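(* Let $n=3$, $s_0,s_1,s_2,b_1,b_2\in\mathbb{R}$, $S=s_0+s_1+s_2$. Assume (a) $b_1,b_2>0$; (b) $b_1+b_2\ge\frac12$; (c) $S\ge 2-(b_1+b_2)$; (d) $S\ge\frac32-b_1$; (e) $S\ge\frac32-b_2$; (f) $S\ge1$; (g) $s_0+2(s_1+s_2)\ge\frac32$; (h) $s_1+s_2\ge0$; (i) $s_0+s_2\ge0$; (j) $s_0+s_1\ge0$; together with the exceptions: if $b_1=\frac12$ then (c) and (d) are strict; if $b_2=\frac12$ then (c) and (e) are strict; if $b_1+b_2=1$ then (c) is strict; (g) is strict whenever $s_0\in\{\frac12,\frac32,\frac32-2b_1,\frac32-2b_2,\frac52-2(b_1+b_2)\}$; if one of (c)–(f) is an equality, then (h), (i), (j) are strict. Then $\begin{pmatrix} s_0 & s_1 & s_2\\ 0 & b_1 & b_2\end{pmatrix}$ is a product.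
   Context: For $u\in\mathcal S(\mathbb{R}^{1+n})$ let $\widetilde u(\tau,\xi)=\iint e^{-i(t\tau+x\cdot\xi)}u(t,x)\,dt\,dx$, $(\tau,\xi)\in\mathbb{R}\times\mathbb{R}^n$, and $\langle x\rangle=(1+|x|^2)^{1/2}$. For $s,b\in\mathbb{R}$ the wave-Sobolev space $H^{s,b}=H^{s,b}(\mathbb{R}^{1+n})$ is the completion of $\mathcal S(\mathbb{R}^{1+n})$ with respect to the norm $\|u\|_{H^{s,b}}=\|\langle\xi\rangle^s\langle|\tau|-|\xi|\rangle^b\widetilde u(\tau,\xi)\|_{L^2_{\tau,\xi}}$. A real matrix $\begin{pmatrix} s_0 & s_1 & s_2\\ b_0 & b_1 & b_2\end{pmatrix}$ is called a product (in dimension $n$) if there is a constant $C$ such that $\|uv\|_{H^{-s_0,-b_0}}\le C\|u\|_{H^{s_1,b_1}}\|v\|_{H^{s_2,b_2}}$ for all $u,v\in\mathcal S(\mathbb{R}^{1+n})$. "Strict" means the inequality holds with $>$. *)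

theory Defs
  imports "HOL-Analysis.Analysis"
begin

text \<open>Space-time R^(1+n) is modelled as real \<times> (real^'n); a point is (t,x).
  The inner product (t,x)\<bullet>(tau,xi) = t*tau + x\<bullet>xi.\<close>

fun pderivs :: "'a list \<Rightarrow> ('a::euclidean_space \<Rightarrow> complex) \<Rightarrow> 'a \<Rightarrow> complex" where
  "pderivs [] f = f"
| "pderivs (v # vs) f = (\<lambda>x. frechet_derivative (pderivs vs f) (at x) v)"

definition schwartz :: "('a::euclidean_space \<Rightarrow> complex) \<Rightarrow> bool" where
  "schwartz f \<longleftrightarrow>
     (\<forall>ds. set ds \<subseteq> Basis \<longrightarrow>
        (\<forall>x. pderivs ds f differentiable (at x)) \<and>
        (\<forall>k::nat. \<exists>C. \<forall>x. norm x ^ k * cmod (pderivs ds f x) \<le> C))"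

definition fourier :: "('a::euclidean_space \<Rightarrow> complex) \<Rightarrow> 'a \<Rightarrow> complex" where
  "fourier u p = (LINT q|lborel. cis (- (q \<bullet> p)) * u q)"

definition jbr :: "real \<Rightarrow> real" where
  "jbr r = (1 + r\<^sup>2) powr (1/2)"

definition hsb_norm :: "real \<Rightarrow> real \<Rightarrow> (real \<times> (real^'n) \<Rightarrow> complex) \<Rightarrow> real" where
  "hsb_norm s b u = sqrt (LINT p|lborel.
     (jbr (norm (snd p)) powr s * jbr (\<bar>fst p\<bar> - norm (snd p)) powr b * cmod (fourier u p))\<^sup>2)"

definition is_product :: "'n::finite itself \<Rightarrow> real \<Rightarrow> real \<Rightarrow> real \<Rightarrow> real \<Rightarrow> real \<Rightarrow> real \<Rightarrow> bool" where
  "is_product _ s0 s1 s2 b0 b1 b2 \<longleftrightarrow>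
     (\<exists>C. \<forall>(u :: real \<times> (real^'n) \<Rightarrow> complex) v. schwartz u \<longrightarrow> schwartz v \<longrightarrow>
        hsb_norm (-s0) (-b0) (\<lambda>q. u q * v q) \<le> C * hsb_norm s1 b1 u * hsb_norm s2 b2 v)"

end

theory Submission
  imports Defs "HOL-Probability.Probability"
begin

text \<open>On the Fourier side the claim is a weighted trilinear estimate for nonnegative functions. Decompose
  dyadically into frequencies \<open>\<langle>\<xi>\<rangle> ~ N\<close> and modulations \<open>\<langle>|\<tau>| - |\<xi>|\<rangle> ~ L\<close>. By Cauchy-Schwarz a dyadic
  block is controlled by the volume of the set where two thickened light cones meet, which in three
  dimensions is computed exactly because the squared distances to two foci are affine functions of
  cylindrical coordinates. This gives the factor \<open>N\<^sub>1\<^sup>2 L\<^sub>m\<^sub>i\<^sub>n min(L\<^sub>m\<^sub>a\<^sub>x, N\<^sub>1)\<close> if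
  \<open>N\<^sub>1 \<le> N\<^sub>2 ~ N\<^sub>0\<close>. If \<open>N\<^sub>0\<close> is much smaller than \<open>N\<^sub>1 ~ N\<^sub>2\<close>, one localizes both frequencies to balls
  of radius \<open>N\<^sub>0\<close> and replaces the interaction by two self-interactions, which gives
  \<open>N\<^sub>0 N\<^sub>1 L\<^sub>m\<^sub>i\<^sub>n min(L\<^sub>m\<^sub>a\<^sub>x, N\<^sub>0\<^sup>2 / N\<^sub>1)\<close>. Summing first over \<open>L\<close> and then over \<open>N\<close> by Schur's test uses
  exactly the hypotheses on the exponents.\<close>

section \<open>Cauchy-Schwarz and convolutions\<close>

text \<open>Where two thickened cones meet, the volume is about
  \<open>R1 * R2 * w * L1 * L2 / d\<close>, with \<open>d\<close> the distance of the foci, which is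
  the output frequency, and \<open>w\<close> the width of a window for the norm of
  \<open>\<xi>\<close>. The division by \<open>d\<close> is the obstacle: for two high inputs and a
  low output \<open>N0\<close> it gives only \<open>N1^2 * L1 * L2\<close>, even after localization
  to balls of radius \<open>N0\<close>, where \<open>w\<close> is about \<open>N0\<close>. In a
  self-interaction of such a ball the foci are at distance about \<open>N1\<close>, and the same
  formula gives \<open>N0 * N1 * L1 * L2\<close>. The trivial volume of the localized set is
  \<open>N0^3 * L_min\<close>, and the two bounds cross at the modulation \<open>N0^2 / N1\<close>.
  This crossing point drops below 1 at \<open>N0 = N1^(1/2)\<close>, which puts a kink into the
  exponent there; (g) says that the exponent is nonpositive at the kink. Both sums are bounded by
  geometric series, which asks for nonzero slopes: this keeps out \<open>b1 = 1/2\<close> and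
  \<open>b2 = 1/2\<close>, where the exponent is lowered first, and singles out the exceptional
  values of \<open>s0\<close>.\<close>

lemma ennreal_power2_le_cancel:
  fixes a b :: ennreal
  assumes "a\<^sup>2 \<le> b\<^sup>2" shows "a \<le> b"
proof (rule ccontr)
  assume "\<not> a \<le> b"
  then have ba: "b < a" by simp
  then obtain r where r: "b = ennreal r" "0 \<le> r" by (cases b) auto
  show False
  proof (cases a)
    case (real s)
    with ba r have "r < s" by (simp add: ennreal_less_iff)
    then have "r\<^sup>2 < s\<^sup>2" using r by (intro power_strict_mono) auto
    moreover have "s\<^sup>2 \<le> r\<^sup>2" using assms real r by (simp add: ennreal_power)
    ultimately show False by simp
  next
    case top
    with assms r show False by (simp add: ennreal_power power2_eq_square ennreal_top_mult top_unique ennreal_mult[symmetric])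
  qed
qed

lemma ennreal_lincomb:
  assumes "0 \<le> a" "0 \<le> x" "0 \<le> b" "0 \<le> y"
  shows "ennreal a * ennreal x + ennreal b * ennreal y = ennreal (a * x + b * y)"
proof -
  have "ennreal (a * x + b * y) = ennreal (a * x) + ennreal (b * y)"
    using assms by (intro ennreal_plus) auto
  also have "\<dots> = ennreal a * ennreal x + ennreal b * ennreal y"
    using assms by (simp only: ennreal_mult)
  finally show ?thesis ..
qed

text \<open>The weighted arithmetic-geometric mean inequality turns a quadratic hypothesis into a
  bound linear in \<open>X\<close> and \<open>Y\<close>. Such a bound can be integrated, and the
  weight \<open>l\<close> is optimized only afterwards.\<close>

lemma ennreal_amgm:
  fixes T X Y :: ennreal
  assumes T: "T\<^sup>2 \<le> X * Y" and l: "0 < l"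
  shows "2 * T \<le> ennreal l * X + ennreal (1/l) * Y"
proof (cases X)
  case top
  then show ?thesis using l by (simp add: ennreal_mult_top)
next
  case x: (real x)
  show ?thesis
  proof (cases Y)
    case top
    then show ?thesis using l by (simp add: ennreal_mult_top)
  next
    case y: (real y)
    have "(2 * T)\<^sup>2 = 4 * T\<^sup>2" by (simp add: power_mult_distrib)
    also have "\<dots> \<le> 4 * (X * Y)" by (intro mult_left_mono T) simp
    also have "\<dots> = ennreal (4 * (x * y))" using x y by (simp add: ennreal_mult)
    also have "\<dots> \<le> ennreal ((l * x + 1 / l * y)\<^sup>2)"
    proof (rule ennreal_leI)
      have "4 * (x*y) = 4 * ((l*x) * (1/l*y))" using l by (simp add: field_simps)
      also have "\<dots> \<le> (l*x + 1/l*y)\<^sup>2"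
        using zero_le_power2[of "l*x - 1/l*y"] by (simp add: power2_eq_square algebra_simps)
      finally show "4 * (x*y) \<le> (l*x + 1/l*y)\<^sup>2" .
    qed
    also have "\<dots> = (ennreal l * X + ennreal (1/l) * Y)\<^sup>2"
    proof -
      have "ennreal l * X + ennreal (1/l) * Y = ennreal (l * x + 1 / l * y)"
        using x y l by (simp only: ennreal_lincomb less_imp_le zero_le_divide_1_iff)
      moreover have "0 \<le> l * x + 1 / l * y" using x y l by simp
      ultimately show ?thesis by (simp only: ennreal_power)
    qed
    finally show ?thesis by (rule ennreal_power2_le_cancel)
  qed
qed

text \<open>Assuming \<open>T\<^sup>2 \<le> X * Y\<close> pointwise, rather than \<open>T = f * g\<close>, avoids square roots in \<^typ>\<open>ennreal\<close>.\<close>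

lemma nn_integral_Cauchy_Schwarz:
  assumes [measurable]: "X \<in> borel_measurable M" "Y \<in> borel_measurable M" "T \<in> borel_measurable M"
    and le: "\<And>x. x \<in> space M \<Longrightarrow> (T x)\<^sup>2 \<le> X x * Y x"
  shows "(\<integral>\<^sup>+x. T x \<partial>M)\<^sup>2 \<le> (\<integral>\<^sup>+x. X x \<partial>M) * (\<integral>\<^sup>+x. Y x \<partial>M)"
proof -
  let ?A = "\<integral>\<^sup>+x. X x \<partial>M" and ?B = "\<integral>\<^sup>+x. Y x \<partial>M"
  have zero: "(\<integral>\<^sup>+x. T x \<partial>M) = 0" if "?A = 0 \<or> ?B = 0"
  proof -
    have "AE x in M. X x = 0 \<or> Y x = 0"
      using that by (auto simp: nn_integral_0_iff_AE elim: eventually_mono)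
    then have "AE x in M. T x = 0"
      using AE_space
    proof eventually_elim
      case (elim x)
      with le[of x] show ?case by auto
    qed
    then show ?thesis by (simp add: nn_integral_0_iff_AE)
  qed
  \<comment> \<open>As \<open>0 * top = 0\<close>, a vanishing integral has to be separated from an
    infinite one.\<close>
  consider "?A = 0 \<or> ?B = 0" | "?A \<noteq> 0" "?B \<noteq> 0" "?A = top \<or> ?B = top"
    | "?A \<noteq> 0" "?B \<noteq> 0" "?A \<noteq> top" "?B \<noteq> top" by blast
  then show ?thesis
  proof cases
    case 1
    then show ?thesis using zero by simp
  next
    case 2
    then have "?A * ?B = top" by (auto simp: ennreal_mult_top ennreal_top_mult)
    then show ?thesis by simp
  next
    case 3
    obtain a where a: "?A = ennreal a" "0 < a"
      using 3(1,3) by (cases ?A) (auto simp: less_le)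
    obtain b where b: "?B = ennreal b" "0 < b"
      using 3(2,4) by (cases ?B) (auto simp: less_le)
    \<comment> \<open>This weight makes \<open>l * a\<close> and \<open>1/l * b\<close> equal, so
      their sum is \<open>2 * sqrt (a * b)\<close>.\<close>
    define l where "l = sqrt (b / a)"
    have l: "0 < l" using a b by (simp add: l_def)
    have "2 * (\<integral>\<^sup>+x. T x \<partial>M) = (\<integral>\<^sup>+x. 2 * T x \<partial>M)"
      by (simp add: nn_integral_cmult)
    also have "\<dots> \<le> (\<integral>\<^sup>+x. ennreal l * X x + ennreal (1/l) * Y x \<partial>M)"
      by (intro nn_integral_mono ennreal_amgm le l)
    also have "\<dots> = ennreal l * ?A + ennreal (1/l) * ?B"
      by (simp add: nn_integral_add nn_integral_cmult)
    also have "\<dots> = ennreal (l * a + 1/l * b)"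
      using a b l by (simp only: ennreal_lincomb less_imp_le zero_le_divide_1_iff)
    also have "l * a + 1/l * b = 2 * sqrt (a * b)"
    proof -
      have "l * a = sqrt (a*b)"
        using a b by (simp add: l_def real_sqrt_mult real_sqrt_divide field_simps)
      moreover have "1/l * b = sqrt (a*b)"
        using a b by (simp add: l_def real_sqrt_mult real_sqrt_divide field_simps)
      ultimately show ?thesis by simp
    qed
    also have "ennreal (2 * sqrt (a*b)) = 2 * ennreal (sqrt (a * b))"
      using a b by (simp add: ennreal_mult)
    finally have "(\<integral>\<^sup>+x. T x \<partial>M) \<le> ennreal (sqrt (a * b))"
      by (simp add: ennreal_mult_le_mult_iff)
    then have "(\<integral>\<^sup>+x. T x \<partial>M)\<^sup>2 \<le> (ennreal (sqrt (a * b)))\<^sup>2"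
      by (intro power_mono) auto
    also have "\<dots> = ?A * ?B" using a b by (simp add: ennreal_power ennreal_mult)
    finally show ?thesis .
  qed
qed

section \<open>Convolutions and the trilinear form\<close>

lemma nn_integral_lborel_translate:
  fixes f :: "'a::euclidean_space \<Rightarrow> ennreal"
  assumes [measurable]: "f \<in> borel_measurable borel"
  shows "(\<integral>\<^sup>+x. f (c + x) \<partial>lborel) = (\<integral>\<^sup>+x. f x \<partial>lborel)"
  by (subst (2) lborel_distr_plus[symmetric, of c]) (simp add: nn_integral_distr)

lemma nn_integral_lborel_reflect:
  fixes f :: "'a::euclidean_space \<Rightarrow> ennreal"
  assumes [measurable]: "f \<in> borel_measurable borel"
  shows "(\<integral>\<^sup>+x. f (c - x) \<partial>lborel) = (\<integral>\<^sup>+x. f x \<partial>lborel)"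
  by (subst (2) lborel_affine[of "-1" c]) (simp_all add: nn_integral_distr nn_integral_density)

text \<open>Multiplication becomes convolution on the Fourier side; this is the convolution of
  \<open>F\<close> and \<open>G\<close> tested against a dual function \<open>H\<close>. With values
  in \<open>ennreal\<close>, exchanging integrals and sums requires measurability only.\<close>

definition tri :: "('a::euclidean_space \<Rightarrow> ennreal) \<Rightarrow> ('a \<Rightarrow> ennreal) \<Rightarrow> ('a \<Rightarrow> ennreal) \<Rightarrow> ennreal" where
  "tri F G H = (\<integral>\<^sup>+p. \<integral>\<^sup>+q. H p * (F q * G (p - q)) \<partial>lborel \<partial>lborel)"

definition l2sq :: "('a::euclidean_space \<Rightarrow> ennreal) \<Rightarrow> ennreal" where
  "l2sq F = (\<integral>\<^sup>+x. (F x)\<^sup>2 \<partial>lborel)"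

definition conv :: "('a::euclidean_space \<Rightarrow> ennreal) \<Rightarrow> ('a \<Rightarrow> ennreal) \<Rightarrow> 'a \<Rightarrow> ennreal" where
  "conv F G p = (\<integral>\<^sup>+q. F q * G (p - q) \<partial>lborel)"

lemma conv_measurable [measurable]:
  assumes [measurable]: "F \<in> borel_measurable borel" "G \<in> borel_measurable borel"
  shows "conv F G \<in> borel_measurable borel"
  unfolding conv_def by measurable

lemma tri_eq_conv:
  assumes [measurable]: "F \<in> borel_measurable borel" "G \<in> borel_measurable borel"
  shows "tri F G H = (\<integral>\<^sup>+p. H p * conv F G p \<partial>lborel)"
  unfolding tri_def conv_def by (simp add: nn_integral_cmult)

lemma conv_commute:
  assumes [measurable]: "F \<in> borel_measurable borel" "G \<in> borel_measurable borel"
  shows "conv F G p = conv G F p"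
  unfolding conv_def
  by (subst nn_integral_lborel_reflect[where c=p, symmetric]) (simp_all add: mult.commute)

lemma tri_commute:
  assumes [measurable]: "F \<in> borel_measurable borel" "G \<in> borel_measurable borel"
  shows "tri F G H = tri G F H"
  by (simp add: tri_eq_conv conv_commute[of F G])

lemma tri_mono:
  assumes "\<And>p. F p \<le> F' p" "\<And>p. G p \<le> G' p" "\<And>p. H p \<le> H' p"
  shows "tri F G H \<le> tri F' G' H'"
  unfolding tri_def by (intro nn_integral_mono mult_mono assms) auto

lemma l2sq_mono: "(\<And>p. F p \<le> F' p) \<Longrightarrow> l2sq F \<le> l2sq F'"
  unfolding l2sq_def by (intro nn_integral_mono power_mono) auto

lemma nn_integral_conv:
  assumes [measurable]: "F \<in> borel_measurable borel" "G \<in> borel_measurable borel"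
  shows "(\<integral>\<^sup>+p. conv F G p \<partial>lborel) = (\<integral>\<^sup>+x. F x \<partial>lborel) * (\<integral>\<^sup>+x. G x \<partial>lborel)"
proof -
  have "(\<integral>\<^sup>+p. conv F G p \<partial>lborel) = (\<integral>\<^sup>+q. \<integral>\<^sup>+p. F q * G (p - q) \<partial>lborel \<partial>lborel)"
    unfolding conv_def by (rule lborel_pair.Fubini') measurable
  also have "\<dots> = (\<integral>\<^sup>+q. F q * (\<integral>\<^sup>+x. G x \<partial>lborel) \<partial>lborel)"
  proof (rule nn_integral_cong)
    fix q
    have "(\<integral>\<^sup>+p. G (p - q) \<partial>lborel) = (\<integral>\<^sup>+x. G x \<partial>lborel)"
      using nn_integral_lborel_translate[of G "-q"] by simp
    then show "(\<integral>\<^sup>+p. F q * G (p - q) \<partial>lborel) = F q * (\<integral>\<^sup>+x. G x \<partial>lborel)"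
      by (simp add: nn_integral_cmult)
  qed
  also have "\<dots> = (\<integral>\<^sup>+x. F x \<partial>lborel) * (\<integral>\<^sup>+x. G x \<partial>lborel)"
    by (simp add: nn_integral_multc)
  finally show ?thesis .
qed

text \<open>Cauchy-Schwarz against the indicator of the points \<open>q\<close> that contribute at
  \<open>p\<close>. The geometry of the cones enters the proof through the volume \<open>c\<close>
  of this set.\<close>

lemma conv_sq_le:
  assumes [measurable]: "F \<in> borel_measurable borel" "G \<in> borel_measurable borel"
    and c: "emeasure lborel {q. F q \<noteq> 0 \<and> G (p - q) \<noteq> 0} \<le> c"
  shows "(conv F G p)\<^sup>2 \<le> c * conv (\<lambda>q. (F q)\<^sup>2) (\<lambda>q. (G q)\<^sup>2) p"
proof -
  let ?E = "{q. F q \<noteq> 0 \<and> G (p - q) \<noteq> 0}"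
  have [measurable]: "?E \<in> sets borel" by measurable
  have "(conv F G p)\<^sup>2 \<le> (\<integral>\<^sup>+q. indicator ?E q \<partial>lborel) * conv (\<lambda>q. (F q)\<^sup>2) (\<lambda>q. (G q)\<^sup>2) p"
    unfolding conv_def
    by (rule nn_integral_Cauchy_Schwarz) (auto simp: power_mult_distrib split: split_indicator)
  also have "\<dots> \<le> c * conv (\<lambda>q. (F q)\<^sup>2) (\<lambda>q. (G q)\<^sup>2) p"
    by (intro mult_right_mono) (simp_all add: c)
  finally show ?thesis .
qed

lemma tri_sq_le_conv:
  assumes [measurable]: "F \<in> borel_measurable borel" "G \<in> borel_measurable borel" "H \<in> borel_measurable borel"
  shows "(tri F G H)\<^sup>2 \<le> l2sq H * l2sq (conv F G)"
  unfolding tri_eq_conv[OF assms(1,2)] l2sq_def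
  by (rule nn_integral_Cauchy_Schwarz) (auto simp: power_mult_distrib)

lemma l2sq_conv_le:
  assumes [measurable]: "F \<in> borel_measurable borel" "G \<in> borel_measurable borel"
    and c: "\<And>p. emeasure lborel {q. F q \<noteq> 0 \<and> G (p - q) \<noteq> 0} \<le> c"
  shows "l2sq (conv F G) \<le> c * (l2sq F * l2sq G)"
proof -
  have "l2sq (conv F G) \<le> (\<integral>\<^sup>+p. c * conv (\<lambda>q. (F q)\<^sup>2) (\<lambda>q. (G q)\<^sup>2) p \<partial>lborel)"
    unfolding l2sq_def by (intro nn_integral_mono conv_sq_le c) auto
  also have "\<dots> = c * (l2sq F * l2sq G)"
    by (simp add: nn_integral_cmult nn_integral_conv l2sq_def)
  finally show ?thesis .
qed

text \<open>In contrast to \<open>l2sq_conv_le\<close>, the volume has to be bounded only for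
  \<open>p\<close> in the support of \<open>H\<close>, so a lower bound on the output frequency can
  be used in estimating it.\<close>

lemma tri_block:
  assumes [measurable]: "F \<in> borel_measurable borel" "G \<in> borel_measurable borel" "H \<in> borel_measurable borel"
    and c: "\<And>p. H p \<noteq> 0 \<Longrightarrow> emeasure lborel {q. F q \<noteq> 0 \<and> G (p - q) \<noteq> 0} \<le> c"
  shows "(tri F G H)\<^sup>2 \<le> c * (l2sq F * l2sq G * l2sq H)"
proof -
  let ?K = "conv (\<lambda>q. (F q)\<^sup>2) (\<lambda>q. (G q)\<^sup>2)"
  have "(tri F G H)\<^sup>2 \<le> (\<integral>\<^sup>+p. (H p)\<^sup>2 \<partial>lborel) * (\<integral>\<^sup>+p. c * ?K p \<partial>lborel)"
    unfolding tri_eq_conv[OF assms(1,2)]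
  proof (rule nn_integral_Cauchy_Schwarz)
    fix p
    show "(H p * conv F G p)\<^sup>2 \<le> (H p)\<^sup>2 * (c * ?K p)"
    proof (cases "H p = 0")
      case False
      then show ?thesis unfolding power_mult_distrib
        by (intro mult_left_mono conv_sq_le c) auto
    qed simp
  qed auto
  also have "\<dots> = c * (l2sq F * l2sq G * l2sq H)"
    by (simp add: nn_integral_cmult nn_integral_conv l2sq_def mult_ac)
  finally show ?thesis .
qed

section \<open>Autocorrelations\<close>

definition acorr :: "('a::euclidean_space \<Rightarrow> ennreal) \<Rightarrow> 'a \<Rightarrow> ennreal" where
  "acorr F d = (\<integral>\<^sup>+q. F q * F (d + q) \<partial>lborel)"

lemma acorr_measurable [measurable]:
  assumes [measurable]: "F \<in> borel_measurable borel"
  shows "acorr F \<in> borel_measurable borel"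
  unfolding acorr_def by measurable

text \<open>The squared convolution is an integral over two points \<open>a\<close> and
  \<open>a'\<close>. With \<open>a' = d + a\<close> and \<open>d\<close> fixed, integrating first in
  \<open>p\<close> and then in \<open>a\<close> separates the factors of \<open>G\<close> from those
  of \<open>F\<close>.\<close>

lemma l2sq_conv_eq_acorr:
  assumes [measurable]: "F \<in> borel_measurable borel" "G \<in> borel_measurable borel"
  shows "l2sq (conv F G) = (\<integral>\<^sup>+d. acorr F d * acorr G d \<partial>lborel)"
proof -
  have "l2sq (conv F G) = (\<integral>\<^sup>+p. \<integral>\<^sup>+a. \<integral>\<^sup>+d. F a * G (p - a) * (F (d + a) * G (p - (d + a))) \<partial>lborel \<partial>lborel \<partial>lborel)"
    unfolding l2sq_def
  proof (rule nn_integral_cong)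
    fix p
    have "(conv F G p)\<^sup>2 = (\<integral>\<^sup>+a. F a * G (p - a) * conv F G p \<partial>lborel)"
      by (simp add: nn_integral_multc conv_def[symmetric] power2_eq_square)
    also have "\<dots> = (\<integral>\<^sup>+a. \<integral>\<^sup>+d. F a * G (p - a) * (F (d + a) * G (p - (d + a))) \<partial>lborel \<partial>lborel)"
    proof (rule nn_integral_cong)
      fix a
      have "conv F G p = (\<integral>\<^sup>+d. F (d + a) * G (p - (d + a)) \<partial>lborel)"
        unfolding conv_def by (subst nn_integral_lborel_translate[where c=a, symmetric]) (auto simp: add.commute)
      then show "F a * G (p - a) * conv F G p = (\<integral>\<^sup>+d. F a * G (p - a) * (F (d + a) * G (p - (d + a))) \<partial>lborel)"
        by (simp add: nn_integral_cmult)
    qed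
    finally show "(conv F G p)\<^sup>2 = \<dots>" .
  qed
  also have "\<dots> = (\<integral>\<^sup>+p. \<integral>\<^sup>+d. \<integral>\<^sup>+a. F a * G (p - a) * (F (d + a) * G (p - (d + a))) \<partial>lborel \<partial>lborel \<partial>lborel)"
    by (intro nn_integral_cong lborel_pair.Fubini') measurable
  also have "\<dots> = (\<integral>\<^sup>+d. \<integral>\<^sup>+p. \<integral>\<^sup>+a. F a * G (p - a) * (F (d + a) * G (p - (d + a))) \<partial>lborel \<partial>lborel \<partial>lborel)"
    by (rule lborel_pair.Fubini') measurable
  also have "\<dots> = (\<integral>\<^sup>+d. \<integral>\<^sup>+a. \<integral>\<^sup>+p. F a * G (p - a) * (F (d + a) * G (p - (d + a))) \<partial>lborel \<partial>lborel \<partial>lborel)"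
    by (intro nn_integral_cong lborel_pair.Fubini') measurable
  also have "\<dots> = (\<integral>\<^sup>+d. acorr F d * acorr G d \<partial>lborel)"
  proof (rule nn_integral_cong)
    fix d
    have "(\<integral>\<^sup>+p. G (p - a) * G (p - (d + a)) \<partial>lborel) = acorr G d" for a
      unfolding acorr_def
      by (subst nn_integral_lborel_translate[where c="d + a", symmetric]) (auto simp: algebra_simps)
    moreover have "(\<integral>\<^sup>+p. F a * G (p - a) * (F (d + a) * G (p - (d + a))) \<partial>lborel) =
        F a * F (d + a) * (\<integral>\<^sup>+p. G (p - a) * G (p - (d + a)) \<partial>lborel)" for a
    proof -
      have "(\<integral>\<^sup>+p. F a * G (p - a) * (F (d + a) * G (p - (d + a))) \<partial>lborel) =
        (\<integral>\<^sup>+p. F a * F (d + a) * (G (p - a) * G (p - (d + a))) \<partial>lborel)"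
        by (intro nn_integral_cong) (simp only: mult_ac)
      also have "\<dots> = F a * F (d + a) * (\<integral>\<^sup>+p. G (p - a) * G (p - (d + a)) \<partial>lborel)"
        by (rule nn_integral_cmult) measurable
      finally show ?thesis .
    qed
    ultimately have "(\<integral>\<^sup>+p. F a * G (p - a) * (F (d + a) * G (p - (d + a))) \<partial>lborel) = F a * F (d + a) * acorr G d" for a
      by simp
    then show "(\<integral>\<^sup>+a. \<integral>\<^sup>+p. F a * G (p - a) * (F (d + a) * G (p - (d + a))) \<partial>lborel \<partial>lborel) = acorr F d * acorr G d"
      by (simp add: nn_integral_multc acorr_def[of F])
  qed
  finally show ?thesis .
qed

text \<open>This replaces \<open>\<parallel>u v\<parallel>\<^sub>2 \<le> \<parallel>u\<parallel>\<^sub>4 \<parallel>v\<parallel>\<^sub>4\<close>; it trades the interaction of opposite waves, for which the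
  level sets below degenerate, for self-interactions.\<close>

lemma l2sq_conv_sq_le:
  assumes [measurable]: "F \<in> borel_measurable borel" "G \<in> borel_measurable borel"
  shows "(l2sq (conv F G))\<^sup>2 \<le> l2sq (conv F F) * l2sq (conv G G)"
  unfolding l2sq_conv_eq_acorr[OF assms] l2sq_conv_eq_acorr[OF assms(1,1)] l2sq_conv_eq_acorr[OF assms(2,2)]
  by (rule nn_integral_Cauchy_Schwarz) (auto simp: power2_eq_square mult_ac)

section \<open>Volumes of intersections of thickened cones\<close>

lemma continuous_on_vector3:
  "continuous_on UNIV (\<lambda>(x :: real, y :: real, z :: real). vector [x, y, z] :: real^3)"
proof -
  have "(\<lambda>(x, y, z). vector [x, y, z] :: real^3) =
      (\<lambda>p. fst p *\<^sub>R axis 1 1 + fst (snd p) *\<^sub>R axis 2 1 + snd (snd p) *\<^sub>R axis 3 1)"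
    by (auto simp: fun_eq_iff vec_eq_iff forall_3 axis_def)
  then show ?thesis by (simp add: continuous_intros)
qed

lemma box_Pair: "box (a, c) (b, d) = box a b \<times> box c d"
  by (auto simp: Basis_prod_def ball_Un box_def)

text \<open>Lebesgue measure is determined by its values on boxes. The triple of coordinates is
  needed to single out the first axis and to treat the other two as a plane.\<close>

lemma lborel_real3:
  "(lborel :: (real^3) measure) = distr lborel borel (\<lambda>(x, y, z). vector [x, y, z])"
proof (rule lborel_eqI)
  let ?v = "\<lambda>(x, y, z). vector [x, y, z] :: real^3"
  have [measurable]: "?v \<in> borel \<rightarrow>\<^sub>M borel"
    by (rule borel_measurable_continuous_onI) (rule continuous_on_vector3)
  fix l u :: "real^3" assume le: "\<And>b. b \<in> Basis \<Longrightarrow> l \<bullet> b \<le> u \<bullet> b"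
  have le': "l $ i \<le> u $ i" for i
    using le[of "axis i 1"] by (simp add: axis_in_Basis_iff cart_eq_inner_axis)
  have "?v -` box l u = box (l$1, l$2, l$3) (u$1, u$2, u$3)"
    by (auto simp: mem_box_cart forall_3 box_Pair box_real)
  then have "emeasure (distr lborel borel ?v) (box l u) = emeasure lborel (box (l$1, l$2, l$3) (u$1, u$2, u$3))"
    by (simp add: emeasure_distr)
  also have "\<dots> = ennreal ((u$1 - l$1) * ((u$2 - l$2) * (u$3 - l$3)))"
  proof -
    have "emeasure (lborel \<Otimes>\<^sub>M lborel \<Otimes>\<^sub>M lborel) (box (l$1) (u$1) \<times> box (l$2) (u$2) \<times> box (l$3) (u$3)) =
        emeasure lborel (box (l$1) (u$1)) * (emeasure lborel (box (l$2) (u$2)) * emeasure lborel (box (l$3) (u$3)))"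
      by (subst lborel.emeasure_pair_measure_Times sigma_finite_measure.emeasure_pair_measure_Times | simp add: lborel_prod sigma_finite_lborel)+
    also have "\<dots> = ennreal ((u$1 - l$1) * ((u$2 - l$2) * (u$3 - l$3)))"
      using le'[of 1] le'[of 2] le'[of 3] by (simp add: ennreal_mult)
    finally show ?thesis by (simp add: box_Pair lborel_prod)
  qed
  also have "\<dots> = ennreal (\<Prod>b\<in>Basis. (u - l) \<bullet> b)"
  proof -
    have "(\<Prod>b\<in>Basis. (u - l) \<bullet> b) = (\<Prod>i\<in>UNIV. (u - l) $ i)"
      by (simp add: Basis_vec_def cart_eq_inner_axis prod.UNION_disjoint axis_eq_axis)
    also have "\<dots> = (u$1 - l$1) * ((u$2 - l$2) * (u$3 - l$3))"
      unfolding UNIV_3 by simp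
    finally show ?thesis by simp
  qed
  finally show "emeasure (distr lborel borel ?v) (box l u) = ennreal (\<Prod>b\<in>Basis. (u - l) \<bullet> b)" .
qed simp

text \<open>A disc of squared radius \<open>t\<close> has area \<open>pi * t\<close>, which is
  linear in \<open>t\<close>, so the squared radius has constant density. This is special to
  cross-sections of dimension two, hence to space dimension three.\<close>

lemma distr_norm_sq_plane:
  "distr (lborel :: (real \<times> real) measure) borel (\<lambda>(y, z). y\<^sup>2 + z\<^sup>2) =
   density lborel (\<lambda>t. ennreal pi * indicator {0..} t)"
proof (rule measure_eqI_generator_eq)
  let ?E = "range (\<lambda>t::real. {..t})"
  let ?M = "distr (lborel :: (real \<times> real) measure) borel (\<lambda>(y, z). y\<^sup>2 + z\<^sup>2)"
  let ?N = "density lborel (\<lambda>t. ennreal pi * indicator {0..} t)"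
  have [measurable]: "(\<lambda>(y, z). y\<^sup>2 + z\<^sup>2) \<in> borel_measurable (borel :: (real \<times> real) measure)"
    unfolding split_beta' by (intro borel_measurable_continuous_onI continuous_intros)
  have M: "emeasure ?M {..t} = (if 0 \<le> t then ennreal (pi * t) else 0)" for t :: real
  proof -
    have "emeasure ?M {..t} = emeasure lborel ((\<lambda>(y, z). y\<^sup>2 + z\<^sup>2) -` {..t} :: (real \<times> real) set)"
      by (subst emeasure_distr) simp_all
    also have "(\<lambda>(y, z). y\<^sup>2 + z\<^sup>2) -` {..t} = (if 0 \<le> t then cball (0 :: real \<times> real) (sqrt t) else {})"
    proof -
      have "y\<^sup>2 + z\<^sup>2 \<le> t \<Longrightarrow> 0 \<le> t" for y z :: real
        using zero_le_power2[of y] zero_le_power2[of z] by linarith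
      moreover have "norm (y, z) = sqrt (y\<^sup>2 + z\<^sup>2)" for y z :: real
        by (simp add: norm_Pair)
      ultimately show ?thesis by (auto simp: dist_norm norm_minus_commute)
    qed
    also have "emeasure lborel \<dots> = (if 0 \<le> t then ennreal (pi * t) else 0)"
      by (simp add: emeasure_cball eval_unit_ball_vol)
    finally show ?thesis .
  qed
  have N: "emeasure ?N {..t} = (if 0 \<le> t then ennreal (pi * t) else 0)" for t :: real
  proof -
    have "emeasure ?N {..t} = ennreal pi * emeasure lborel {0..t}"
      by (subst emeasure_density)
         (auto simp: nn_integral_cmult mult.assoc indicator_inter_arith[symmetric] Int_commute atLeastAtMost_def simp flip: nn_integral_indicator intro!: nn_integral_cong)
    then show ?thesis by (auto simp: ennreal_mult)
  qed
  show "Int_stable ?E" by (auto simp: Int_stable_def)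
  show "?E \<subseteq> Pow UNIV" by auto
  show "emeasure ?M X = emeasure ?N X" if "X \<in> ?E" for X
    using that M N by auto
  show "sets ?M = sigma_sets UNIV ?E" "sets ?N = sigma_sets UNIV ?E"
    by (simp_all add: borel_eq_atMost)
  show "range (\<lambda>n::nat. {..real n}) \<subseteq> ?E" by auto
  show "(\<Union>n::nat. {..real n}) = UNIV"
    using real_arch_simple by auto
  show "emeasure ?M {..real n} \<noteq> \<infinity>" for n :: nat
    unfolding M by simp
qed

lemma nn_integral_cylindrical:
  fixes \<phi> :: "real \<Rightarrow> real \<Rightarrow> ennreal"
  assumes [measurable]: "case_prod \<phi> \<in> borel_measurable borel"
  shows "(\<integral>\<^sup>+\<xi>. \<phi> (\<xi>$1) ((\<xi>$2)\<^sup>2 + (\<xi>$3)\<^sup>2) \<partial>(lborel :: (real^3) measure)) =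
    (\<integral>\<^sup>+x. \<integral>\<^sup>+t. ennreal pi * indicator {0..} t * \<phi> x t \<partial>lborel \<partial>lborel)"
proof -
  have [measurable]: "(\<lambda>p. \<phi> (f p) (g p)) \<in> borel_measurable M"
    if "f \<in> borel_measurable M" "g \<in> borel_measurable M" for f g and M :: "'m measure"
  proof -
    have "(\<lambda>p. (f p, g p)) \<in> M \<rightarrow>\<^sub>M borel"
      unfolding borel_prod[symmetric] using that by (rule measurable_Pair)
    from measurable_compose[OF this assms] show ?thesis by simp
  qed
  have [measurable]: "(\<lambda>(y, z). y\<^sup>2 + z\<^sup>2) \<in> borel_measurable (borel :: (real \<times> real) measure)"
    unfolding split_beta' by (intro borel_measurable_continuous_onI continuous_intros)
  have m3: "(\<lambda>p. \<phi> (fst p) ((fst (snd p))\<^sup>2 + (snd (snd p))\<^sup>2)) \<in> borel_measurable (borel :: (real \<times> real \<times> real) measure)"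
  proof -
    have [measurable]: "fst \<in> borel_measurable (borel :: (real \<times> real \<times> real) measure)"
      "(\<lambda>p. fst (snd p)) \<in> borel_measurable (borel :: (real \<times> real \<times> real) measure)"
      "(\<lambda>p. snd (snd p)) \<in> borel_measurable (borel :: (real \<times> real \<times> real) measure)"
      by (intro borel_measurable_continuous_onI continuous_intros)+
    show ?thesis by measurable
  qed
  let ?v = "\<lambda>(x, y, z). vector [x, y, z] :: real^3"
  have [measurable]: "?v \<in> borel \<rightarrow>\<^sub>M borel"
    by (rule borel_measurable_continuous_onI) (rule continuous_on_vector3)
  have "(\<integral>\<^sup>+\<xi>. \<phi> (\<xi>$1) ((\<xi>$2)\<^sup>2 + (\<xi>$3)\<^sup>2) \<partial>(lborel :: (real^3) measure)) =
     (\<integral>\<^sup>+p. \<phi> (fst p) ((fst (snd p))\<^sup>2 + (snd (snd p))\<^sup>2) \<partial>(lborel :: (real \<times> real \<times> real) measure))"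
    by (subst lborel_real3, subst nn_integral_distr) (simp_all add: split_beta)
  also have "\<dots> = (\<integral>\<^sup>+x. \<integral>\<^sup>+q. \<phi> x ((fst q)\<^sup>2 + (snd q)\<^sup>2) \<partial>lborel \<partial>lborel)"
    using lborel.nn_integral_fst[of "\<lambda>p. \<phi> (fst p) ((fst (snd p))\<^sup>2 + (snd (snd p))\<^sup>2)" "lborel :: real measure"] m3
    by (simp add: lborel_prod)
  also have "\<dots> = (\<integral>\<^sup>+x. \<integral>\<^sup>+t. ennreal pi * indicator {0..} t * \<phi> x t \<partial>lborel \<partial>lborel)"
  proof (rule nn_integral_cong)
    fix x
    have "(\<integral>\<^sup>+q. \<phi> x ((fst q)\<^sup>2 + (snd q)\<^sup>2) \<partial>lborel) =
      (\<integral>\<^sup>+t. \<phi> x t \<partial>distr (lborel :: (real \<times> real) measure) borel (\<lambda>(y, z). y\<^sup>2 + z\<^sup>2))"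
      by (subst nn_integral_distr) (simp_all add: split_beta)
    also have "\<dots> = (\<integral>\<^sup>+t. ennreal pi * indicator {0..} t * \<phi> x t \<partial>lborel)"
      unfolding distr_norm_sq_plane by (subst nn_integral_density) simp_all
    finally show "(\<integral>\<^sup>+q. \<phi> x ((fst q)\<^sup>2 + (snd q)\<^sup>2) \<partial>lborel) = \<dots>" .
  qed
  finally show ?thesis .
qed

text \<open>Squaring stretches lengths by at most \<open>2 * R\<close> between 0 and
  \<open>R\<close>. If no \<open>u\<close> meets the three constraints, the degenerate interval at 0
  serves.\<close>

lemma sq_interval_bound:
  fixes c l R :: real
  assumes "0 \<le> l" "0 \<le> R"
  obtains lo hi where "0 \<le> hi - lo" "hi - lo \<le> 2 * R * l"
    "\<And>u. 0 \<le> u \<Longrightarrow> u \<in> {c..c + l} \<Longrightarrow> u \<le> R \<Longrightarrow> u\<^sup>2 \<in> {lo..hi}"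
proof (cases "max c 0 \<le> min (c + l) R")
  case True
  let ?c = "max c 0" and ?d = "min (c + l) R"
  have "?d\<^sup>2 - ?c\<^sup>2 = (?d - ?c) * (?d + ?c)" by (simp add: power2_eq_square algebra_simps)
  also have "\<dots> \<le> l * (2 * R)" using True assms by (intro mult_mono) auto
  finally have 1: "?d\<^sup>2 - ?c\<^sup>2 \<le> 2 * R * l" by (simp add: mult_ac)
  show thesis
  proof (rule that[of "?d\<^sup>2" "?c\<^sup>2"])
    show "0 \<le> ?d\<^sup>2 - ?c\<^sup>2" using power_mono[OF True, of 2] by simp
    show "u\<^sup>2 \<in> {?c\<^sup>2..?d\<^sup>2}" if "0 \<le> u" "u \<in> {c..c + l}" "u \<le> R" for u
      using that power_mono[of ?c u 2] power_mono[of u ?d 2] by auto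
  qed (rule 1)
next
  case False
  show thesis
  proof (rule that[of 0 0])
    show "u\<^sup>2 \<in> {0..0}" if "0 \<le> u" "u \<in> {c..c + l}" "u \<le> R" for u
      using that False by auto
  qed (use assms in auto)
qed

text \<open>In cylindrical coordinates \<open>(x, t = |y|\<^sup>2)\<close> around \<open>\<xi>\<^sub>0 = a e\<^sub>1\<close> the squared distances to the two foci,
  \<open>P = x\<^sup>2 + t\<close> and \<open>P + a\<^sup>2 - 2 a x\<close>, have constant Jacobian.\<close>

lemma level_set_volume_axis:
  fixes a R1 R2 w l \<alpha> \<beta> \<sigma> \<sigma>' :: real
  assumes a: "0 < a" and R: "0 \<le> R1" "0 \<le> R2" and w: "0 \<le> w" "0 \<le> l"
    and \<sigma>: "\<sigma>' = 1 \<or> \<sigma>' = -1"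
  shows "emeasure lborel {\<xi> :: real^3. norm \<xi> \<in> {\<alpha>..\<alpha> + w} \<and> norm \<xi> \<le> R1 \<and> norm (a *\<^sub>R axis 1 1 - \<xi>) \<le> R2 \<and>
      \<sigma> * norm \<xi> + \<sigma>' * norm (a *\<^sub>R axis 1 1 - \<xi>) \<in> {\<beta>..\<beta> + l}} \<le> ennreal (2 * pi * R1 * R2 * w * l / a)"
proof -
  define Pr where "Pr r \<rho> \<longleftrightarrow> r \<in> {\<alpha>..\<alpha> + w} \<and> r \<le> R1 \<and> \<rho> \<le> R2 \<and> \<sigma> * r + \<sigma>' * \<rho> \<in> {\<beta>..\<beta> + l}" for r \<rho>
  \<comment> \<open>\<open>B\<close> expresses all conditions through the two squared distances,
    which become the variables of integration.\<close>
  define B where "B = {p. Pr (sqrt (fst p)) (sqrt (snd p))}"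
  have [measurable]: "fst \<in> borel_measurable (borel :: (real \<times> real) measure)"
      "snd \<in> borel_measurable (borel :: (real \<times> real) measure)"
    by (intro borel_measurable_continuous_onI continuous_intros)+
  have [measurable]: "B \<in> sets borel"
    unfolding B_def Pr_def by measurable
  let ?e = "a *\<^sub>R axis 1 1 :: real^3"
  let ?A = "{\<xi>. Pr (norm \<xi>) (norm (?e - \<xi>))}"
  define \<phi> where "\<phi> x t = (indicator B (x\<^sup>2 + t, x\<^sup>2 + t + a\<^sup>2 - 2 * a * x) :: ennreal)" for x t
  have \<phi>m: "case_prod \<phi> \<in> borel_measurable borel"
  proof -
    have "(\<lambda>p. ((fst p)\<^sup>2 + snd p, (fst p)\<^sup>2 + snd p + a\<^sup>2 - 2 * a * fst p)) \<in> (borel :: (real \<times> real) measure) \<rightarrow>\<^sub>M borel"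
      by (intro borel_measurable_continuous_onI continuous_intros)
    then have "(\<lambda>p. indicator B ((fst p)\<^sup>2 + snd p, (fst p)\<^sup>2 + snd p + a\<^sup>2 - 2 * a * fst p)) \<in> borel_measurable borel"
      by (rule measurable_compose) simp
    then show ?thesis by (simp add: \<phi>_def split_beta')
  qed
  have \<phi>2 [measurable]: "(\<lambda>x. \<phi> (f x) (g x)) \<in> borel_measurable M"
    if "f \<in> borel_measurable M" "g \<in> borel_measurable M" for f g and M :: "'m measure"
  proof -
    have "(\<lambda>p. (f p, g p)) \<in> M \<rightarrow>\<^sub>M borel"
      unfolding borel_prod[symmetric] using that by (rule measurable_Pair)
    from measurable_compose[OF this \<phi>m] show ?thesis by simp
  qed
  have nm1: "norm \<xi> = sqrt ((\<xi>$1)\<^sup>2 + ((\<xi>$2)\<^sup>2 + (\<xi>$3)\<^sup>2))" for \<xi> :: "real^3"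
    by (simp add: norm_vec_def L2_set_def sum_3 add.assoc)
  have nm2: "norm (?e - \<xi>) = sqrt ((\<xi>$1)\<^sup>2 + ((\<xi>$2)\<^sup>2 + (\<xi>$3)\<^sup>2) + a\<^sup>2 - 2 * a * \<xi>$1)" for \<xi> :: "real^3"
    by (simp add: norm_vec_def L2_set_def sum_3 axis_def power2_eq_square algebra_simps)
  have "emeasure lborel ?A = (\<integral>\<^sup>+\<xi>. indicator ?A \<xi> \<partial>lborel)"
  proof (rule nn_integral_indicator[symmetric])
    show "?A \<in> sets lborel" unfolding Pr_def by measurable
  qed
  also have "\<dots> = (\<integral>\<^sup>+\<xi>. \<phi> (\<xi>$1) ((\<xi>$2)\<^sup>2 + (\<xi>$3)\<^sup>2) \<partial>(lborel :: (real^3) measure))"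
  proof (rule nn_integral_cong)
    fix \<xi> :: "real^3"
    show "indicator ?A \<xi> = \<phi> (\<xi>$1) ((\<xi>$2)\<^sup>2 + (\<xi>$3)\<^sup>2)"
      using nm1[of \<xi>] nm2[of \<xi>] by (simp add: indicator_def \<phi>_def B_def)
  qed
  also have "\<dots> = (\<integral>\<^sup>+x. \<integral>\<^sup>+t. ennreal pi * indicator {0..} t * \<phi> x t \<partial>lborel \<partial>lborel)"
    by (rule nn_integral_cylindrical[OF \<phi>m])
  \<comment> \<open>The substitution \<open>P = x\<^sup>2 + t\<close> prepares the exchange of
    integrals: for fixed \<open>P\<close>, that is for fixed first distance, the second squared
    distance is affine in \<open>x\<close>.\<close>
  also have "\<dots> = (\<integral>\<^sup>+x. \<integral>\<^sup>+P. ennreal pi * indicator {0..} (P - x\<^sup>2) * \<phi> x (P - x\<^sup>2) \<partial>lborel \<partial>lborel)"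
  proof (rule nn_integral_cong)
    fix x :: real
    show "(\<integral>\<^sup>+t. ennreal pi * indicator {0..} t * \<phi> x t \<partial>lborel) =
      (\<integral>\<^sup>+P. ennreal pi * indicator {0..} (P - x\<^sup>2) * \<phi> x (P - x\<^sup>2) \<partial>lborel)"
      using nn_integral_lborel_translate[of "\<lambda>t. ennreal pi * indicator {0..} t * \<phi> x t" "- x\<^sup>2"] by simp
  qed
  also have "\<dots> = (\<integral>\<^sup>+P. \<integral>\<^sup>+x. ennreal pi * indicator {0..} (P - x\<^sup>2) * \<phi> x (P - x\<^sup>2) \<partial>lborel \<partial>lborel)"
    by (rule lborel_pair.Fubini') measurable
  also have "\<dots> \<le> ennreal (2 * pi * R1 * R2 * w * l / a)"
  proof -
    obtain lo1 hi1 where I1: "0 \<le> hi1 - lo1" "hi1 - lo1 \<le> 2 * R1 * w"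
      "\<And>u. 0 \<le> u \<Longrightarrow> u \<in> {\<alpha>..\<alpha> + w} \<Longrightarrow> u \<le> R1 \<Longrightarrow> u\<^sup>2 \<in> {lo1..hi1}"
      using sq_interval_bound[OF w(1) R(1)] by metis
    have inner: "(\<integral>\<^sup>+x. ennreal pi * indicator {0..} (P - x\<^sup>2) * \<phi> x (P - x\<^sup>2) \<partial>lborel) \<le>
       ennreal (pi * (R2 * l / a)) * indicator {lo1..hi1} P" for P
    proof -
      \<comment> \<open>For a fixed first distance the condition on the sum or difference puts the
        second distance into an interval of length \<open>l\<close>; its left end depends on the
        sign.\<close>
      define c where "c = (if \<sigma>' = 1 then \<beta> - \<sigma> * sqrt P else \<sigma> * sqrt P - \<beta> - l)"
      obtain lo2 hi2 where I2: "0 \<le> hi2 - lo2" "hi2 - lo2 \<le> 2 * R2 * l"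
        "\<And>u. 0 \<le> u \<Longrightarrow> u \<in> {c..c + l} \<Longrightarrow> u \<le> R2 \<Longrightarrow> u\<^sup>2 \<in> {lo2..hi2}"
        using sq_interval_bound[OF w(2) R(2)] by metis
      \<comment> \<open>The second squared distance is \<open>P + a\<^sup>2 - 2 * a * x\<close>, so
        its range \<open>{lo2..hi2}\<close> confines \<open>x\<close> to an interval of length
        \<open>(hi2 - lo2) / (2 * a)\<close>. This is the origin of the factor \<open>1 / a\<close>,
        which blows up as the foci merge.\<close>
      let ?K = "{(P + a\<^sup>2 - hi2) / (2 * a)..(P + a\<^sup>2 - lo2) / (2 * a)}"
      have pt: "ennreal pi * indicator {0..} (P - x\<^sup>2) * \<phi> x (P - x\<^sup>2) \<le> ennreal pi * indicator {lo1..hi1} P * indicator ?K x" for x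
      proof (cases "x\<^sup>2 \<le> P \<and> Pr (sqrt P) (sqrt (P + a\<^sup>2 - 2 * a * x))")
        case True
        define Q where "Q = P + a\<^sup>2 - 2 * a * x"
        have P0: "0 \<le> P" using True zero_le_power2[of x] by linarith
        have "Q = (P - x\<^sup>2) + (x - a)\<^sup>2" by (simp add: Q_def power2_eq_square algebra_simps)
        then have Q0: "0 \<le> Q" using True by simp
        have pr: "Pr (sqrt P) (sqrt Q)" using True by (simp add: Q_def)
        have "P \<in> {lo1..hi1}" using I1(3)[of "sqrt P"] pr P0 by (auto simp: Pr_def)
        moreover have "sqrt Q \<in> {c..c + l}" using pr \<sigma> by (auto simp: Pr_def c_def)
        then have "Q \<in> {lo2..hi2}" using I2(3)[of "sqrt Q"] pr Q0 by (auto simp: Pr_def)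
        then have "x \<in> ?K" using a by (auto simp: Q_def field_simps)
        ultimately show ?thesis by (auto simp: indicator_def \<phi>_def)
      next
        case False
        then have "ennreal pi * indicator {0..} (P - x\<^sup>2) * \<phi> x (P - x\<^sup>2) = 0"
          by (auto simp: \<phi>_def B_def indicator_def)
        then show ?thesis by (metis zero_le)
      qed
      have "(\<integral>\<^sup>+x. ennreal pi * indicator {0..} (P - x\<^sup>2) * \<phi> x (P - x\<^sup>2) \<partial>lborel) \<le>
         (\<integral>\<^sup>+x. ennreal pi * indicator {lo1..hi1} P * indicator ?K x \<partial>lborel)"
        by (intro nn_integral_mono pt)
      also have "\<dots> = ennreal pi * indicator {lo1..hi1} P * ennreal ((hi2 - lo2) / (2 * a))"
      proof -
        have "(P + a\<^sup>2 - hi2) / (2 * a) \<le> (P + a\<^sup>2 - lo2) / (2 * a)"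
          using I2(1) a by (intro divide_right_mono) auto
        moreover have "(P + a\<^sup>2 - lo2) / (2 * a) - (P + a\<^sup>2 - hi2) / (2 * a) = (hi2 - lo2) / (2 * a)"
          by (simp add: diff_divide_distrib)
        ultimately show ?thesis by (simp add: nn_integral_cmult)
      qed
      also have "\<dots> \<le> ennreal pi * indicator {lo1..hi1} P * ennreal (R2 * l / a)"
      proof (intro mult_left_mono ennreal_leI)
        have "(hi2 - lo2) / (2 * a) \<le> (2 * R2 * l) / (2 * a)"
          using I2(2) a by (intro divide_right_mono) auto
        then show "(hi2 - lo2) / (2 * a) \<le> R2 * l / a" by simp
      qed simp
      also have "\<dots> = ennreal (pi * (R2 * l / a)) * indicator {lo1..hi1} P"
      proof -
        have "ennreal (pi * (R2 * l / a)) = ennreal pi * ennreal (R2 * l / a)"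
          using R w a by (intro ennreal_mult) auto
        then show ?thesis by (simp add: mult_ac)
      qed
      finally show ?thesis .
    qed
    have "(\<integral>\<^sup>+P. \<integral>\<^sup>+x. ennreal pi * indicator {0..} (P - x\<^sup>2) * \<phi> x (P - x\<^sup>2) \<partial>lborel \<partial>lborel) \<le>
      (\<integral>\<^sup>+P. ennreal (pi * (R2 * l / a)) * indicator {lo1..hi1} P \<partial>lborel)"
      by (intro nn_integral_mono inner)
    also have "\<dots> = ennreal (pi * (R2 * l / a)) * ennreal (hi1 - lo1)"
      using I1(1) by (simp add: nn_integral_cmult)
    also have "\<dots> = ennreal (pi * (R2 * l / a) * (hi1 - lo1))"
      using R w a I1(1) by (intro ennreal_mult[symmetric]) auto
    also have "\<dots> \<le> ennreal (pi * (R2 * l / a) * (2 * R1 * w))"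
      using R w a I1(2) by (intro ennreal_leI mult_left_mono) auto
    also have "pi * (R2 * l / a) * (2 * R1 * w) = 2 * pi * R1 * R2 * w * l / a"
      by (simp add: mult_ac)
    finally show ?thesis .
  qed
  finally show ?thesis unfolding Pr_def .
qed

text \<open>A rotation moves the second focus to the first axis. The sets are bounded, so their
  measures are finite and the invariance of \<open>measure\<close> under orthogonal maps carries
  over to \<open>emeasure\<close>.\<close>

lemma level_set_volume:
  fixes \<eta> :: "real^3" and R1 R2 w l \<alpha> \<beta> \<sigma> \<sigma>' :: real
  assumes a: "\<eta> \<noteq> 0" and R: "0 \<le> R1" "0 \<le> R2" and w: "0 \<le> w" "0 \<le> l"
    and \<sigma>: "\<sigma>' = 1 \<or> \<sigma>' = -1"
  shows "emeasure lborel {\<xi> :: real^3. norm \<xi> \<in> {\<alpha>..\<alpha> + w} \<and> norm \<xi> \<le> R1 \<and> norm (\<eta> - \<xi>) \<le> R2 \<and>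
      \<sigma> * norm \<xi> + \<sigma>' * norm (\<eta> - \<xi>) \<in> {\<beta>..\<beta> + l}} \<le> ennreal (2 * pi * R1 * R2 * w * l / norm \<eta>)"
proof -
  define A where "A \<eta> = {\<xi> :: real^3. norm \<xi> \<in> {\<alpha>..\<alpha> + w} \<and> norm \<xi> \<le> R1 \<and> norm (\<eta> - \<xi>) \<le> R2 \<and>
      \<sigma> * norm \<xi> + \<sigma>' * norm (\<eta> - \<xi>) \<in> {\<beta>..\<beta> + l}}" for \<eta>
  have [measurable]: "A \<eta> \<in> sets borel" for \<eta> unfolding A_def by measurable
  let ?e = "norm \<eta> *\<^sub>R axis 1 1 :: real^3"
  obtain f where f: "orthogonal_transformation f" "f ?e = \<eta>"
    using orthogonal_transformation_exists[of ?e \<eta>] by (auto simp: norm_axis_1)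
  have nf: "norm (f x) = norm x" for x using f(1) by (simp add: orthogonal_transformation_norm)
  have df: "norm (\<eta> - f x) = norm (?e - x)" for x
    using nf[of "?e - x"] f by (simp add: orthogonal_transformation_linear linear_diff)
  have img: "A \<eta> = f ` A ?e"
  proof
    show "f ` A ?e \<subseteq> A \<eta>"
    proof
      fix y assume "y \<in> f ` A ?e"
      then obtain x where x: "y = f x" "x \<in> A ?e" by blast
      then show "y \<in> A \<eta>" unfolding A_def x(1) mem_Collect_eq nf df by blast
    qed
    show "A \<eta> \<subseteq> f ` A ?e"
    proof
      fix y assume y: "y \<in> A \<eta>"
      obtain x where x: "y = f x" using orthogonal_transformation_surj[OF f(1)] by (metis surjD)
      from y have "x \<in> A ?e" unfolding A_def x mem_Collect_eq nf df .
      then show "y \<in> f ` A ?e" unfolding x by (rule imageI)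
    qed
  qed
  have bd: "bounded (A \<eta>)" for \<eta>
    by (rule bounded_subset[of "cball 0 R1"]) (auto simp: A_def)
  have lm: "A \<eta> \<in> lmeasurable" for \<eta>
    by (rule bounded_set_imp_lmeasurable[OF bd]) simp
  have fin: "emeasure lborel (A \<eta>) = ennreal (measure lebesgue (A \<eta>))" for \<eta>
  proof -
    have "emeasure lborel (A \<eta>) = emeasure lebesgue (A \<eta>)" by simp
    also have "\<dots> = ennreal (measure lebesgue (A \<eta>))"
      using lm[of \<eta>] by (intro emeasure_eq_ennreal_measure) (auto simp: fmeasurable_def)
    finally show ?thesis .
  qed
  have "emeasure lborel (A \<eta>) = emeasure lborel (A ?e)"
    unfolding fin unfolding img using measure_orthogonal_image[OF f(1) lm[of ?e]] by simp
  also have "\<dots> \<le> ennreal (2 * pi * R1 * R2 * w * l / norm \<eta>)"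
    unfolding A_def using a by (intro level_set_volume_axis R w \<sigma>) auto
  finally show ?thesis unfolding A_def .
qed

section \<open>Thickened light cones in space-time\<close>

type_synonym spacetime = "real \<times> (real^3)"

text \<open>The modulation without its bracket; up to a constant, the distance of \<open>p\<close>
  to the double light cone.\<close>

definition cdist :: "spacetime \<Rightarrow> real" where
  "cdist p = \<bar>\<bar>fst p\<bar> - norm (snd p)\<bar>"

lemma borel_measurable_fst_snd [measurable]:
  "fst \<in> borel_measurable (borel :: spacetime measure)"
  "snd \<in> borel_measurable (borel :: spacetime measure)"
  by (intro borel_measurable_continuous_onI continuous_intros)+

lemma cdist_measurable [measurable]: "cdist \<in> borel_measurable borel"
  unfolding cdist_def by measurable

lemma emeasure_slices_le:
  fixes E :: "spacetime set"
  assumes E: "E \<in> sets borel" and B: "B \<in> sets borel"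
    and sub: "\<And>\<tau> \<xi>. (\<tau>, \<xi>) \<in> E \<Longrightarrow> \<xi> \<in> B"
    and sl: "\<And>\<xi>. \<xi> \<in> B \<Longrightarrow> emeasure lborel {\<tau>. (\<tau>, \<xi>) \<in> E} \<le> c"
  shows "emeasure lborel E \<le> c * emeasure lborel B"
proof -
  have E': "E \<in> sets (lborel \<Otimes>\<^sub>M lborel)" using E by (simp only: lborel_prod sets_lborel)
  have "emeasure lborel E = (\<integral>\<^sup>+\<xi>. emeasure lborel ((\<lambda>\<tau>. (\<tau>, \<xi>)) -` E) \<partial>lborel)"
    using lborel_pair.emeasure_pair_measure_alt2[OF E'] by (simp add: lborel_prod)
  also have "\<dots> \<le> (\<integral>\<^sup>+\<xi>. c * indicator B \<xi> \<partial>lborel)"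
  proof (rule nn_integral_mono)
    fix \<xi> :: "real^3"
    show "emeasure lborel ((\<lambda>\<tau>. (\<tau>, \<xi>)) -` E) \<le> c * indicator B \<xi>"
    proof (cases "\<xi> \<in> B")
      case True
      then show ?thesis using sl[OF True] by (simp add: vimage_def)
    next
      case False
      then have "(\<lambda>\<tau>. (\<tau>, \<xi>)) -` E = {}" using sub by auto
      then show ?thesis by simp
    qed
  qed
  also have "\<dots> = c * emeasure lborel B" using B by (simp add: nn_integral_cmult_indicator)
  finally show ?thesis .
qed

text \<open>Two intervals of length \<open>2 * l\<close>, one for each sign of
  \<open>c - \<tau>\<close>, cover the set.\<close>

lemma emeasure_abs_abs_le:
  fixes r l c :: real
  assumes "0 \<le> l"
  shows "emeasure lborel {\<tau>. \<bar>\<bar>c - \<tau>\<bar> - r\<bar> \<le> l} \<le> ennreal (4 * l)"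
proof -
  have "emeasure lborel {\<tau>. \<bar>\<bar>c - \<tau>\<bar> - r\<bar> \<le> l} \<le> emeasure lborel ({c - r - l..c - r + l} \<union> {c + r - l..c + r + l})"
    by (intro emeasure_mono) auto
  also have "\<dots> \<le> emeasure lborel {c - r - l..c - r + l} + emeasure lborel {c + r - l..c + r + l}"
    by (intro emeasure_subadditive) auto
  also have "\<dots> = ennreal (4 * l)"
    using assms by (simp add: ennreal_plus[symmetric] del: ennreal_plus)
  finally show ?thesis .
qed

text \<open>For fixed \<open>\<xi>\<close> each of the two cone conditions alone confines
  \<open>\<tau>\<close>, and the better one gives the minimum. The restriction that the cones impose
  on \<open>\<xi>\<close> is ignored.\<close>

lemma trivial_volume:
  fixes p :: spacetime
  assumes B [measurable]: "B \<in> sets borel" and l: "0 \<le> l1" "0 \<le> l2"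
    and sub: "\<And>\<xi>. Q \<xi> \<Longrightarrow> \<xi> \<in> B"
    and Q: "Measurable.pred borel Q"
  shows "emeasure lborel {q. Q (snd q) \<and> cdist q \<le> l1 \<and> cdist (p - q) \<le> l2} \<le>
    ennreal (4 * min l1 l2) * emeasure lborel B"
proof (rule emeasure_slices_le)
  note Q [measurable]
  have [measurable]: "Measurable.pred borel (\<lambda>q::spacetime. Q (snd q))"
    by (rule measurable_compose[OF _ Q]) measurable
  show "{q. Q (snd q) \<and> cdist q \<le> l1 \<and> cdist (p - q) \<le> l2} \<in> sets borel" by measurable
  show "\<xi> \<in> B" if "(\<tau>, \<xi>) \<in> {q. Q (snd q) \<and> cdist q \<le> l1 \<and> cdist (p - q) \<le> l2}" for \<tau> \<xi>
    using that sub by auto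
  fix \<xi> :: "real^3"
  let ?S = "{\<tau>. (\<tau>, \<xi>) \<in> {q. Q (snd q) \<and> cdist q \<le> l1 \<and> cdist (p - q) \<le> l2}}"
  have "emeasure lborel ?S \<le> emeasure lborel {\<tau>. \<bar>\<bar>0 - \<tau>\<bar> - norm \<xi>\<bar> \<le> l1}"
    by (intro emeasure_mono) (auto simp: cdist_def)
  also have "\<dots> \<le> ennreal (4 * l1)" by (rule emeasure_abs_abs_le) fact
  finally have 1: "emeasure lborel ?S \<le> ennreal (4 * l1)" .
  have "emeasure lborel ?S \<le> emeasure lborel {\<tau>. \<bar>\<bar>fst p - \<tau>\<bar> - norm (snd p - \<xi>)\<bar> \<le> l2}"
    by (intro emeasure_mono) (auto simp: cdist_def)
  also have "\<dots> \<le> ennreal (4 * l2)" by (rule emeasure_abs_abs_le) fact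
  finally have 2: "emeasure lborel ?S \<le> ennreal (4 * l2)" .
  show "emeasure lborel ?S \<le> ennreal (4 * min l1 l2)"
    using 1 2 by (auto simp: min_def)
qed measurable

text \<open>Fix the signs of both time frequencies. Adding the two cone conditions eliminates
  \<open>\<tau>\<close> and puts \<open>\<xi>\<close> into a shell between level sets of the sum or
  difference of the distances to 0 and \<open>snd p\<close>, that is, ellipsoids or hyperboloids;
  then \<open>\<tau>\<close> ranges over a length of \<open>2 * min l1 l2\<close>. The window of
  width \<open>w\<close> for the norm of \<open>\<xi>\<close> is kept separate because it becomes
  narrow after localization to balls.\<close>

lemma cone_volume:
  fixes p :: spacetime
  assumes p: "snd p \<noteq> 0" and R: "0 \<le> R1" "0 \<le> R2" and w: "0 \<le> w" and l: "0 \<le> l1" "0 \<le> l2"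
  shows "emeasure lborel {q. norm (snd q) \<in> {\<alpha>..\<alpha> + w} \<and> norm (snd q) \<le> R1 \<and> norm (snd (p - q)) \<le> R2 \<and>
     cdist q \<le> l1 \<and> cdist (p - q) \<le> l2} \<le> ennreal (64 * pi * R1 * R2 * w * l1 * l2 / norm (snd p))"
    (is "emeasure lborel ?A \<le> _")
proof -
  define lev where "lev \<sigma> \<sigma>' = {\<xi> :: real^3. norm \<xi> \<in> {\<alpha>..\<alpha> + w} \<and> norm \<xi> \<le> R1 \<and> norm (snd p - \<xi>) \<le> R2 \<and>
      \<sigma> * norm \<xi> + \<sigma>' * norm (snd p - \<xi>) \<in> {fst p - (l1 + l2)..fst p - (l1 + l2) + 2 * (l1 + l2)}}" for \<sigma> \<sigma>' :: real
  define E where "E \<sigma> \<sigma>' = {q :: spacetime. snd q \<in> lev \<sigma> \<sigma>' \<and> \<bar>fst q - \<sigma> * norm (snd q)\<bar> \<le> l1 \<and>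
      \<bar>fst p - fst q - \<sigma>' * norm (snd p - snd q)\<bar> \<le> l2}" for \<sigma> \<sigma>' :: real
  have [measurable]: "lev \<sigma> \<sigma>' \<in> sets borel" for \<sigma> \<sigma>' unfolding lev_def by measurable
  have [measurable]: "Measurable.pred borel (\<lambda>q::spacetime. snd q \<in> lev \<sigma> \<sigma>')" for \<sigma> \<sigma>'
    unfolding lev_def mem_Collect_eq by measurable
  have Em [measurable]: "E \<sigma> \<sigma>' \<in> sets borel" for \<sigma> \<sigma>' unfolding E_def by measurable
  have bd: "emeasure lborel (E \<sigma> \<sigma>') \<le> ennreal (16 * pi * R1 * R2 * w * l1 * l2 / norm (snd p))"
    if s': "\<sigma>' = 1 \<or> \<sigma>' = -1" for \<sigma> \<sigma>'
  proof -
    have "emeasure lborel (E \<sigma> \<sigma>') \<le> ennreal (2 * min l1 l2) * emeasure lborel (lev \<sigma> \<sigma>')"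
    proof (rule emeasure_slices_le)
      show "\<xi> \<in> lev \<sigma> \<sigma>'" if "(\<tau>, \<xi>) \<in> E \<sigma> \<sigma>'" for \<tau> \<xi> using that by (auto simp: E_def)
      fix \<xi> :: "real^3"
      have "emeasure lborel {\<tau>. (\<tau>, \<xi>) \<in> E \<sigma> \<sigma>'} \<le> emeasure lborel {\<sigma> * norm \<xi> - l1..\<sigma> * norm \<xi> + l1}"
        by (intro emeasure_mono) (auto simp: E_def)
      also have "\<dots> = ennreal (2 * l1)" using l by simp
      finally have 1: "emeasure lborel {\<tau>. (\<tau>, \<xi>) \<in> E \<sigma> \<sigma>'} \<le> ennreal (2 * l1)" .
      have "emeasure lborel {\<tau>. (\<tau>, \<xi>) \<in> E \<sigma> \<sigma>'} \<le>
          emeasure lborel {fst p - \<sigma>' * norm (snd p - \<xi>) - l2..fst p - \<sigma>' * norm (snd p - \<xi>) + l2}"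
        by (intro emeasure_mono) (auto simp: E_def)
      also have "\<dots> = ennreal (2 * l2)" using l by simp
      finally have 2: "emeasure lborel {\<tau>. (\<tau>, \<xi>) \<in> E \<sigma> \<sigma>'} \<le> ennreal (2 * l2)" .
      show "emeasure lborel {\<tau>. (\<tau>, \<xi>) \<in> E \<sigma> \<sigma>'} \<le> ennreal (2 * min l1 l2)"
        using 1 2 by (auto simp: min_def)
    qed measurable
    also have "\<dots> \<le> ennreal (2 * min l1 l2) * ennreal (2 * pi * R1 * R2 * w * (2 * (l1 + l2)) / norm (snd p))"
      unfolding lev_def using p R w l s' by (intro mult_left_mono level_set_volume) auto
    also have "\<dots> = ennreal (2 * min l1 l2 * (2 * pi * R1 * R2 * w * (2 * (l1 + l2)) / norm (snd p)))"
      using l R w by (intro ennreal_mult[symmetric]) auto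
    also have "\<dots> \<le> ennreal (16 * pi * R1 * R2 * w * l1 * l2 / norm (snd p))"
    proof (rule ennreal_leI)
      \<comment> \<open>The \<open>\<tau>\<close> range and the shell thickness
        \<open>2 * (l1 + l2)\<close> combine to a multiple of the product of both
        modulations.\<close>
      have "min l1 l2 * (l1 + l2) \<le> min l1 l2 * (2 * max l1 l2)"
        using l by (intro mult_left_mono) auto
      also have "\<dots> = 2 * (l1 * l2)" by (simp add: min_def max_def)
      finally have *: "min l1 l2 * (l1 + l2) \<le> 2 * (l1 * l2)" .
      have "2 * min l1 l2 * (2 * pi * R1 * R2 * w * (2 * (l1 + l2)) / norm (snd p)) =
          (8 * pi * R1 * R2 * w / norm (snd p)) * (min l1 l2 * (l1 + l2))" by simp
      also have "\<dots> \<le> (8 * pi * R1 * R2 * w / norm (snd p)) * (2 * (l1 * l2))"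
        using R w by (intro mult_left_mono *) auto
      finally show "2 * min l1 l2 * (2 * pi * R1 * R2 * w * (2 * (l1 + l2)) / norm (snd p)) \<le>
          16 * pi * R1 * R2 * w * l1 * l2 / norm (snd p)" by (simp add: mult_ac)
    qed
    finally show ?thesis .
  qed
  let ?c = "16 * pi * R1 * R2 * w * l1 * l2 / norm (snd p)"
  have "?A \<subseteq> (E 1 1 \<union> E 1 (-1)) \<union> (E (-1) 1 \<union> E (-1) (-1))"
  proof
    fix q assume q: "q \<in> ?A"
    obtain \<sigma> where s: "\<sigma> = 1 \<or> \<sigma> = -1" "\<bar>fst q\<bar> = \<sigma> * fst q" "\<sigma> * \<sigma> = (1::real)"
      by (metis abs_of_nonneg abs_of_nonpos linear mult_1 mult_minus1 mult_minus_left mult.commute minus_minus)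
    obtain \<sigma>' where s': "\<sigma>' = 1 \<or> \<sigma>' = -1" "\<bar>fst p - fst q\<bar> = \<sigma>' * (fst p - fst q)"
      by (metis abs_of_nonneg abs_of_nonpos linear mult_1 mult_minus1)
    have a1: "\<bar>fst q - \<sigma> * norm (snd q)\<bar> \<le> l1" using q s by (auto simp: cdist_def)
    have a2: "\<bar>fst p - fst q - \<sigma>' * norm (snd p - snd q)\<bar> \<le> l2" using q s' by (auto simp: cdist_def)
    have "q \<in> E \<sigma> \<sigma>'" using q a1 a2 by (auto simp: E_def lev_def)
    then show "q \<in> (E 1 1 \<union> E 1 (-1)) \<union> (E (-1) 1 \<union> E (-1) (-1))" using s(1) s'(1) by auto
  qed
  then have "emeasure lborel ?A \<le> emeasure lborel ((E 1 1 \<union> E 1 (-1)) \<union> (E (-1) 1 \<union> E (-1) (-1)))"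
    by (intro emeasure_mono) auto
  also have "\<dots> \<le> emeasure lborel (E 1 1 \<union> E 1 (-1)) + emeasure lborel (E (-1) 1 \<union> E (-1) (-1))"
    by (intro emeasure_subadditive) auto
  also have "\<dots> \<le> (emeasure lborel (E 1 1) + emeasure lborel (E 1 (-1))) + (emeasure lborel (E (-1) 1) + emeasure lborel (E (-1) (-1)))"
    by (intro add_mono emeasure_subadditive) auto
  also have "\<dots> \<le> (ennreal ?c + ennreal ?c) + (ennreal ?c + ennreal ?c)"
    by (intro add_mono bd) auto
  also have "\<dots> = ennreal (4 * ?c)"
    using R w l by (simp add: ennreal_plus[symmetric] del: ennreal_plus)
  finally show ?thesis by (simp add: mult_ac)
qed

section \<open>Bilinear estimates for localized functions\<close>

lemma emeasure_ball_R3: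
  fixes c :: "real^3"
  assumes "0 \<le> r"
  shows "emeasure lborel (ball c r) = ennreal (4 / 3 * pi * r ^ 3)"
  using assms by (simp add: emeasure_ball eval_unit_ball_vol)

lemma emeasure_ball_R3_le:
  fixes c :: "real^3"
  assumes "0 \<le> r"
  shows "emeasure lborel (ball c r) \<le> ennreal (6 * r ^ 3)"
proof -
  have "4 / 3 * pi * r ^ 3 \<le> 6 * r ^ 3"
    using assms pi_less_4 by (intro mult_right_mono) auto
  then show ?thesis unfolding emeasure_ball_R3[OF assms] by (rule ennreal_leI)
qed

lemma emeasure_cball_R3_le:
  fixes c :: "real^3"
  assumes "0 \<le> r"
  shows "emeasure lborel (cball c r) \<le> ennreal (6 * r ^ 3)"
  using emeasure_ball_R3_le[OF assms, of c] assms by (simp add: emeasure_ball emeasure_cball)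

text \<open>The constant is \<open>4 * 6\<close>: two time intervals of length
  \<open>2 * min l1 l2\<close> and a ball of volume at most \<open>6 * r ^ 3\<close>.\<close>

lemma tri_trivial:
  fixes F G H :: "spacetime \<Rightarrow> ennreal"
  assumes [measurable]: "F \<in> borel_measurable borel" "G \<in> borel_measurable borel" "H \<in> borel_measurable borel"
    and F: "\<And>q. F q \<noteq> 0 \<Longrightarrow> snd q \<in> cball c r \<and> cdist q \<le> l1"
    and G: "\<And>q. G q \<noteq> 0 \<Longrightarrow> cdist q \<le> l2"
    and nn: "0 \<le> r" "0 \<le> l1" "0 \<le> l2"
  shows "(tri F G H)\<^sup>2 \<le> ennreal (24 * r ^ 3 * min l1 l2) * (l2sq F * l2sq G * l2sq H)"
proof (rule tri_block)
  fix p
  have "emeasure lborel {q. F q \<noteq> 0 \<and> G (p - q) \<noteq> 0} \<le>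
    emeasure lborel {q. snd q \<in> cball c r \<and> cdist q \<le> l1 \<and> cdist (p - q) \<le> l2}"
  proof (rule emeasure_mono)
    show "{q. F q \<noteq> 0 \<and> G (p - q) \<noteq> 0} \<subseteq> {q. snd q \<in> cball c r \<and> cdist q \<le> l1 \<and> cdist (p - q) \<le> l2}"
      using F G by blast
    have [measurable]: "Measurable.pred borel (\<lambda>q::spacetime. snd q \<in> cball c r)"
      unfolding mem_cball by measurable
    show "{q. snd q \<in> cball c r \<and> cdist q \<le> l1 \<and> cdist (p - q) \<le> l2} \<in> sets lborel" by measurable
  qed
  also have "\<dots> \<le> ennreal (4 * min l1 l2) * emeasure lborel (cball c r)"
    using nn by (intro trivial_volume) auto
  also have "\<dots> \<le> ennreal (4 * min l1 l2) * ennreal (6 * r ^ 3)"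
    using nn by (intro mult_left_mono emeasure_cball_R3_le) auto
  also have "\<dots> = ennreal (24 * r ^ 3 * min l1 l2)"
    using nn by (simp add: ennreal_mult[symmetric] mult_ac)
  finally show "emeasure lborel {q. F q \<noteq> 0 \<and> G (p - q) \<noteq> 0} \<le> ennreal (24 * r ^ 3 * min l1 l2)" .
qed measurable

text \<open>Here the foci are at distance at least \<open>M\<close>. The norm of the first frequency
  is confined by \<open>R1\<close> alone, so \<open>R1\<close> also takes the part of the window
  width and occurs squared.\<close>

lemma tri_transversal:
  fixes F G H :: "spacetime \<Rightarrow> ennreal"
  assumes [measurable]: "F \<in> borel_measurable borel" "G \<in> borel_measurable borel" "H \<in> borel_measurable borel"
    and F: "\<And>q. F q \<noteq> 0 \<Longrightarrow> norm (snd q) \<le> R1 \<and> cdist q \<le> l1"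
    and G: "\<And>q. G q \<noteq> 0 \<Longrightarrow> norm (snd q) \<le> R2 \<and> cdist q \<le> l2"
    and H: "\<And>q. H q \<noteq> 0 \<Longrightarrow> M \<le> norm (snd q)"
    and nn: "0 \<le> R1" "0 \<le> R2" "0 \<le> l1" "0 \<le> l2" "0 < M"
  shows "(tri F G H)\<^sup>2 \<le> ennreal (256 * R1\<^sup>2 * R2 * l1 * l2 / M) * (l2sq F * l2sq G * l2sq H)"
proof (rule tri_block)
  fix p assume Hp: "H p \<noteq> 0"
  have "emeasure lborel {q. F q \<noteq> 0 \<and> G (p - q) \<noteq> 0} \<le>
    emeasure lborel {q. norm (snd q) \<in> {0..0 + R1} \<and> norm (snd q) \<le> R1 \<and> norm (snd (p - q)) \<le> R2 \<and> cdist q \<le> l1 \<and> cdist (p - q) \<le> l2}"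
  proof (rule emeasure_mono)
    show "{q. F q \<noteq> 0 \<and> G (p - q) \<noteq> 0} \<subseteq> {q. norm (snd q) \<in> {0..0 + R1} \<and> norm (snd q) \<le> R1 \<and> norm (snd (p - q)) \<le> R2 \<and> cdist q \<le> l1 \<and> cdist (p - q) \<le> l2}"
      using F G by fastforce
    show "{q. norm (snd q) \<in> {0..0 + R1} \<and> norm (snd q) \<le> R1 \<and> norm (snd (p - q)) \<le> R2 \<and> cdist q \<le> l1 \<and> cdist (p - q) \<le> l2} \<in> sets lborel"
      by measurable
  qed
  also have "\<dots> \<le> ennreal (64 * pi * R1 * R2 * R1 * l1 * l2 / norm (snd p))"
    using nn H[OF Hp] by (intro cone_volume) auto
  also have "\<dots> \<le> ennreal (256 * R1\<^sup>2 * R2 * l1 * l2 / M)"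
  proof (rule ennreal_leI)
    have "64 * pi * R1 * R2 * R1 * l1 * l2 = (64 * pi) * (R1 * R2 * R1 * l1 * l2)" by simp
    also have "\<dots> \<le> 256 * (R1 * R2 * R1 * l1 * l2)"
      using nn pi_less_4 by (intro mult_right_mono) auto
    also have "\<dots> = 256 * R1\<^sup>2 * R2 * l1 * l2" by (simp add: power2_eq_square)
    finally show "64 * pi * R1 * R2 * R1 * l1 * l2 / norm (snd p) \<le> 256 * R1\<^sup>2 * R2 * l1 * l2 / M"
      using nn H[OF Hp] by (intro frac_le) auto
  qed
  finally show "emeasure lborel {q. F q \<noteq> 0 \<and> G (p - q) \<noteq> 0} \<le> ennreal (256 * R1\<^sup>2 * R2 * l1 * l2 / M)" .
qed measurable

text \<open>Two frequencies of size \<open>N\<close> in the same small ball add up to one of size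
  about \<open>N\<close>, so the foci stay far apart. The ball also confines the norm to a window of
  width \<open>2 * \<rho>\<close>, which replaces one factor \<open>N\<close> by
  \<open>\<rho>\<close>.\<close>

lemma l2sq_self_conv_le:
  fixes F :: "spacetime \<Rightarrow> ennreal"
  assumes [measurable]: "F \<in> borel_measurable borel"
    and F: "\<And>q. F q \<noteq> 0 \<Longrightarrow> norm (snd q - c) \<le> \<rho> \<and> N / 2 \<le> norm (snd q) \<and> norm (snd q) \<le> 2 * N \<and> cdist q \<le> 2 * L"
    and nn: "0 \<le> \<rho>" "0 \<le> L" "0 < N" "4 * \<rho> \<le> N"
  shows "l2sq (conv F F) \<le> ennreal (16384 * N * \<rho> * L\<^sup>2) * (l2sq F * l2sq F)"
proof (rule l2sq_conv_le)
  fix p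
  let ?E = "{q. F q \<noteq> 0 \<and> F (p - q) \<noteq> 0}"
  show "emeasure lborel ?E \<le> ennreal (16384 * N * \<rho> * L\<^sup>2)"
  proof (cases "?E = {}")
    case False
    then obtain q where q: "F q \<noteq> 0" "F (p - q) \<noteq> 0" by auto
    \<comment> \<open>The spatial part of \<open>2 q - p\<close> is the difference of two points of
      the ball, \<open>q\<close> and \<open>p - q\<close>, hence at most
      \<open>2 * \<rho> \<le> N / 2\<close>, while that of \<open>2 q\<close> has norm at least
      \<open>N\<close>.\<close>
    have "norm (2 *\<^sub>R snd q - snd p) \<le> norm (snd q - c) + norm (snd (p - q) - c)"
      using norm_triangle_ineq4[of "snd q - c" "snd (p - q) - c"] by (simp add: algebra_simps scaleR_2)
    also have "\<dots> \<le> 2 * \<rho>" using F[OF q(1)] F[OF q(2)] by simp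
    finally have "norm (2 *\<^sub>R snd q - snd p) \<le> 2 * \<rho>" .
    moreover have "norm (2 *\<^sub>R snd q) \<le> norm (2 *\<^sub>R snd q - snd p) + norm (snd p)"
      using norm_triangle_ineq[of "2 *\<^sub>R snd q - snd p" "snd p"] by simp
    ultimately have p: "N / 2 \<le> norm (snd p)" using F[OF q(1)] nn by simp
    let ?A = "{q. norm (snd q) \<in> {norm c - \<rho>..norm c - \<rho> + 2 * \<rho>} \<and> norm (snd q) \<le> 2 * N \<and> norm (snd (p - q)) \<le> 2 * N \<and> cdist q \<le> 2 * L \<and> cdist (p - q) \<le> 2 * L}"
    have "emeasure lborel ?E \<le> emeasure lborel ?A"
    proof (rule emeasure_mono)
      show "?E \<subseteq> ?A"
      proof
        fix q assume "q \<in> ?E"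
        then have q: "F q \<noteq> 0" "F (p - q) \<noteq> 0" by auto
        have "\<bar>norm (snd q) - norm c\<bar> \<le> \<rho>"
          using F[OF q(1)] norm_triangle_ineq3[of "snd q" c] by linarith
        then show "q \<in> ?A" using F[OF q(1)] F[OF q(2)] by auto
      qed
      show "?A \<in> sets lborel" by measurable
    qed
    also have "\<dots> \<le> ennreal (64 * pi * (2 * N) * (2 * N) * (2 * \<rho>) * (2 * L) * (2 * L) / norm (snd p))"
      using nn p by (intro cone_volume) auto
    also have "\<dots> \<le> ennreal (16384 * N * \<rho> * L\<^sup>2)"
    proof (rule ennreal_leI)
      have "64 * pi * (2 * N) * (2 * N) * (2 * \<rho>) * (2 * L) * (2 * L) = pi * (2048 * N\<^sup>2 * \<rho> * L\<^sup>2)"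
        by (simp add: power2_eq_square)
      also have "\<dots> \<le> 4 * (2048 * N\<^sup>2 * \<rho> * L\<^sup>2)"
        using nn pi_less_4 by (intro mult_right_mono) auto
      finally have "64 * pi * (2 * N) * (2 * N) * (2 * \<rho>) * (2 * L) * (2 * L) / norm (snd p) \<le> 4 * (2048 * N\<^sup>2 * \<rho> * L\<^sup>2) / (N / 2)"
        using nn p by (intro frac_le) auto
      also have "\<dots> = 16384 * N * \<rho> * L\<^sup>2" using nn by (simp add: power2_eq_square)
      finally show "64 * pi * (2 * N) * (2 * N) * (2 * \<rho>) * (2 * L) * (2 * L) / norm (snd p) \<le> 16384 * N * \<rho> * L\<^sup>2" .
    qed
    finally show ?thesis .
  next
    case True
    then show ?thesis by (simp only: emeasure_empty zero_le)
  qed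
qed measurable

section \<open>Localization to balls\<close>

definition loc :: "real^3 \<Rightarrow> real \<Rightarrow> (spacetime \<Rightarrow> ennreal) \<Rightarrow> spacetime \<Rightarrow> ennreal" where
  "loc c r F q = indicator (ball c r) (snd q) * F q"

lemma loc_measurable2 [measurable]:
  assumes [measurable]: "f \<in> M \<rightarrow>\<^sub>M borel" "g \<in> M \<rightarrow>\<^sub>M borel" "F \<in> borel_measurable borel"
  shows "(\<lambda>x. loc (f x) r F (g x)) \<in> borel_measurable M"
proof -
  have "(\<lambda>x. indicator (ball (f x) r) (snd (g x)) :: ennreal) = (\<lambda>x. indicator {..<r} (dist (f x) (snd (g x))))"
    by (auto simp: indicator_def)
  also have "\<dots> \<in> borel_measurable M" by measurable
  finally show ?thesis unfolding loc_def by measurable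
qed

lemma loc_neq_0: "loc c r F q \<noteq> 0 \<longleftrightarrow> dist c (snd q) < r \<and> F q \<noteq> 0"
  by (auto simp: loc_def indicator_def)

text \<open>Each point lies in the ball for a set of centres whose volume is that of the ball, so
  averaging over the centres reproduces the squared norm exactly, up to this volume.\<close>

lemma nn_integral_l2sq_loc:
  assumes [measurable]: "F \<in> borel_measurable borel" and r: "0 \<le> r"
  shows "(\<integral>\<^sup>+c. l2sq (loc c r F) \<partial>lborel) = ennreal (4 / 3 * pi * r ^ 3) * l2sq F"
    and "(\<integral>\<^sup>+c. l2sq (loc (- c) r F) \<partial>lborel) = ennreal (4 / 3 * pi * r ^ 3) * l2sq F"
proof -
  show 1: "(\<integral>\<^sup>+c. l2sq (loc c r F) \<partial>lborel) = ennreal (4 / 3 * pi * r ^ 3) * l2sq F"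
  proof -
    have "(\<integral>\<^sup>+c. l2sq (loc c r F) \<partial>lborel) = (\<integral>\<^sup>+q. \<integral>\<^sup>+c. (loc c r F q)\<^sup>2 \<partial>lborel \<partial>lborel)"
      unfolding l2sq_def by (rule lborel_pair.Fubini') measurable
    also have "\<dots> = (\<integral>\<^sup>+q. ennreal (4 / 3 * pi * r ^ 3) * (F q)\<^sup>2 \<partial>lborel)"
    proof (rule nn_integral_cong)
      fix q
      have "(\<integral>\<^sup>+c. (loc c r F q)\<^sup>2 \<partial>lborel) = (\<integral>\<^sup>+c. (F q)\<^sup>2 * indicator (ball (snd q) r) c \<partial>lborel)"
        by (intro nn_integral_cong) (auto simp: loc_def indicator_def dist_commute)
      also have "\<dots> = (F q)\<^sup>2 * ennreal (4 / 3 * pi * r ^ 3)"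
        using r by (subst nn_integral_cmult_indicator) (auto simp: emeasure_ball_R3)
      finally show "(\<integral>\<^sup>+c. (loc c r F q)\<^sup>2 \<partial>lborel) = ennreal (4 / 3 * pi * r ^ 3) * (F q)\<^sup>2"
        by (simp add: mult.commute)
    qed
    also have "\<dots> = ennreal (4 / 3 * pi * r ^ 3) * l2sq F"
      by (simp add: nn_integral_cmult l2sq_def)
    finally show ?thesis .
  qed
  have [measurable]: "(\<lambda>c. l2sq (loc c r F)) \<in> borel_measurable borel"
    unfolding l2sq_def by measurable
  show "(\<integral>\<^sup>+c. l2sq (loc (- c) r F) \<partial>lborel) = ennreal (4 / 3 * pi * r ^ 3) * l2sq F"
    using nn_integral_lborel_reflect[of "\<lambda>c. l2sq (loc c r F)" 0] 1 by simp
qed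

text \<open>Averaging over all balls of radius \<open>r\<close> plays the role of an almost orthogonal decomposition into cubes.\<close>

lemma tri_localize:
  fixes F G H :: "spacetime \<Rightarrow> ennreal"
  assumes [measurable]: "F \<in> borel_measurable borel" "G \<in> borel_measurable borel" "H \<in> borel_measurable borel"
    and r: "0 < r"
    and H: "\<And>q. H q \<noteq> 0 \<Longrightarrow> norm (snd q) \<le> 2 * r"
    and A: "\<And>c. (tri (loc c r F) (loc (- c) (3 * r) G) H)\<^sup>2 \<le> A * (l2sq (loc c r F) * l2sq (loc (- c) (3 * r) G) * l2sq H)"
  shows "(tri F G H)\<^sup>2 \<le> 27 * A * (l2sq F * l2sq G * l2sq H)"
proof -
  let ?v = "4 / 3 * pi * r ^ 3"
  let ?T = "\<lambda>c. tri (loc c r F) (loc (- c) (3 * r) G) H"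
  have v: "0 < ?v" using r by simp
  have Tm: "?T \<in> borel_measurable borel"
    unfolding tri_def by measurable
  have "ennreal ?v * tri F G H = (\<integral>\<^sup>+p. \<integral>\<^sup>+q. \<integral>\<^sup>+c. H p * (loc c r F q * loc (- c) (3 * r) G (p - q)) \<partial>lborel \<partial>lborel \<partial>lborel)"
  proof -
    have "ennreal ?v * tri F G H = (\<integral>\<^sup>+p. \<integral>\<^sup>+q. ennreal ?v * (H p * (F q * G (p - q))) \<partial>lborel \<partial>lborel)"
      unfolding tri_def by (simp add: nn_integral_cmult)
    also have "\<dots> = (\<integral>\<^sup>+p. \<integral>\<^sup>+q. \<integral>\<^sup>+c. H p * (loc c r F q * loc (- c) (3 * r) G (p - q)) \<partial>lborel \<partial>lborel \<partial>lborel)"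
    proof (intro nn_integral_cong)
      fix p q
      have "(\<integral>\<^sup>+c. H p * (loc c r F q * loc (- c) (3 * r) G (p - q)) \<partial>lborel) =
        (\<integral>\<^sup>+c. H p * (F q * G (p - q)) * indicator (ball (snd q) r) c \<partial>lborel)"
      proof (rule nn_integral_cong)
        fix c :: "real^3"
        show "H p * (loc c r F q * loc (- c) (3 * r) G (p - q)) = H p * (F q * G (p - q)) * indicator (ball (snd q) r) c"
        \<comment> \<open>If \<open>q\<close> is within \<open>r\<close> of \<open>c\<close> and the
          output \<open>p\<close> has norm at most \<open>2 * r\<close>, then \<open>p - q\<close>
          is within \<open>3 * r\<close> of \<open>- c\<close>. So the second cutoff removes
          nothing, which explains its radius.\<close>
        proof (cases "H p \<noteq> 0 \<and> dist c (snd q) < r")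
          case True
          have "dist (- c) (snd (p - q)) = norm (snd p + (c - snd q))"
            by (simp add: dist_norm norm_minus_commute algebra_simps)
          also have "\<dots> \<le> norm (snd p) + dist c (snd q)"
            unfolding dist_norm by (rule norm_triangle_ineq)
          also have "\<dots> < 3 * r" using True H[of p] by auto
          finally show ?thesis using True by (auto simp: loc_def indicator_def dist_commute)
        next
          case False
          then show ?thesis by (auto simp: loc_def indicator_def dist_commute)
        qed
      qed
      also have "\<dots> = H p * (F q * G (p - q)) * ennreal ?v"
        using r by (subst nn_integral_cmult_indicator) (auto simp: emeasure_ball_R3)
      finally show "ennreal ?v * (H p * (F q * G (p - q))) = (\<integral>\<^sup>+c. H p * (loc c r F q * loc (- c) (3 * r) G (p - q)) \<partial>lborel)"
        by (simp only: mult.commute)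
    qed
    finally show ?thesis .
  qed
  also have "\<dots> = (\<integral>\<^sup>+p. \<integral>\<^sup>+c. \<integral>\<^sup>+q. H p * (loc c r F q * loc (- c) (3 * r) G (p - q)) \<partial>lborel \<partial>lborel \<partial>lborel)"
    by (intro nn_integral_cong lborel_pair.Fubini') measurable
  also have "\<dots> = (\<integral>\<^sup>+c. ?T c \<partial>lborel)"
    unfolding tri_def by (rule lborel_pair.Fubini') measurable
  finally have eq: "ennreal ?v * tri F G H = (\<integral>\<^sup>+c. ?T c \<partial>lborel)" .
  have "(\<integral>\<^sup>+c. ?T c \<partial>lborel)\<^sup>2 \<le>
     (\<integral>\<^sup>+c. A * l2sq H * l2sq (loc c r F) \<partial>lborel) * (\<integral>\<^sup>+c. l2sq (loc (- c) (3 * r) G) \<partial>lborel)"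
  proof (rule nn_integral_Cauchy_Schwarz)
    show "(?T c)\<^sup>2 \<le> A * l2sq H * l2sq (loc c r F) * l2sq (loc (- c) (3 * r) G)" for c
      using A[of c] by (simp add: mult_ac)
  qed (use Tm in \<open>simp_all add: l2sq_def\<close>)
  also have "(\<integral>\<^sup>+c. A * l2sq H * l2sq (loc c r F) \<partial>lborel) = A * l2sq H * (ennreal ?v * l2sq F)"
  proof -
    have "(\<lambda>c. l2sq (loc c r F)) \<in> borel_measurable lborel" unfolding l2sq_def by measurable
    then have "(\<integral>\<^sup>+c. A * l2sq H * l2sq (loc c r F) \<partial>lborel) = A * l2sq H * (\<integral>\<^sup>+c. l2sq (loc c r F) \<partial>lborel)"
      by (rule nn_integral_cmult)
    then show ?thesis using r nn_integral_l2sq_loc(1)[of F r] by simp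
  qed
  also have "(\<integral>\<^sup>+c. l2sq (loc (- c) (3 * r) G) \<partial>lborel) = ennreal (4 / 3 * pi * (3 * r) ^ 3) * l2sq G"
    using r by (intro nn_integral_l2sq_loc) auto
  \<comment> \<open>The constant 27 is the volume ratio of balls of radius \<open>3 * r\<close> and
    \<open>r\<close>.\<close>
  also have "4 / 3 * pi * (3 * r) ^ 3 = 27 * ?v" by (simp add: power_mult_distrib)
  also have "ennreal (27 * ?v) = 27 * ennreal ?v" using r by (subst ennreal_mult) auto
  finally have "(ennreal ?v * tri F G H)\<^sup>2 \<le> A * l2sq H * (ennreal ?v * l2sq F) * (27 * ennreal ?v * l2sq G)"
    unfolding eq .
  then have "(ennreal ?v)\<^sup>2 * (tri F G H)\<^sup>2 \<le> (ennreal ?v)\<^sup>2 * (27 * A * (l2sq F * l2sq G * l2sq H))"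
    by (simp add: power_mult_distrib power2_eq_square mult_ac)
  then show ?thesis
    using v by (subst (asm) ennreal_mult_le_mult_iff) (auto simp: ennreal_power power2_eq_square ennreal_mult_eq_top_iff)
qed

text \<open>After localization \<open>l2sq_conv_sq_le\<close> replaces the interaction by two
  self-interactions; \<open>12 * N0\<close> is four times the larger radius \<open>3 * N0\<close>,
  as \<open>l2sq_self_conv_le\<close> requires. The second bound is the trivial estimate on a ball
  of radius \<open>N0\<close>.\<close>

lemma tri_high_high:
  fixes F G H :: "spacetime \<Rightarrow> ennreal"
  assumes [measurable]: "F \<in> borel_measurable borel" "G \<in> borel_measurable borel" "H \<in> borel_measurable borel"
    and F: "\<And>q. F q \<noteq> 0 \<Longrightarrow> N1 / 2 \<le> norm (snd q) \<and> norm (snd q) \<le> 2 * N1 \<and> cdist q \<le> 2 * L1"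
    and G: "\<And>q. G q \<noteq> 0 \<Longrightarrow> N2 / 2 \<le> norm (snd q) \<and> norm (snd q) \<le> 2 * N2 \<and> cdist q \<le> 2 * L2"
    and H: "\<And>q. H q \<noteq> 0 \<Longrightarrow> norm (snd q) \<le> 2 * N0"
    and N: "0 < N0" "12 * N0 \<le> N1" "12 * N0 \<le> N2" "N2 \<le> 2 * N1" and L: "0 \<le> L1" "0 \<le> L2"
  shows "(tri F G H)\<^sup>2 \<le> ennreal (1328000 * N0 * N1 * L1 * L2) * (l2sq F * l2sq G * l2sq H)"
    and "(tri F G H)\<^sup>2 \<le> ennreal (1328000 * N0 ^ 3 * min L1 L2) * (l2sq F * l2sq G * l2sq H)"
proof -
  have N12: "0 < N1" "0 < N2" using N by auto
  have "(tri F G H)\<^sup>2 \<le> 27 * ennreal (49152 * N0 * N1 * L1 * L2) * (l2sq F * l2sq G * l2sq H)"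
  proof (rule tri_localize[OF assms(1-3) N(1) H])
    fix c
    let ?F = "loc c N0 F" and ?G = "loc (- c) (3 * N0) G"
    have 1: "l2sq (conv ?F ?F) \<le> ennreal (16384 * N1 * N0 * L1\<^sup>2) * (l2sq ?F * l2sq ?F)"
      by (rule l2sq_self_conv_le[where c=c])
         (use F N N12 L in \<open>auto simp: loc_neq_0 dist_norm norm_minus_commute\<close>)
    have 2: "l2sq (conv ?G ?G) \<le> ennreal (16384 * N2 * (3 * N0) * L2\<^sup>2) * (l2sq ?G * l2sq ?G)"
    proof (rule l2sq_self_conv_le[where c="-c"])
      fix q assume "?G q \<noteq> 0"
      then have "dist (- c) (snd q) < 3 * N0" "G q \<noteq> 0" by (auto simp: loc_neq_0)
      then show "norm (snd q - - c) \<le> 3 * N0 \<and> N2 / 2 \<le> norm (snd q) \<and> norm (snd q) \<le> 2 * N2 \<and> cdist q \<le> 2 * L2"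
        using G[of q] by (metis dist_commute dist_norm less_imp_le)
    qed (use N N12 L in auto)
    have "((tri ?F ?G H)\<^sup>2)\<^sup>2 \<le> (l2sq H * l2sq (conv ?F ?G))\<^sup>2"
      by (intro power_mono tri_sq_le_conv) auto
    also have "\<dots> = (l2sq H)\<^sup>2 * (l2sq (conv ?F ?G))\<^sup>2" by (simp add: power_mult_distrib)
    also have "\<dots> \<le> (l2sq H)\<^sup>2 * (l2sq (conv ?F ?F) * l2sq (conv ?G ?G))"
      by (intro mult_left_mono l2sq_conv_sq_le) auto
    also have "\<dots> \<le> (l2sq H)\<^sup>2 * ((ennreal (16384 * N1 * N0 * L1\<^sup>2) * (l2sq ?F * l2sq ?F)) *
       (ennreal (16384 * N2 * (3 * N0) * L2\<^sup>2) * (l2sq ?G * l2sq ?G)))"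
      by (intro mult_left_mono mult_mono 1 2) auto
    also have "\<dots> = (ennreal (16384 * N1 * N0 * L1\<^sup>2) * ennreal (16384 * N2 * (3 * N0) * L2\<^sup>2)) * (l2sq ?F * l2sq ?G * l2sq H)\<^sup>2"
      by (simp add: power2_eq_square mult_ac)
    \<comment> \<open>\<open>49152 = 3 * 16384\<close>, where 3 exceeds the square root of 6: a
      factor 3 comes from the larger ball and a factor 2 from
      \<open>N2 \<le> 2 * N1\<close>.\<close>
    also have "\<dots> \<le> (ennreal (49152 * N0 * N1 * L1 * L2))\<^sup>2 * (l2sq ?F * l2sq ?G * l2sq H)\<^sup>2"
    proof (rule mult_right_mono)
      have "16384 * N1 * N0 * L1\<^sup>2 * (16384 * N2 * (3 * N0) * L2\<^sup>2) = N2 * (805306368 * N1 * N0\<^sup>2 * L1\<^sup>2 * L2\<^sup>2)"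
        by (simp add: power2_eq_square)
      also have "\<dots> \<le> (2 * N1) * (805306368 * N1 * N0\<^sup>2 * L1\<^sup>2 * L2\<^sup>2)"
        using N N12 L by (intro mult_right_mono) auto
      also have "\<dots> = 1610612736 * (N1\<^sup>2 * N0\<^sup>2 * L1\<^sup>2 * L2\<^sup>2)" by (simp add: power2_eq_square)
      also have "\<dots> \<le> 2415919104 * (N1\<^sup>2 * N0\<^sup>2 * L1\<^sup>2 * L2\<^sup>2)"
        by (intro mult_right_mono) auto
      also have "\<dots> = (49152 * N0 * N1 * L1 * L2)\<^sup>2" by (simp add: power_mult_distrib)
      finally have "ennreal (16384 * N1 * N0 * L1\<^sup>2 * (16384 * N2 * (3 * N0) * L2\<^sup>2)) \<le> ennreal ((49152 * N0 * N1 * L1 * L2)\<^sup>2)"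
        by (rule ennreal_leI)
      moreover have "ennreal (16384 * N1 * N0 * L1\<^sup>2 * (16384 * N2 * (3 * N0) * L2\<^sup>2)) = ennreal (16384 * N1 * N0 * L1\<^sup>2) * ennreal (16384 * N2 * (3 * N0) * L2\<^sup>2)"
        using N N12 by (intro ennreal_mult) auto
      moreover have "ennreal ((49152 * N0 * N1 * L1 * L2)\<^sup>2) = (ennreal (49152 * N0 * N1 * L1 * L2))\<^sup>2"
        using N N12 L by (intro ennreal_power[symmetric]) auto
      ultimately show "ennreal (16384 * N1 * N0 * L1\<^sup>2) * ennreal (16384 * N2 * (3 * N0) * L2\<^sup>2) \<le> (ennreal (49152 * N0 * N1 * L1 * L2))\<^sup>2"
        by simp
    qed simp
    also have "\<dots> = (ennreal (49152 * N0 * N1 * L1 * L2) * (l2sq ?F * l2sq ?G * l2sq H))\<^sup>2"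
      by (simp add: power_mult_distrib)
    finally show "(tri ?F ?G H)\<^sup>2 \<le> ennreal (49152 * N0 * N1 * L1 * L2) * (l2sq ?F * l2sq ?G * l2sq H)"
      by (rule ennreal_power2_le_cancel)
  qed
  also have "27 * ennreal (49152 * N0 * N1 * L1 * L2) = ennreal (27 * (49152 * N0 * N1 * L1 * L2))"
    using N N12 L by (subst ennreal_mult) auto
  also have "\<dots> \<le> ennreal (1328000 * N0 * N1 * L1 * L2)"
  proof (rule ennreal_leI)
    have "0 \<le> N0 * N1 * L1 * L2" using N N12 L by simp
    then have "1327104 * (N0 * N1 * L1 * L2) \<le> 1328000 * (N0 * N1 * L1 * L2)" by (intro mult_right_mono) auto
    then show "27 * (49152 * N0 * N1 * L1 * L2) \<le> 1328000 * N0 * N1 * L1 * L2" by (simp add: mult.assoc)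
  qed
  finally show "(tri F G H)\<^sup>2 \<le> ennreal (1328000 * N0 * N1 * L1 * L2) * (l2sq F * l2sq G * l2sq H)"
    by (auto simp: mult_right_mono)
  have "(tri F G H)\<^sup>2 \<le> 27 * ennreal (24 * N0 ^ 3 * min (2 * L1) (2 * L2)) * (l2sq F * l2sq G * l2sq H)"
  proof (rule tri_localize[OF assms(1-3) N(1) H])
    fix c
    show "(tri (loc c N0 F) (loc (- c) (3 * N0) G) H)\<^sup>2 \<le> ennreal (24 * N0 ^ 3 * min (2 * L1) (2 * L2)) *
        (l2sq (loc c N0 F) * l2sq (loc (- c) (3 * N0) G) * l2sq H)"
      by (rule tri_trivial[where c=c]) (use F G N L in \<open>auto simp: loc_neq_0\<close>)
  qed
  also have "27 * ennreal (24 * N0 ^ 3 * min (2 * L1) (2 * L2)) = ennreal (27 * (24 * N0 ^ 3 * min (2 * L1) (2 * L2)))"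
    using N L by (subst ennreal_mult) auto
  also have "\<dots> \<le> ennreal (1328000 * N0 ^ 3 * min L1 L2)"
  proof (rule ennreal_leI)
    have "27 * (24 * N0 ^ 3 * min (2 * L1) (2 * L2)) = 1296 * (N0 ^ 3 * min L1 L2)" by (simp add: min_def)
    also have "\<dots> \<le> 1328000 * (N0 ^ 3 * min L1 L2)" using N L by (intro mult_right_mono) auto
    finally show "27 * (24 * N0 ^ 3 * min (2 * L1) (2 * L2)) \<le> 1328000 * N0 ^ 3 * min L1 L2" by simp
  qed
  finally show "(tri F G H)\<^sup>2 \<le> ennreal (1328000 * N0 ^ 3 * min L1 L2) * (l2sq F * l2sq G * l2sq H)"
    by (auto simp: mult_right_mono)
qed

section \<open>Discrete sums\<close>

lemma nn_integral_count_nat_le: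
  fixes f :: "nat \<Rightarrow> real"
  assumes "\<And>n. 0 \<le> f n" "\<And>N. (\<Sum>n<N. f n) \<le> C"
  shows "(\<integral>\<^sup>+n. ennreal (f n) \<partial>count_space UNIV) \<le> ennreal C"
  unfolding nn_integral_count_space_nat suminf_eq_SUP
  by (intro SUP_least) (simp add: sum_ennreal assms ennreal_leI)

lemma geometric_peak_sum:
  fixes e c :: real
  assumes e: "0 < e"
  shows "(\<integral>\<^sup>+n. ennreal (2 powr (- e * \<bar>real n - c\<bar>)) \<partial>count_space UNIV) \<le> ennreal (2 / (1 - 2 powr (- e)))"
proof (rule nn_integral_count_nat_le)
  define r :: real where "r = 2 powr (- e)"
  have r: "0 < r" "r < 1" using e by (auto simp: r_def powr_less_one)
  have geo: "(\<Sum>j<M. r ^ j) \<le> 1 / (1 - r)" for M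
  proof -
    have "(\<Sum>j<M. r ^ j) = (1 - r ^ M) / (1 - r)" using r by (simp add: sum_gp_strict)
    also have "\<dots> \<le> 1 / (1 - r)" using r by (intro divide_right_mono) auto
    finally show ?thesis .
  qed
  have rp: "r ^ j = 2 powr (- e * real j)" for j
    using r by (simp add: r_def powr_realpow[symmetric] powr_powr)
  \<comment> \<open>Rounding \<open>c\<close> up for the terms on its right and down for those on
    its left shortens distances and so enlarges the terms; for negative \<open>c\<close>,
    \<open>nat\<close> moves the peak to 0 with the same effect. A geometric series remains on each
    side.\<close>
  let ?k = "nat \<lceil>c\<rceil>" and ?K = "nat \<lfloor>c\<rfloor>"
  fix N
  have up: "(\<Sum>n<N. if k \<le> n then r ^ (n - k) else 0) = (\<Sum>j<N - k. r ^ j)" for N k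
    by (induction N) (auto simp: Suc_diff_le not_le)
  have dn: "(\<Sum>n<N. if n \<le> ?K then r ^ (?K - n) else 0) \<le> (\<Sum>j<Suc ?K. r ^ j)"
  proof -
    have "(\<Sum>n<N. if n \<le> ?K then r ^ (?K - n) else 0) = (\<Sum>n\<in>{..<N} \<inter> {..?K}. r ^ (?K - n))"
      by (subst sum.inter_restrict) auto
    also have "\<dots> \<le> (\<Sum>n\<in>{..?K}. r ^ (?K - n))"
      using r by (intro sum_mono2) auto
    also have "\<dots> = (\<Sum>n<Suc ?K. r ^ (Suc ?K - Suc n))" by (simp add: lessThan_Suc_atMost)
    also have "\<dots> = (\<Sum>j<Suc ?K. r ^ j)" by (rule sum.nat_diff_reindex)
    finally show ?thesis .
  qed
  have "(\<Sum>n<N. 2 powr (- e * \<bar>real n - c\<bar>)) \<le>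
    (\<Sum>n<N. (if ?k \<le> n then r ^ (n - ?k) else 0) + (if n \<le> ?K then r ^ (?K - n) else 0))"
  proof (rule sum_mono)
    fix n
    show "2 powr (- e * \<bar>real n - c\<bar>) \<le> (if ?k \<le> n then r ^ (n - ?k) else 0) + (if n \<le> ?K then r ^ (?K - n) else 0)"
    proof (cases "c \<le> real n")
      case True
      then have k: "?k \<le> n" by linarith
      have "real (n - ?k) \<le> \<bar>real n - c\<bar>" using k True by linarith
      then have "2 powr (- e * \<bar>real n - c\<bar>) \<le> r ^ (n - ?k)"
        unfolding rp using e by (intro powr_mono) auto
      then show ?thesis using k r by (auto intro: order_trans add_increasing2)
    next
      case False
      then have k: "n \<le> ?K" by linarith
      have "real (?K - n) \<le> \<bar>real n - c\<bar>" using k False by linarith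
      then have "2 powr (- e * \<bar>real n - c\<bar>) \<le> r ^ (?K - n)"
        unfolding rp using e by (intro powr_mono) auto
      then show ?thesis using k r by (auto intro: order_trans add_increasing)
    qed
  qed
  also have "\<dots> = (\<Sum>j<N - ?k. r ^ j) + (\<Sum>n<N. if n \<le> ?K then r ^ (?K - n) else 0)"
    by (simp only: sum.distrib up)
  also have "\<dots> \<le> 1 / (1 - r) + 1 / (1 - r)"
    using dn geo[of "N - ?k"] geo[of "Suc ?K"] by linarith
  finally show "(\<Sum>n<N. 2 powr (- e * \<bar>real n - c\<bar>)) \<le> 2 / (1 - 2 powr (- e))" by (simp add: r_def)
qed simp

text \<open>The bound is independent of the positions of the peaks, as Schur's test demands of row
  and column sums. The peaks will be vertices of piecewise linear exponents, and the alternative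
  that holds may change with \<open>n\<close>.\<close>

lemma sum_two_powr_peaks_le:
  fixes e :: real and f :: "nat \<Rightarrow> real"
  assumes e: "0 < e"
    and f: "\<And>n. f n \<le> - e * \<bar>real n - c1\<bar> \<or> f n \<le> - e * \<bar>real n - c2\<bar> \<or> f n \<le> - e * \<bar>real n - c3\<bar>"
  shows "(\<integral>\<^sup>+n. ennreal (2 powr f n) \<partial>count_space UNIV) \<le> ennreal (6 / (1 - 2 powr (- e)))"
proof -
  let ?g = "\<lambda>c n. ennreal (2 powr (- e * \<bar>real n - c\<bar>))"
  let ?C = "2 / (1 - 2 powr (- e))"
  have C: "0 \<le> ?C" using e by (auto simp: powr_less_one less_imp_le)
  have "(\<integral>\<^sup>+n. ennreal (2 powr f n) \<partial>count_space UNIV) \<le> (\<integral>\<^sup>+n. ?g c1 n + (?g c2 n + ?g c3 n) \<partial>count_space UNIV)"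
  proof (rule nn_integral_mono)
    fix n
    consider "f n \<le> - e * \<bar>real n - c1\<bar>" | "f n \<le> - e * \<bar>real n - c2\<bar>" | "f n \<le> - e * \<bar>real n - c3\<bar>"
      using f by blast
    then show "ennreal (2 powr f n) \<le> ?g c1 n + (?g c2 n + ?g c3 n)"
    proof cases
      case 1
      then have "ennreal (2 powr f n) \<le> ?g c1 n" by (intro ennreal_leI powr_mono) auto
      then show ?thesis by (rule order_trans) simp
    next
      case 2
      then have "ennreal (2 powr f n) \<le> ?g c2 n" by (intro ennreal_leI powr_mono) auto
      also have "\<dots> \<le> ?g c2 n + ?g c3 n" by simp
      finally show ?thesis by (rule order_trans) simp
    next
      case 3
      then have "ennreal (2 powr f n) \<le> ?g c3 n" by (intro ennreal_leI powr_mono) auto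
      also have "\<dots> \<le> ?g c2 n + ?g c3 n" by simp
      finally show ?thesis by (rule order_trans) simp
    qed
  qed
  also have "\<dots> \<le> ennreal ?C + (ennreal ?C + ennreal ?C)"
    by (simp only: nn_integral_add[OF borel_measurable_count_space borel_measurable_count_space])
       (intro add_mono geometric_peak_sum e)
  also have "\<dots> = ennreal (?C + (?C + ?C))"
    using C by (simp only: ennreal_plus add_nonneg_nonneg)
  finally show ?thesis by simp
qed

text \<open>Schur's test: in Cauchy-Schwarz one copy of \<open>K\<close> goes with \<open>X\<close>
  and the other with \<open>Y\<close>, leaving row and column sums. \<open>Z\<close> belongs to the
  third function, which is not decomposed.\<close>

lemma schur_bilinear:
  fixes T K :: "nat \<Rightarrow> nat \<Rightarrow> ennreal" and X Y :: "nat \<Rightarrow> ennreal"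
  assumes T: "\<And>a b. (T a b)\<^sup>2 \<le> (K a b)\<^sup>2 * (X a * Y b * Z)"
    and A: "\<And>a. (\<integral>\<^sup>+b. K a b \<partial>count_space UNIV) \<le> A"
    and B: "\<And>b. (\<integral>\<^sup>+a. K a b \<partial>count_space UNIV) \<le> B"
  shows "(\<integral>\<^sup>+a. \<integral>\<^sup>+b. T a b \<partial>count_space UNIV \<partial>count_space UNIV)\<^sup>2 \<le>
    A * B * ((\<integral>\<^sup>+a. X a \<partial>count_space UNIV) * (\<integral>\<^sup>+b. Y b \<partial>count_space UNIV) * Z)"
proof -
  have "(\<integral>\<^sup>+a. \<integral>\<^sup>+b. T a b \<partial>count_space UNIV \<partial>count_space UNIV) = (\<integral>\<^sup>+(a, b). T a b \<partial>count_space UNIV)"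
    using nn_integral_fst_count_space[of "\<lambda>(a, b). T a b"] by simp
  also have "\<dots>\<^sup>2 \<le> (\<integral>\<^sup>+(a, b). K a b * X a * Z \<partial>count_space UNIV) * (\<integral>\<^sup>+(a, b). K a b * Y b \<partial>count_space UNIV)"
  proof (rule nn_integral_Cauchy_Schwarz)
    fix x :: "nat \<times> nat"
    show "(case x of (a, b) \<Rightarrow> T a b)\<^sup>2 \<le> (case x of (a, b) \<Rightarrow> K a b * X a * Z) * (case x of (a, b) \<Rightarrow> K a b * Y b)"
      using T[of "fst x" "snd x"] by (simp add: split_beta power2_eq_square mult_ac)
  qed simp_all
  also have "(\<integral>\<^sup>+(a, b). K a b * X a * Z \<partial>count_space UNIV) \<le> A * (\<integral>\<^sup>+a. X a \<partial>count_space UNIV) * Z"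
  proof -
    have "(\<integral>\<^sup>+(a, b). K a b * X a * Z \<partial>count_space UNIV) = (\<integral>\<^sup>+a. \<integral>\<^sup>+b. K a b * (X a * Z) \<partial>count_space UNIV \<partial>count_space UNIV)"
      using nn_integral_fst_count_space[of "\<lambda>(a, b). K a b * X a * Z"] by (simp add: mult.assoc)
    also have "\<dots> \<le> (\<integral>\<^sup>+a. A * (X a * Z) \<partial>count_space UNIV)"
      by (intro nn_integral_mono) (simp add: nn_integral_multc A mult_right_mono)
    also have "\<dots> = A * (\<integral>\<^sup>+a. X a \<partial>count_space UNIV) * Z"
      by (simp add: nn_integral_cmult nn_integral_multc mult.assoc)
    finally show ?thesis .
  qed
  also have "(\<integral>\<^sup>+(a, b). K a b * Y b \<partial>count_space UNIV) \<le> B * (\<integral>\<^sup>+b. Y b \<partial>count_space UNIV)"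
  proof -
    have "(\<integral>\<^sup>+(a, b). K a b * Y b \<partial>count_space UNIV) = (\<integral>\<^sup>+b. \<integral>\<^sup>+a. K a b * Y b \<partial>count_space UNIV \<partial>count_space UNIV)"
      using nn_integral_snd_count_space[of "\<lambda>(a, b). K a b * Y b"] by simp
    also have "\<dots> \<le> (\<integral>\<^sup>+b. B * Y b \<partial>count_space UNIV)"
      by (intro nn_integral_mono) (simp add: nn_integral_multc B mult_right_mono)
    also have "\<dots> = B * (\<integral>\<^sup>+b. Y b \<partial>count_space UNIV)"
      by (simp add: nn_integral_cmult)
    finally show ?thesis .
  qed
  finally show ?thesis by (simp add: mult_ac mult_left_mono mult_right_mono)
qed

lemma nn_integral_near_le:
  fixes f :: "nat \<Rightarrow> ennreal"
  assumes "\<And>k. f k \<le> A" "\<And>k. f k \<noteq> 0 \<Longrightarrow> k \<le> j + c \<and> j \<le> k + c"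
  shows "(\<integral>\<^sup>+k. f k \<partial>count_space UNIV) \<le> of_nat (2 * c + 1) * A"
proof -
  have "(\<integral>\<^sup>+k. f k \<partial>count_space UNIV) \<le> (\<integral>\<^sup>+k. A * indicator {j - c..j + c} k \<partial>count_space UNIV)"
  proof (rule nn_integral_mono)
    fix k show "f k \<le> A * indicator {j - c..j + c} k"
      using assms(1)[of k] assms(2)[of k] by (cases "f k = 0") (auto simp: indicator_def)
  qed
  also have "\<dots> = A * of_nat (card {j - c..j + c})"
    by (subst nn_integral_cmult_indicator) (simp_all add: emeasure_count_space)
  also have "\<dots> \<le> A * of_nat (2 * c + 1)"
    by (intro mult_left_mono) (auto intro!: of_nat_mono simp del: of_nat_Suc of_nat_add)
  finally show ?thesis by (simp add: mult.commute)
qed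

text \<open>\<open>i\<close> is the low frequency, \<open>j\<close> and \<open>k\<close> are the two
  comparable high ones. Bounding each \<open>X i\<close> by the whole sum leaves \<open>i\<close>
  only in the kernel, and near the diagonal a sum over \<open>j\<close> or over \<open>k\<close> has
  at most \<open>2 * c + 1\<close> terms.\<close>

lemma schur_trilinear:
  fixes T :: "nat \<Rightarrow> nat \<Rightarrow> nat \<Rightarrow> ennreal" and w :: "nat \<Rightarrow> nat \<Rightarrow> ennreal" and X Y Z :: "nat \<Rightarrow> ennreal"
  assumes T: "\<And>i j k. (T i j k)\<^sup>2 \<le> (w i j)\<^sup>2 * (X i * Y j * Z k)"
    and near: "\<And>i j k. T i j k \<noteq> 0 \<Longrightarrow> k \<le> j + c \<and> j \<le> k + c"
    and A: "\<And>j. (\<integral>\<^sup>+i. w i j \<partial>count_space UNIV) \<le> A"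
  shows "(\<integral>\<^sup>+j. \<integral>\<^sup>+k. \<integral>\<^sup>+i. T i j k \<partial>count_space UNIV \<partial>count_space UNIV \<partial>count_space UNIV)\<^sup>2 \<le>
    (of_nat (2 * c + 1) * A)\<^sup>2 * ((\<integral>\<^sup>+i. X i \<partial>count_space UNIV) * (\<integral>\<^sup>+j. Y j \<partial>count_space UNIV) * (\<integral>\<^sup>+k. Z k \<partial>count_space UNIV))"
proof -
  let ?C = "count_space UNIV"
  let ?X = "\<integral>\<^sup>+i. X i \<partial>?C" and ?D = "of_nat (2 * c + 1) * A"
  define v :: "nat \<Rightarrow> nat \<Rightarrow> nat \<Rightarrow> ennreal" where
    "v i j k = w i j * indicator {k. k \<le> j + c \<and> j \<le> k + c} k" for i j k
  have Xi: "X i \<le> ?X" for i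
  proof -
    have "X i = (\<integral>\<^sup>+k. X k * indicator {i} k \<partial>?C)"
      by (simp add: nn_integral_count_space_indicator[symmetric] emeasure_count_space)
    also have "\<dots> \<le> ?X" by (intro nn_integral_mono) (auto simp: indicator_def)
    finally show ?thesis .
  qed
  have v: "(\<integral>\<^sup>+i. v i j k \<partial>?C) \<le> A" "(\<integral>\<^sup>+i. v i j k \<partial>?C) \<noteq> 0 \<Longrightarrow> k \<le> j + c \<and> j \<le> k + c" for j k
  proof -
    have "(\<integral>\<^sup>+i. v i j k \<partial>?C) \<le> (\<integral>\<^sup>+i. w i j \<partial>?C)"
      by (intro nn_integral_mono) (auto simp: v_def indicator_def)
    then show "(\<integral>\<^sup>+i. v i j k \<partial>?C) \<le> A" using A[of j] by (rule order_trans)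
    assume "(\<integral>\<^sup>+i. v i j k \<partial>?C) \<noteq> 0"
    then obtain i where "v i j k \<noteq> 0" by (auto simp: nn_integral_0_iff_AE AE_count_space)
    then show "k \<le> j + c \<and> j \<le> k + c" by (auto simp: v_def indicator_def split: if_splits)
  qed
  have vk: "(\<integral>\<^sup>+k. \<integral>\<^sup>+i. v i j k \<partial>?C \<partial>?C) \<le> ?D" for j
    by (rule nn_integral_near_le[of _ _ j]) (use v in auto)
  have vj: "(\<integral>\<^sup>+j. \<integral>\<^sup>+i. v i j k \<partial>?C \<partial>?C) \<le> ?D" for k
    by (rule nn_integral_near_le[of _ _ k]) (use v in auto)
  have "(\<integral>\<^sup>+j. \<integral>\<^sup>+k. \<integral>\<^sup>+i. T i j k \<partial>?C \<partial>?C \<partial>?C) = (\<integral>\<^sup>+j. \<integral>\<^sup>+(k, i). T i j k \<partial>?C \<partial>?C)"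
    using nn_integral_fst_count_space[of "\<lambda>(k, i). T i _ k"] by simp
  also have "\<dots> = (\<integral>\<^sup>+(j, k, i). T i j k \<partial>?C)"
    using nn_integral_fst_count_space[of "\<lambda>(j, k, i). T i j k"] by simp
  also have "\<dots>\<^sup>2 \<le> (\<integral>\<^sup>+(j, k, i). v i j k * (?X * Y j) \<partial>?C) * (\<integral>\<^sup>+(j, k, i). v i j k * Z k \<partial>?C)"
  proof (rule nn_integral_Cauchy_Schwarz)
    fix x :: "nat \<times> nat \<times> nat"
    obtain j k i where x: "x = (j, k, i)" by (cases x) auto
    have "(T i j k)\<^sup>2 \<le> v i j k * (?X * Y j) * (v i j k * Z k)"
    proof (cases "T i j k = 0")
      case False
      have "(T i j k)\<^sup>2 \<le> (w i j)\<^sup>2 * (X i * Y j * Z k)" by (rule T)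
      also have "\<dots> \<le> (w i j)\<^sup>2 * (?X * Y j * Z k)" by (intro mult_left_mono mult_right_mono Xi) auto
      also have "w i j = v i j k" using near[OF False] by (simp add: v_def)
      finally show ?thesis by (simp add: power2_eq_square mult_ac)
    qed simp
    then show "(case x of (j, k, i) \<Rightarrow> T i j k)\<^sup>2 \<le> (case x of (j, k, i) \<Rightarrow> v i j k * (?X * Y j)) * (case x of (j, k, i) \<Rightarrow> v i j k * Z k)"
      by (simp add: x)
  qed simp_all
  also have "(\<integral>\<^sup>+(j, k, i). v i j k * (?X * Y j) \<partial>?C) \<le> ?D * (?X * (\<integral>\<^sup>+j. Y j \<partial>?C))"
  proof -
    have "(\<integral>\<^sup>+(j, k, i). v i j k * (?X * Y j) \<partial>?C) = (\<integral>\<^sup>+j. \<integral>\<^sup>+(k, i). v i j k * (?X * Y j) \<partial>?C \<partial>?C)"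
      using nn_integral_fst_count_space[of "\<lambda>(j, k, i). v i j k * (?X * Y j)"] by simp
    also have "\<dots> = (\<integral>\<^sup>+j. (\<integral>\<^sup>+k. \<integral>\<^sup>+i. v i j k \<partial>?C \<partial>?C) * (?X * Y j) \<partial>?C)"
    proof (rule nn_integral_cong)
      fix j
      have "(\<integral>\<^sup>+(k, i). v i j k * (?X * Y j) \<partial>?C) = (\<integral>\<^sup>+k. \<integral>\<^sup>+i. v i j k * (?X * Y j) \<partial>?C \<partial>?C)"
        using nn_integral_fst_count_space[of "\<lambda>(k, i). v i j k * (?X * Y j)"] by simp
      also have "\<dots> = (\<integral>\<^sup>+k. \<integral>\<^sup>+i. v i j k \<partial>?C \<partial>?C) * (?X * Y j)"
        by (simp add: nn_integral_multc)
      finally show "(\<integral>\<^sup>+(k, i). v i j k * (?X * Y j) \<partial>?C) = \<dots>" .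
    qed
    also have "\<dots> \<le> (\<integral>\<^sup>+j. ?D * (?X * Y j) \<partial>?C)"
      by (intro nn_integral_mono mult_right_mono vk) auto
    also have "\<dots> = ?D * (?X * (\<integral>\<^sup>+j. Y j \<partial>?C))"
      by (simp add: nn_integral_cmult)
    finally show ?thesis .
  qed
  also have "(\<integral>\<^sup>+(j, k, i). v i j k * Z k \<partial>?C) \<le> ?D * (\<integral>\<^sup>+k. Z k \<partial>?C)"
  proof -
    have "(\<integral>\<^sup>+(j, k, i). v i j k * Z k \<partial>?C) = (\<integral>\<^sup>+j. \<integral>\<^sup>+(k, i). v i j k * Z k \<partial>?C \<partial>?C)"
      using nn_integral_fst_count_space[of "\<lambda>(j, k, i). v i j k * Z k"] by simp
    also have "\<dots> = (\<integral>\<^sup>+j. \<integral>\<^sup>+k. (\<integral>\<^sup>+i. v i j k \<partial>?C) * Z k \<partial>?C \<partial>?C)"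
    proof (rule nn_integral_cong)
      fix j
      have "(\<integral>\<^sup>+(k, i). v i j k * Z k \<partial>?C) = (\<integral>\<^sup>+k. \<integral>\<^sup>+i. v i j k * Z k \<partial>?C \<partial>?C)"
        using nn_integral_fst_count_space[of "\<lambda>(k, i). v i j k * Z k"] by simp
      then show "(\<integral>\<^sup>+(k, i). v i j k * Z k \<partial>?C) = (\<integral>\<^sup>+k. (\<integral>\<^sup>+i. v i j k \<partial>?C) * Z k \<partial>?C)"
        by (simp add: nn_integral_multc)
    qed
    also have "\<dots> = (\<integral>\<^sup>+k. \<integral>\<^sup>+j. (\<integral>\<^sup>+i. v i j k \<partial>?C) * Z k \<partial>?C \<partial>?C)"
      using nn_integral_fst_count_space[of "\<lambda>(j, k). (\<integral>\<^sup>+i. v i j k \<partial>?C) * Z k"]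
        nn_integral_snd_count_space[of "\<lambda>(j, k). (\<integral>\<^sup>+i. v i j k \<partial>?C) * Z k"] by simp
    also have "\<dots> \<le> (\<integral>\<^sup>+k. ?D * Z k \<partial>?C)"
    proof (rule nn_integral_mono)
      fix k
      show "(\<integral>\<^sup>+j. (\<integral>\<^sup>+i. v i j k \<partial>?C) * Z k \<partial>?C) \<le> ?D * Z k"
        using mult_right_mono[OF vj[of k], of "Z k"] by (subst nn_integral_multc) auto
    qed
    also have "\<dots> = ?D * (\<integral>\<^sup>+k. Z k \<partial>?C)"
      by (simp add: nn_integral_cmult)
    finally show ?thesis .
  qed
  finally show ?thesis by (simp add: mult_ac mult_left_mono mult_right_mono power2_eq_square)
qed

text \<open>\<open>theta b1 b2\<close> is the power of \<open>2\<^sup>m\<close> lost in summing over modulations below \<open>2\<^sup>m\<close>; for negative \<open>m\<close>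
  only the gain \<open>2\<^bsup>m/2\<^esup>\<close> of the trivial estimate remains.\<close>

definition theta :: "real \<Rightarrow> real \<Rightarrow> real" where
  "theta b1 b2 = max 0 (1/2 - b1) + max 0 (1/2 - b2)"

definition kappa :: "real \<Rightarrow> real \<Rightarrow> real \<Rightarrow> real" where
  "kappa b1 b2 m = (if 0 \<le> m then theta b1 b2 * m else m / 2)"

lemma theta_commute: "theta b1 b2 = theta b2 b1"
  by (simp add: theta_def)

text \<open>\<open>a\<close> and \<open>b\<close> are the logarithms of the modulations. For fixed
  \<open>a\<close> the exponent is piecewise linear in \<open>b\<close> and falls off from one of
  the points \<open>a\<close>, \<open>max m 0\<close> and \<open>0\<close>. While both modulations
  lie below the threshold, the rate in \<open>b\<close> is \<open>\<bar>1/2 - b2\<bar>\<close>,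
  which is why \<open>b2 = 1/2\<close> is excluded; above it, \<open>1/2 \<le> b1 + b2\<close>
  prevents growth when \<open>a\<close> and \<open>b\<close> increase together.\<close>

lemma modulation_exponent:
  fixes a b m b1 b2 :: real
  assumes ab: "0 \<le> a" "0 \<le> b" and b12: "0 < b1" "0 < b2" "b1 \<noteq> 1/2" "b2 \<noteq> 1/2" "1/2 \<le> b1 + b2"
    and e: "e \<le> b1" "e \<le> b2" "e \<le> \<bar>1/2 - b2\<bar>"
  defines "E \<equiv> (min a b + min (max a b) m) / 2 - b1 * a - b2 * b - kappa b1 b2 m"
  shows "E \<le> - e * \<bar>b - a\<bar> \<or> E \<le> - e * \<bar>b - max m 0\<bar> \<or> E \<le> - e * \<bar>b - 0\<bar>"
proof -
  \<comment> \<open>A negative threshold acts like 0, because the gain \<open>m / 2\<close> is then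
    exactly \<open>kappa\<close> and drops out of \<open>E\<close>.\<close>
  define M where "M = max m 0"
  define t1 where "t1 = max 0 (1/2 - b1)"
  define t2 where "t2 = max 0 (1/2 - b2)"
  have M: "0 \<le> M" by (simp add: M_def)
  have EM: "E = (min a b + min (max a b) M) / 2 - b1 * a - b2 * b - (t1 + t2) * M"
  proof (cases "0 \<le> m")
    case True
    then show ?thesis by (simp add: E_def kappa_def theta_def M_def t1_def t2_def)
  next
    case False
    then have "min (max a b) m = m" "min (max a b) M = 0" using ab by (auto simp: M_def)
    then show ?thesis using False by (simp add: E_def kappa_def M_def field_simps)
  qed
  have t: "0 \<le> t1" "0 \<le> t2" "1/2 - b1 \<le> t1" "1/2 - b2 \<le> t2" by (auto simp: t1_def t2_def)
  have tM: "(1/2 - b1) * M \<le> t1 * M" "(1/2 - b2) * M \<le> t2 * M" "0 \<le> t1 * M" "0 \<le> t2 * M"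
    using t M by (auto intro: mult_right_mono)
  have eb: "e * x \<le> b1 * x" "e * x \<le> b2 * x" "e * x \<le> \<bar>1/2 - b2\<bar> * x" if "0 \<le> x" for x
    using e that by (auto intro: mult_right_mono)
  consider "a \<le> M" "b \<le> M" | "b \<le> a" "M < a" | "a < b" "M < b" by linarith
  then show ?thesis
  proof cases
    case 1
    have "min a b + min (max a b) M = a + b" using 1 by (auto simp: min_def max_def)
    then have EE: "E = ((1/2 - b1) * a - t1 * M) + ((1/2 - b2) * b - t2 * M)"
      unfolding EM by (simp add: algebra_simps add_divide_distrib)
    have "(1/2 - b1) * a \<le> t1 * a" using ab t by (intro mult_right_mono) auto
    also have "\<dots> \<le> t1 * M" using 1 t by (intro mult_left_mono) auto
    finally have "E \<le> (1/2 - b2) * b - t2 * M" unfolding EE by simp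
    moreover have "(1/2 - b2) * b - t2 * M \<le> - e * \<bar>b - M\<bar> \<or> (1/2 - b2) * b - t2 * M \<le> - e * \<bar>b - 0\<bar>"
    proof (cases "b2 < 1/2")
      case True
      then have "(1/2 - b2) * b - t2 * M = - ((1/2 - b2) * (M - b))" by (simp add: t2_def right_diff_distrib)
      also have "\<dots> \<le> - (e * (M - b))" using eb(3)[of "M - b"] 1 True by simp
      finally show ?thesis using 1 by simp
    next
      case False
      then have "(1/2 - b2) * b = - (\<bar>1/2 - b2\<bar> * b)" by (simp add: algebra_simps)
      then have "(1/2 - b2) * b \<le> - (e * b)" using eb(3)[of b] ab by simp
      then show ?thesis using tM(4) ab by simp
    qed
    ultimately show ?thesis unfolding M_def by linarith
  next
    case 2
    have "min a b + min (max a b) M = b + M" using 2 by (auto simp: min_def max_def)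
    then have EE: "E = M / 2 - b1 * a + (1/2 - b2) * b - t1 * M - t2 * M"
      unfolding EM by (simp add: algebra_simps add_divide_distrib)
    show ?thesis
    proof (cases "b2 < 1/2")
      case True
      have "(1/2 - b1 - b2) * a \<le> (1/2 - b1 - b2) * M" using 2 b12 by (intro mult_left_mono_neg) auto
      moreover have "(1/2 - b2) * (a - b) \<ge> e * (a - b)" using eb(3)[of "a - b"] 2 True by simp
      moreover have "E = M / 2 + (1/2 - b1 - b2) * a - (1/2 - b2) * (a - b) - t1 * M - t2 * M"
        unfolding EE by (simp add: field_simps)
      moreover have "M / 2 + (1/2 - b1 - b2) * M = (1/2 - b1) * M + (1/2 - b2) * M" by (simp add: field_simps)
      ultimately have "E \<le> - (e * (a - b))" using tM by linarith
      then show ?thesis using 2 by simp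
    next
      case False
      have "b1 * M \<le> b1 * a" using 2 b12 by (intro mult_left_mono) auto
      moreover have "(1/2 - b2) * b = - (\<bar>1/2 - b2\<bar> * b)" using False by (simp add: algebra_simps)
      moreover have "M / 2 - b1 * M = (1/2 - b1) * M" by (simp add: algebra_simps)
      ultimately have "E \<le> - (e * b)" unfolding EE using eb(3)[of b] ab tM by linarith
      then show ?thesis using ab by simp
    qed
  next
    case 3
    have "min a b + min (max a b) M = a + M" using 3 by (auto simp: min_def max_def)
    then have EE: "E = M / 2 + (1/2 - b1) * a - b2 * b - t1 * M - t2 * M"
      unfolding EM by (simp add: algebra_simps add_divide_distrib)
    have M2: "M / 2 - b2 * M = (1/2 - b2) * M" by (simp add: algebra_simps)
    have bM: "b2 * b = b2 * M + b2 * (b - M)" by (simp add: algebra_simps)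
    have eM: "e * (b - M) \<le> b2 * (b - M)" using eb(2)[of "b - M"] 3 by simp
    show ?thesis
    proof (cases "b1 < 1/2 \<and> M \<le> a")
      case True
      have "(1/2 - b1 - b2) * a \<le> (1/2 - b1 - b2) * M" using True b12 by (intro mult_left_mono_neg) auto
      moreover have "b2 * (b - a) \<ge> e * (b - a)" using eb(2)[of "b - a"] 3 by simp
      moreover have "E = M / 2 + (1/2 - b1 - b2) * a - b2 * (b - a) - t1 * M - t2 * M"
        unfolding EE by (simp add: field_simps)
      moreover have "M / 2 + (1/2 - b1 - b2) * M = (1/2 - b1) * M + (1/2 - b2) * M" by (simp add: field_simps)
      ultimately have "E \<le> - (e * (b - a))" using tM by linarith
      then show ?thesis using 3 by simp
    next
      case False
      have "(1/2 - b1) * a \<le> t1 * M"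
      proof (cases "b1 < 1/2")
        case True
        then have "(1/2 - b1) * a \<le> (1/2 - b1) * M" using False by (intro mult_left_mono) auto
        then show ?thesis using tM by linarith
      next
        case False
        then have "(1/2 - b1) * a \<le> 0" using ab by (simp add: mult_nonpos_nonneg)
        then show ?thesis using tM by linarith
      qed
      then have "E \<le> - (e * (b - M))" unfolding EE using M2 bM eM tM by linarith
      then show ?thesis using 3 unfolding M_def by simp
    qed
  qed
qed

text \<open>Binary logarithm of \<open>sqrt (L_min * min L_max (2^m)) / (L1^b1 * L2^b2)\<close> for
  \<open>L1 = 2^a\<close> and \<open>L2 = 2^b\<close>.\<close>

definition mweight :: "real \<Rightarrow> real \<Rightarrow> real \<Rightarrow> nat \<Rightarrow> nat \<Rightarrow> real" where
  "mweight b1 b2 m a b = (min (real a) (real b) + min (max (real a) (real b)) m) / 2 - b1 * real a - b2 * real b"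

lemma modulation_sum:
  assumes b12: "0 < b1" "0 < b2" "b1 \<noteq> 1/2" "b2 \<noteq> 1/2" "1/2 \<le> b1 + b2"
  obtains C where "0 < C"
    "\<And>m a. (\<integral>\<^sup>+b. ennreal (2 powr mweight b1 b2 m a b) \<partial>count_space UNIV) \<le> ennreal (C * 2 powr kappa b1 b2 m)"
    "\<And>m b. (\<integral>\<^sup>+a. ennreal (2 powr mweight b1 b2 m a b) \<partial>count_space UNIV) \<le> ennreal (C * 2 powr kappa b1 b2 m)"
proof -
  define e where "e = min (min b1 b2) (min \<bar>1/2 - b1\<bar> \<bar>1/2 - b2\<bar>)"
  have e: "0 < e" "e \<le> b1" "e \<le> b2" "e \<le> \<bar>1/2 - b1\<bar>" "e \<le> \<bar>1/2 - b2\<bar>"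
    using b12 by (auto simp: e_def)
  define C where "C = 6 / (1 - 2 powr (- e))"
  have C: "0 < C" using e by (auto simp: C_def powr_less_one)
  have shift: "(\<integral>\<^sup>+b. ennreal (2 powr g b) \<partial>count_space UNIV) \<le> ennreal (C * 2 powr k)"
    if "(\<integral>\<^sup>+b. ennreal (2 powr (g b - k)) \<partial>count_space UNIV) \<le> ennreal C" for g :: "nat \<Rightarrow> real" and k
  proof -
    have "(\<integral>\<^sup>+b. ennreal (2 powr g b) \<partial>count_space UNIV) =
        (\<integral>\<^sup>+b. ennreal (2 powr k) * ennreal (2 powr (g b - k)) \<partial>count_space UNIV)"
      by (simp add: ennreal_mult[symmetric] powr_add[symmetric])
    also have "\<dots> = ennreal (2 powr k) * (\<integral>\<^sup>+b. ennreal (2 powr (g b - k)) \<partial>count_space UNIV)"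
      by (simp add: nn_integral_cmult)
    also have "\<dots> \<le> ennreal (2 powr k) * ennreal C" by (intro mult_left_mono that) auto
    also have "\<dots> = ennreal (C * 2 powr k)" using C by (simp add: ennreal_mult[symmetric] mult.commute)
    finally show ?thesis .
  qed
  have 1: "(\<integral>\<^sup>+b. ennreal (2 powr mweight b1 b2 m a b) \<partial>count_space UNIV) \<le> ennreal (C * 2 powr kappa b1 b2 m)" for m a
    unfolding mweight_def
    by (rule shift, unfold C_def,
        rule sum_two_powr_peaks_le[OF e(1), of _ "real a" "max m 0" 0],
        rule modulation_exponent) (use b12 e in auto)
  have 2: "(\<integral>\<^sup>+a. ennreal (2 powr mweight b1 b2 m a b) \<partial>count_space UNIV) \<le> ennreal (C * 2 powr kappa b1 b2 m)" for m b
  proof -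
    \<comment> \<open>Column sums are row sums with the two waves exchanged.\<close>
    have "mweight b1 b2 m a b - kappa b1 b2 m = mweight b2 b1 m b a - kappa b2 b1 m" for a
      by (simp add: mweight_def kappa_def theta_commute min.commute max.commute)
    moreover have "(\<integral>\<^sup>+a. ennreal (2 powr (mweight b2 b1 m b a - kappa b2 b1 m)) \<partial>count_space UNIV) \<le> ennreal C"
      unfolding mweight_def C_def
      by (rule sum_two_powr_peaks_le[OF e(1), of _ "real b" "max m 0" 0],
        rule modulation_exponent) (use b12 e in auto)
    ultimately show ?thesis by (intro shift) simp
  qed
  show thesis using that[OF C 1 2] .
qed

text \<open>Conditions (c) to (f) merge into \<open>1 + theta b1 b2 \<le> S\<close>, as
  \<open>theta b1 b2\<close> is the largest of \<open>0\<close>, \<open>1/2 - b1\<close>,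
  \<open>1/2 - b2\<close> and \<open>1 - (b1 + b2)\<close>. Exponents equal to \<open>1/2\<close>
  are kept out because the sum over modulations would then lose its geometric decay.\<close>

definition admissible :: "real \<Rightarrow> real \<Rightarrow> real \<Rightarrow> real \<Rightarrow> real \<Rightarrow> bool" where
  "admissible s0 s1 s2 b1 b2 \<longleftrightarrow>
     0 < b1 \<and> 0 < b2 \<and> b1 \<noteq> 1/2 \<and> b2 \<noteq> 1/2 \<and> 1/2 \<le> b1 + b2 \<and>
     1 + theta b1 b2 \<le> s0 + s1 + s2 \<and> 3/2 \<le> s0 + 2 * (s1 + s2) \<and>
     0 \<le> s1 + s2 \<and> 0 \<le> s0 + s2 \<and> 0 \<le> s0 + s1 \<and>
     (s0 \<in> {3/2, 1/2 + 2 * theta b1 b2} \<longrightarrow> 3/2 < s0 + 2 * (s1 + s2)) \<and>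
     (s0 + s1 + s2 = 1 + theta b1 b2 \<longrightarrow> 0 < s1 + s2 \<and> 0 < s0 + s2 \<and> 0 < s0 + s1)"

lemma admissible_commute: "admissible s0 s1 s2 b1 b2 \<Longrightarrow> admissible s0 s2 s1 b2 b1"
  unfolding admissible_def by (auto simp: theta_commute add_ac)

text \<open>With \<open>p \<le> q\<close> and \<open>0 \<le> q\<close> the exponent peaks at
  \<open>i = j\<close> if \<open>q > 0\<close>. If \<open>q = 0\<close>, the last clause of
  \<open>admissible\<close> rules out \<open>p = q\<close>, so \<open>p < 0\<close> and the peak is
  at 0.\<close>

lemma low_high_sum:
  assumes "admissible s0 s1 s2 b1 b2"
  obtains C where "0 < C"
    "\<And>j. (\<integral>\<^sup>+i. (if i \<le> j then ennreal (2 powr ((1 + theta b1 b2 - s1) * real i - (s0 + s2) * real j)) else 0) \<partial>count_space UNIV) \<le> ennreal C"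
proof -
  define p where "p = 1 + theta b1 b2 - s1"
  define q where "q = s0 + s2"
  have pq: "p \<le> q" "0 \<le> q" "q = 0 \<longrightarrow> p < 0" using assms by (auto simp: admissible_def p_def q_def)
  obtain e c where e: "0 < (e::real)" and le: "\<And>i j. i \<le> j \<Longrightarrow> p * real i - q * real j \<le> - e * \<bar>real i - c (real j)\<bar>"
  proof (cases "q = 0")
    case True
    show thesis by (rule that[of "-p" "\<lambda>_. 0"]) (use pq True in auto)
  next
    case False
    show thesis
    proof (rule that[of q "\<lambda>x. x"])
      fix i j :: nat assume ij: "i \<le> j"
      have "p * real i \<le> q * real i" using pq by (intro mult_right_mono) auto
      then show "p * real i - q * real j \<le> - q * \<bar>real i - real j\<bar>" using ij by (simp add: algebra_simps)
    qed (use False pq in auto)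
  qed
  show thesis
  proof (rule that)
    show "0 < 2 / (1 - 2 powr (- e))" using e by (auto simp: powr_less_one)
    fix j :: nat
    have "(\<integral>\<^sup>+i. (if i \<le> j then ennreal (2 powr (p * real i - q * real j)) else 0) \<partial>count_space UNIV) \<le>
       (\<integral>\<^sup>+i. ennreal (2 powr (- e * \<bar>real i - c (real j)\<bar>)) \<partial>count_space UNIV)"
      using le by (intro nn_integral_mono) (auto intro!: ennreal_leI powr_mono)
    also have "\<dots> \<le> ennreal (2 / (1 - 2 powr (- e)))" by (rule geometric_peak_sum[OF e])
    finally show "(\<integral>\<^sup>+i. (if i \<le> j then ennreal (2 powr ((1 + theta b1 b2 - s1) * real i - (s0 + s2) * real j)) else 0) \<partial>count_space UNIV) \<le> ennreal (2 / (1 - 2 powr (- e)))"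
      unfolding p_def q_def .
  qed
qed

text \<open>Binary logarithm of the dyadic factor for output frequency \<open>N0 = 2^x\<close> and
  input frequencies \<open>N1 = 2^y\<close>; \<open>2 * x - y\<close> is the logarithm of the
  threshold \<open>N0^2 / N1\<close>.\<close>

definition hhexp :: "real \<Rightarrow> real \<Rightarrow> real \<Rightarrow> real \<Rightarrow> real \<Rightarrow> real \<Rightarrow> real \<Rightarrow> real" where
  "hhexp s0 s1 s2 b1 b2 x y = (x + y) / 2 + kappa b1 b2 (2 * x - y) - s0 * x - (s1 + s2) * y"

text \<open>The exponent is piecewise linear in \<open>x\<close> with vertices at \<open>0\<close>, \<open>y / 2\<close> and \<open>y\<close>, where it is nonpositive by the
  conditions on \<open>s1 + s2\<close>, on \<open>s0 + 2 (s1 + s2)\<close> and on \<open>s0 + s1 + s2\<close>, respectively. The exceptional values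
  of \<open>s0\<close> are those for which one of the two slopes vanishes.\<close>

lemma hhexp_bound:
  assumes ad: "admissible s0 s1 s2 b1 b2"
  obtains e :: real where "0 < e"
    "\<And>x y. 0 \<le> x \<Longrightarrow> x \<le> y \<Longrightarrow> hhexp s0 s1 s2 b1 b2 x y \<le> - e * \<bar>x - 0\<bar> \<or>
      hhexp s0 s1 s2 b1 b2 x y \<le> - e * \<bar>x - y / 2\<bar> \<or> hhexp s0 s1 s2 b1 b2 x y \<le> - e * \<bar>x - y\<bar>"
proof -
  define t where "t = theta b1 b2"
  define u where "u = s1 + s2"
  \<comment> \<open>At the kink \<open>x = y / 2\<close> the exponent equals
    \<open>- G * y / 2\<close>.\<close>
  define G where "G = s0 + 2 * u - 3/2"
  have F: "1 + t \<le> s0 + u" "0 \<le> G" "0 \<le> u" "s0 = 3/2 \<Longrightarrow> 0 < G" "s0 = 1/2 + 2 * t \<Longrightarrow> 0 < G"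
    using ad by (auto simp: admissible_def t_def u_def G_def)
  \<comment> \<open>\<open>a1\<close> and \<open>a2\<close> are the slopes in \<open>x\<close> to
    the left and to the right of \<open>y / 2\<close>.\<close>
  define a1 where "a1 = 3/2 - s0"
  define a2 where "a2 = 1/2 - s0 + 2 * t"
  \<comment> \<open>Where a slope vanishes, the decay in \<open>x\<close> is taken from the strictly
    negative multiple of \<open>y\<close>, using \<open>x \<le> y\<close>.\<close>
  define e where "e = min (if a1 = 0 then u else \<bar>a1\<bar>) (if a2 = 0 then G / 2 else \<bar>a2\<bar>)"
  have "a1 = 0 \<Longrightarrow> 0 < u" using F by (auto simp: a1_def G_def)
  moreover have "a2 = 0 \<Longrightarrow> 0 < G" using F(5) by (auto simp: a2_def)
  ultimately have e: "0 < e" by (auto simp: e_def)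
  have e1: "a1 = 0 \<Longrightarrow> e \<le> u" "a1 \<noteq> 0 \<Longrightarrow> e \<le> \<bar>a1\<bar>" by (auto simp: e_def)
  have e2: "a2 = 0 \<Longrightarrow> e \<le> G / 2" "a2 \<noteq> 0 \<Longrightarrow> e \<le> \<bar>a2\<bar>" by (auto simp: e_def)
  show thesis
  proof (rule that[OF e])
    fix x y :: real assume xy: "0 \<le> x" "x \<le> y"
    let ?E = "hhexp s0 s1 s2 b1 b2 x y"
    have Gy: "0 \<le> G * y" using F xy by simp
    show "?E \<le> - e * \<bar>x - 0\<bar> \<or> ?E \<le> - e * \<bar>x - y / 2\<bar> \<or> ?E \<le> - e * \<bar>x - y\<bar>"
    proof (cases "2 * x - y < 0")
      case True
      then have E: "?E = a1 * x - u * y"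
        by (simp add: hhexp_def kappa_def a1_def u_def field_simps)
      have uy: "0 \<le> u * y" using F xy by simp
      consider "a1 = 0" | "a1 < 0" | "0 < a1" by linarith
      then show ?thesis
      proof cases
        case 1
        have "e * x \<le> u * y" using e1(1)[OF 1] xy e by (intro mult_mono) auto
        then show ?thesis using E 1 xy by simp
      next
        case 2
        have "e * x \<le> (- a1) * x" using e1(2) 2 xy by (intro mult_right_mono) auto
        then show ?thesis using E uy xy by simp
      next
        case 3
        have "e * (y / 2 - x) \<le> a1 * (y / 2 - x)" using e1(2) 3 True by (intro mult_right_mono) auto
        moreover have "?E = - (a1 * (y / 2 - x)) - G * y / 2"
          unfolding E by (simp add: a1_def G_def field_simps)
        ultimately have "?E \<le> - (e * (y / 2 - x))" using Gy by simp
        then show ?thesis using True by (simp add: abs_if)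
      qed
    next
      case False
      then have E: "?E = a2 * x - (u - 1/2 + t) * y"
        by (simp add: hhexp_def kappa_def a2_def u_def t_def field_simps)
      consider "a2 = 0" | "a2 < 0" | "0 < a2" by linarith
      then show ?thesis
      proof cases
        case 1
        then have "s0 = 1/2 + 2 * t" by (simp add: a2_def)
        then have "?E = - (G / 2 * y)" unfolding E by (simp add: a2_def G_def field_simps)
        moreover have "e * x \<le> G / 2 * y" using e2(1)[OF 1] xy e by (intro mult_mono) auto
        ultimately show ?thesis using xy by simp
      next
        case 2
        have "e * (x - y / 2) \<le> (- a2) * (x - y / 2)" using e2(2) 2 False by (intro mult_right_mono) auto
        moreover have "?E = - ((- a2) * (x - y / 2)) - G * y / 2"
          unfolding E by (simp add: a2_def G_def field_simps)
        ultimately have "?E \<le> - (e * (x - y / 2))" using Gy by simp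
        then show ?thesis using False by (simp add: abs_if)
      next
        case 3
        have "e * (y - x) \<le> a2 * (y - x)" using e2(2) 3 xy by (intro mult_right_mono) auto
        moreover have "?E = - (a2 * (y - x)) - (s0 + u - 1 - t) * y"
          unfolding E by (simp add: a2_def field_simps)
        moreover have "0 \<le> (s0 + u - 1 - t) * y" using F xy by simp
        ultimately have "?E \<le> - (e * (y - x))" by simp
        moreover have "\<bar>x - y\<bar> = y - x" using xy by simp
        ultimately show ?thesis by simp
      qed
    qed
  qed
qed

lemma high_high_sum:
  assumes "admissible s0 s1 s2 b1 b2"
  obtains C where "0 < C"
    "\<And>j. (\<integral>\<^sup>+i. (if i \<le> j then ennreal (2 powr hhexp s0 s1 s2 b1 b2 (real i) (real j)) else 0) \<partial>count_space UNIV) \<le> ennreal C"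
proof -
  obtain e where e: "0 < e" and le: "\<And>x y. 0 \<le> x \<Longrightarrow> x \<le> y \<Longrightarrow> hhexp s0 s1 s2 b1 b2 x y \<le> - e * \<bar>x - 0\<bar> \<or>
      hhexp s0 s1 s2 b1 b2 x y \<le> - e * \<bar>x - y / 2\<bar> \<or> hhexp s0 s1 s2 b1 b2 x y \<le> - e * \<bar>x - y\<bar>"
    using hhexp_bound[OF assms] by metis
  show thesis
  proof (rule that)
    show "0 < 6 / (1 - 2 powr (- e))" using e by (auto simp: powr_less_one)
    fix j :: nat
    \<comment> \<open>Beyond the range of summation the exponent is continued by a peak at 0, so
      that \<open>sum_two_powr_peaks_le\<close> applies.\<close>
    let ?f = "\<lambda>i. if i \<le> j then hhexp s0 s1 s2 b1 b2 (real i) (real j) else - e * \<bar>real i - 0\<bar>"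
    have "(\<integral>\<^sup>+i. (if i \<le> j then ennreal (2 powr hhexp s0 s1 s2 b1 b2 (real i) (real j)) else 0) \<partial>count_space UNIV) \<le>
       (\<integral>\<^sup>+i. ennreal (2 powr ?f i) \<partial>count_space UNIV)"
      by (intro nn_integral_mono) auto
    also have "\<dots> \<le> ennreal (6 / (1 - 2 powr (- e)))"
    proof (rule sum_two_powr_peaks_le[OF e])
      fix i
      show "?f i \<le> - e * \<bar>real i - 0\<bar> \<or> ?f i \<le> - e * \<bar>real i - real j / 2\<bar> \<or> ?f i \<le> - e * \<bar>real i - real j\<bar>"
        using le[of "real i" "real j"] by auto
    qed
    finally show "(\<integral>\<^sup>+i. (if i \<le> j then ennreal (2 powr hhexp s0 s1 s2 b1 b2 (real i) (real j)) else 0) \<partial>count_space UNIV) \<le> ennreal (6 / (1 - 2 powr (- e)))" .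
  qed
qed

section \<open>Dyadic decomposition\<close>

lemma jbr_eq_sqrt: "jbr r = sqrt (1 + r\<^sup>2)"
  unfolding jbr_def by (subst powr_half_sqrt) (auto intro: add_nonneg_nonneg)

lemma jbr_ge: "1 \<le> jbr r" "\<bar>r\<bar> \<le> jbr r"
  unfolding jbr_eq_sqrt by (auto intro: real_le_rsqrt)

text \<open>\<open>jbr r\<close> is the Euclidean norm of the vector \<open>(1, r)\<close>, so this
  is a triangle inequality in the plane.\<close>

lemma jbr_norm_triangle: "jbr (norm (x + y)) \<le> jbr (norm x) + jbr (norm y)"
proof -
  have "jbr (norm (x + y)) = norm (1 :: real, norm (x + y))" by (simp add: jbr_eq_sqrt norm_Pair)
  also have "\<dots> \<le> norm ((1 :: real, norm x) + (1 :: real, norm y))"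
    using norm_triangle_ineq[of x y] by (simp add: norm_Pair power_mono add_mono)
  also have "\<dots> \<le> jbr (norm x) + jbr (norm y)"
    by (rule order_trans[OF norm_triangle_ineq]) (simp add: jbr_eq_sqrt norm_Pair)
  finally show ?thesis .
qed

definition dyad :: "real \<Rightarrow> nat" where
  "dyad x = nat \<lfloor>log 2 x\<rfloor>"

lemma dyad_bounds:
  assumes "1 \<le> x"
  shows "2 ^ dyad x \<le> x" "x < 2 * 2 ^ dyad x"
proof -
  have l: "0 \<le> log 2 x" using assms by (simp add: zero_le_log_cancel_iff)
  then have "real (dyad x) \<le> log 2 x" "log 2 x < real (dyad x) + 1" unfolding dyad_def by linarith+
  then have "2 powr real (dyad x) \<le> x" "x < 2 powr (real (dyad x) + 1)"
    using assms by (auto simp: le_log_iff log_less_iff)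
  then show "2 ^ dyad x \<le> x" "x < 2 * 2 ^ dyad x" by (auto simp: powr_add powr_realpow)
qed

lemma dyad_triangle:
  assumes "x \<le> y + z" "1 \<le> x" "1 \<le> y" "1 \<le> z"
  shows "dyad x \<le> max (dyad y) (dyad z) + 1"
proof -
  let ?M = "max (dyad y) (dyad z)"
  have "(2::real) ^ dyad y \<le> 2 ^ ?M" "(2::real) ^ dyad z \<le> 2 ^ ?M" by (auto intro: power_increasing)
  \<comment> \<open>Each of \<open>y\<close> and \<open>z\<close> is below
    \<open>2 * 2 ^ ?M\<close>; the resulting factor 4 accounts for the loss of one in the
    conclusion.\<close>
  then have "2 ^ dyad x < 4 * (2::real) ^ ?M"
    using dyad_bounds(1)[OF assms(2)] dyad_bounds(2)[OF assms(3)] dyad_bounds(2)[OF assms(4)] assms(1) by linarith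
  also have "4 * (2::real) ^ ?M = 2 ^ (?M + 2)" by (simp only: power_add) simp
  finally have "dyad x < ?M + 2" by (rule power_less_imp_less_exp[rotated]) simp
  then show ?thesis by simp
qed

definition freq :: "spacetime \<Rightarrow> nat" where
  "freq q = dyad (jbr (norm (snd q)))"

definition modul :: "spacetime \<Rightarrow> nat" where
  "modul q = dyad (jbr (\<bar>fst q\<bar> - norm (snd q)))"

lemma freq_modul_measurable [measurable]:
  "freq \<in> borel \<rightarrow>\<^sub>M count_space UNIV" "modul \<in> borel \<rightarrow>\<^sub>M count_space UNIV"
  unfolding freq_def modul_def dyad_def jbr_def by measurable

lemma freq_triangle:
  "freq p \<le> max (freq q) (freq (p - q)) + 1"
  "freq q \<le> max (freq p) (freq (p - q)) + 1"
  "freq (p - q) \<le> max (freq p) (freq q) + 1"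
proof -
  have "jbr (norm (snd p)) \<le> jbr (norm (snd q)) + jbr (norm (snd (p - q)))"
    using jbr_norm_triangle[of "snd q" "snd p - snd q"] by simp
  then show "freq p \<le> max (freq q) (freq (p - q)) + 1"
    unfolding freq_def by (intro dyad_triangle jbr_ge)
  have "jbr (norm (snd q)) \<le> jbr (norm (snd p)) + jbr (norm (snd (p - q)))"
    using jbr_norm_triangle[of "snd p" "snd q - snd p"] by (simp add: norm_minus_commute)
  then show "freq q \<le> max (freq p) (freq (p - q)) + 1"
    unfolding freq_def by (intro dyad_triangle jbr_ge)
  have "jbr (norm (snd (p - q))) \<le> jbr (norm (snd p)) + jbr (norm (snd q))"
    using jbr_norm_triangle[of "snd p" "- snd q"] by simp
  then show "freq (p - q) \<le> max (freq p) (freq q) + 1"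
    unfolding freq_def by (intro dyad_triangle jbr_ge)
qed

text \<open>The lowest dyadic region \<open>freq q = 0\<close> contains the spatial origin, so a
  lower bound holds only for the other regions.\<close>

lemma freq_bounds:
  "norm (snd q) \<le> 2 * 2 ^ freq q"
  "1 \<le> freq q \<Longrightarrow> 2 ^ freq q / 2 \<le> norm (snd q)"
proof -
  have b: "2 ^ freq q \<le> jbr (norm (snd q))" "jbr (norm (snd q)) < 2 * 2 ^ freq q"
    unfolding freq_def by (intro dyad_bounds jbr_ge)+
  show "norm (snd q) \<le> 2 * 2 ^ freq q" using b(2) jbr_ge(2)[of "norm (snd q)"] by simp
  assume n: "1 \<le> freq q"
  have j: "(jbr (norm (snd q)))\<^sup>2 = 1 + (norm (snd q))\<^sup>2" unfolding jbr_eq_sqrt by (simp add: add_nonneg_nonneg)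
  have "(2::real) ^ 1 \<le> 2 ^ freq q" using n by (intro power_increasing) auto
  then have 4: "4 \<le> ((2::real) ^ freq q)\<^sup>2" using power_mono[of 2 "(2::real) ^ freq q" 2] by simp
  have "(2 ^ freq q)\<^sup>2 \<le> (jbr (norm (snd q)))\<^sup>2" using b(1) by (intro power_mono) auto
  then have "(2 ^ freq q / 2)\<^sup>2 \<le> (norm (snd q))\<^sup>2" using 4 j by (simp add: power_divide)
  then show "2 ^ freq q / 2 \<le> norm (snd q)" by (rule power2_le_imp_le) simp
qed

lemma modul_bound: "cdist q \<le> 2 * 2 ^ modul q"
  using dyad_bounds(2)[OF jbr_ge(1)[of "\<bar>fst q\<bar> - norm (snd q)"]] jbr_ge(2)[of "\<bar>fst q\<bar> - norm (snd q)"]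
  unfolding modul_def cdist_def by simp

section \<open>Dyadic pieces\<close>

definition piece :: "('a \<Rightarrow> nat) \<Rightarrow> nat \<Rightarrow> ('a \<Rightarrow> ennreal) \<Rightarrow> 'a \<Rightarrow> ennreal" where
  "piece d n f q = (if d q = n then f q else 0)"

lemma piece_measurable [measurable]:
  assumes [measurable]: "f \<in> borel_measurable M" "d \<in> M \<rightarrow>\<^sub>M count_space UNIV"
  shows "piece d n f \<in> borel_measurable M"
  unfolding piece_def by measurable

lemma nn_integral_single: "(\<integral>\<^sup>+n. (if m = n then c else 0) \<partial>count_space UNIV) = c"
proof -
  have "(\<integral>\<^sup>+n. (if m = n then c else 0) \<partial>count_space UNIV) = (\<integral>\<^sup>+n. c * indicator {m} n \<partial>count_space UNIV)"
    by (intro nn_integral_cong) (auto simp: indicator_def)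
  also have "\<dots> = c" by (simp add: nn_integral_cmult_indicator emeasure_count_space)
  finally show ?thesis .
qed

lemma nn_integral_piece: "(\<integral>\<^sup>+n. piece d n f q \<partial>count_space UNIV) = f q"
  unfolding piece_def by (rule nn_integral_single)

lemma nn_integral_l2sq_piece:
  assumes [measurable]: "f \<in> borel_measurable borel" "d \<in> borel \<rightarrow>\<^sub>M count_space UNIV"
  shows "(\<integral>\<^sup>+n. l2sq (piece d n f) \<partial>count_space UNIV) = l2sq f"
proof -
  have "(\<integral>\<^sup>+n. l2sq (piece d n f) \<partial>count_space UNIV) = (\<integral>\<^sup>+q. \<integral>\<^sup>+n. (piece d n f q)\<^sup>2 \<partial>count_space UNIV \<partial>lborel)"
    unfolding l2sq_def by (subst nn_integral_count_space_nn_integral) auto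
  also have "\<dots> = (\<integral>\<^sup>+q. (f q)\<^sup>2 \<partial>lborel)"
  proof (rule nn_integral_cong)
    fix q
    have "(piece d n f q)\<^sup>2 = piece d n (\<lambda>q. (f q)\<^sup>2) q" for n by (simp add: piece_def)
    then show "(\<integral>\<^sup>+n. (piece d n f q)\<^sup>2 \<partial>count_space UNIV) = (f q)\<^sup>2" by (simp add: nn_integral_piece)
  qed
  finally show ?thesis by (simp add: l2sq_def)
qed

lemma tri_piece_left:
  assumes [measurable]: "F \<in> borel_measurable borel" "G \<in> borel_measurable borel" "H \<in> borel_measurable borel"
    "d \<in> borel \<rightarrow>\<^sub>M count_space UNIV"
  shows "tri F G H = (\<integral>\<^sup>+n. tri (piece d n F) G H \<partial>count_space UNIV)"
proof -
  have "(\<integral>\<^sup>+n. tri (piece d n F) G H \<partial>count_space UNIV) =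
      (\<integral>\<^sup>+p. \<integral>\<^sup>+n. \<integral>\<^sup>+q. H p * (piece d n F q * G (p - q)) \<partial>lborel \<partial>count_space UNIV \<partial>lborel)"
    unfolding tri_def by (subst nn_integral_count_space_nn_integral) auto
  also have "\<dots> = (\<integral>\<^sup>+p. \<integral>\<^sup>+q. \<integral>\<^sup>+n. H p * (piece d n F q * G (p - q)) \<partial>count_space UNIV \<partial>lborel \<partial>lborel)"
    by (subst nn_integral_count_space_nn_integral) auto
  also have "\<dots> = tri F G H"
    unfolding tri_def by (simp add: nn_integral_cmult nn_integral_multc nn_integral_piece)
  finally show ?thesis ..
qed

lemma tri_piece_right:
  assumes [measurable]: "F \<in> borel_measurable borel" "G \<in> borel_measurable borel" "H \<in> borel_measurable borel"
    "d \<in> borel \<rightarrow>\<^sub>M count_space UNIV"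
  shows "tri F G H = (\<integral>\<^sup>+n. tri F (piece d n G) H \<partial>count_space UNIV)"
proof -
  have "tri F G H = (\<integral>\<^sup>+n. tri (piece d n G) F H \<partial>count_space UNIV)"
    by (subst tri_commute) (simp_all add: tri_piece_left)
  also have "\<dots> = (\<integral>\<^sup>+n. tri F (piece d n G) H \<partial>count_space UNIV)"
    by (intro nn_integral_cong tri_commute) auto
  finally show ?thesis .
qed

lemma tri_piece_out:
  assumes [measurable]: "F \<in> borel_measurable borel" "G \<in> borel_measurable borel" "H \<in> borel_measurable borel"
    "d \<in> borel \<rightarrow>\<^sub>M count_space UNIV"
  shows "tri F G H = (\<integral>\<^sup>+n. tri F G (piece d n H) \<partial>count_space UNIV)"
proof -
  have "(\<integral>\<^sup>+n. tri F G (piece d n H) \<partial>count_space UNIV) =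
      (\<integral>\<^sup>+p. \<integral>\<^sup>+n. piece d n H p * conv F G p \<partial>count_space UNIV \<partial>lborel)"
    by (simp add: tri_eq_conv) (subst nn_integral_count_space_nn_integral, auto)
  also have "\<dots> = tri F G H"
    by (simp add: tri_eq_conv nn_integral_multc nn_integral_piece)
  finally show ?thesis ..
qed

lemma tri_nonzeroE:
  assumes "tri F G H \<noteq> 0"
  obtains p q where "H p \<noteq> 0" "F q \<noteq> 0" "G (p - q) \<noteq> 0"
proof (rule ccontr)
  assume "\<not> thesis"
  then have z: "H p * (F q * G (p - q)) = 0" for p q using that by auto
  have "tri F G H = 0" unfolding tri_def z by simp
  with assms show False by simp
qed

text \<open>The inverse of the weight in \<open>hsb_norm\<close>: applied to a weighted Fourier
  transform it restores the transform itself, while the weighted norms of the theorem become plain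
  ones.\<close>

definition wt :: "real \<Rightarrow> real \<Rightarrow> (spacetime \<Rightarrow> ennreal) \<Rightarrow> spacetime \<Rightarrow> ennreal" where
  "wt s b f q = ennreal (jbr (norm (snd q)) powr (- s) * jbr (\<bar>fst q\<bar> - norm (snd q)) powr (- b)) * f q"

lemma wt_measurable [measurable]:
  assumes [measurable]: "f \<in> borel_measurable borel"
  shows "wt s b f \<in> borel_measurable borel"
  unfolding wt_def jbr_def by measurable

text \<open>\<open>x\<close> may exceed \<open>2 ^ dyad x\<close> by a factor of almost 2. For
  negative \<open>s\<close> this costs \<open>2 powr \<bar>s\<bar>\<close>, a factor that is allowed
  for either sign.\<close>

lemma powr_dyad_le:
  assumes "1 \<le> x"
  shows "x powr (- s) \<le> 2 powr (\<bar>s\<bar> - s * real (dyad x))"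
proof (cases "0 \<le> s")
  case True
  have "x powr (- s) \<le> (2 ^ dyad x) powr (- s)"
    using dyad_bounds[OF assms] assms True by (intro powr_mono2') auto
  also have "\<dots> = 2 powr (- s * real (dyad x))" by (simp add: powr_realpow[symmetric] powr_powr mult.commute)
  also have "\<dots> \<le> 2 powr (\<bar>s\<bar> - s * real (dyad x))" by (intro powr_mono) auto
  finally show ?thesis .
next
  case False
  have "x powr (- s) \<le> (2 * 2 ^ dyad x) powr (- s)"
    using dyad_bounds[OF assms] assms False by (intro powr_mono2) auto
  also have "2 * 2 ^ dyad x = (2::real) powr (real (dyad x) + 1)" by (simp add: powr_add powr_realpow)
  also have "\<dots> powr (- s) = 2 powr ((real (dyad x) + 1) * (- s))" by (simp add: powr_powr)
  also have "\<dots> = 2 powr (\<bar>s\<bar> - s * real (dyad x))" using False by (simp add: algebra_simps)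
  finally show ?thesis .
qed

lemma wt_le: "wt s b f q \<le> ennreal (2 powr (\<bar>s\<bar> + \<bar>b\<bar> - s * real (freq q) - b * real (modul q))) * f q"
proof -
  have "jbr (norm (snd q)) powr (- s) * jbr (\<bar>fst q\<bar> - norm (snd q)) powr (- b) \<le>
      2 powr (\<bar>s\<bar> - s * real (freq q)) * 2 powr (\<bar>b\<bar> - b * real (modul q))"
    unfolding freq_def modul_def by (intro mult_mono powr_dyad_le jbr_ge) auto
  also have "\<dots> = 2 powr (\<bar>s\<bar> + \<bar>b\<bar> - s * real (freq q) - b * real (modul q))"
    by (simp add: powr_add[symmetric] algebra_simps)
  finally show ?thesis unfolding wt_def by (intro mult_right_mono ennreal_leI) auto
qed

lemma l2sq_wt_le:
  assumes [measurable]: "f \<in> borel_measurable borel"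
    and "\<And>q. f q \<noteq> 0 \<Longrightarrow> \<bar>s\<bar> + \<bar>b\<bar> - s * real (freq q) - b * real (modul q) \<le> x"
  shows "l2sq (wt s b f) \<le> (ennreal (2 powr x))\<^sup>2 * l2sq f"
proof -
  have "l2sq (wt s b f) \<le> l2sq (\<lambda>q. ennreal (2 powr x) * f q)"
  proof (rule l2sq_mono)
    fix q
    show "wt s b f q \<le> ennreal (2 powr x) * f q"
    proof (cases "f q = 0")
      case False
      then show ?thesis
        using assms(2)[of q] by (intro order_trans[OF wt_le] mult_right_mono ennreal_leI powr_mono) auto
    qed (simp add: wt_def)
  qed
  also have "\<dots> = (ennreal (2 powr x))\<^sup>2 * l2sq f"
    by (simp add: l2sq_def power_mult_distrib nn_integral_cmult)
  finally show ?thesis .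
qed

lemma piece_wt: "piece d n (wt s b f) = wt s b (piece d n f)"
  by (auto simp: piece_def wt_def fun_eq_iff)

text \<open>\<open>L\<^sub>m\<^sub>i\<^sub>n min(L\<^sub>m\<^sub>a\<^sub>x, 2\<^sup>m)\<close> is the common shape of the dyadic estimates, \<open>2\<^sup>m\<close> being the modulation above
  which the trivial estimate wins.\<close>

definition block_bound :: "nat \<Rightarrow> nat \<Rightarrow> nat \<Rightarrow> real \<Rightarrow> real \<Rightarrow> bool" where
  "block_bound n1 n2 n0 m k \<longleftrightarrow> (\<forall>l1 l2 F G H. F \<in> borel_measurable borel \<longrightarrow> G \<in> borel_measurable borel \<longrightarrow> H \<in> borel_measurable borel \<longrightarrow>
     (\<forall>q. F q \<noteq> 0 \<longrightarrow> freq q = n1 \<and> modul q = l1) \<longrightarrow> (\<forall>q. G q \<noteq> 0 \<longrightarrow> freq q = n2 \<and> modul q = l2) \<longrightarrow>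
     (\<forall>q. H q \<noteq> 0 \<longrightarrow> freq q = n0) \<longrightarrow>
     (tri F G H)\<^sup>2 \<le> (ennreal (k * 2 powr ((min (real l1) (real l2) + min (max (real l1) (real l2)) m) / 2)))\<^sup>2 * (l2sq F * l2sq G * l2sq H))"

lemma block_boundD:
  assumes bb: "block_bound n1 n2 n0 m k"
    and M: "F \<in> borel_measurable borel" "G \<in> borel_measurable borel" "H \<in> borel_measurable borel"
    and F: "\<And>q. F q \<noteq> 0 \<Longrightarrow> freq q = n1 \<and> modul q = l1" and G: "\<And>q. G q \<noteq> 0 \<Longrightarrow> freq q = n2 \<and> modul q = l2"
    and H: "\<And>q. H q \<noteq> 0 \<Longrightarrow> freq q = n0"
  shows "(tri F G H)\<^sup>2 \<le> (ennreal (k * 2 powr ((min (real l1) (real l2) + min (max (real l1) (real l2)) m) / 2)))\<^sup>2 * (l2sq F * l2sq G * l2sq H)"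
proof -
  have FF: "\<forall>q. F q \<noteq> 0 \<longrightarrow> freq q = n1 \<and> modul q = l1" using F by simp
  have GG: "\<forall>q. G q \<noteq> 0 \<longrightarrow> freq q = n2 \<and> modul q = l2" using G by simp
  have HH: "\<forall>q. H q \<noteq> 0 \<longrightarrow> freq q = n0" using H by simp
  show ?thesis
    by (rule bb[unfolded block_bound_def, THEN spec, THEN spec, THEN spec, THEN spec, THEN spec,
          THEN mp, THEN mp, THEN mp, THEN mp, THEN mp, THEN mp, OF M FF GG HH])
qed

text \<open>The first estimate is used if the larger modulation is at most \<open>2 powr m\<close>,
  the second otherwise; together they give the minimum in \<open>block_bound\<close>.\<close>

lemma block_boundI:
  assumes k: "0 \<le> k"
    and A: "\<And>l1 l2 F G H. F \<in> borel_measurable borel \<Longrightarrow> G \<in> borel_measurable borel \<Longrightarrow> H \<in> borel_measurable borel \<Longrightarrow>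
      (\<And>q. F q \<noteq> 0 \<Longrightarrow> freq q = n1 \<and> modul q = l1) \<Longrightarrow> (\<And>q. G q \<noteq> 0 \<Longrightarrow> freq q = n2 \<and> modul q = l2) \<Longrightarrow>
      (\<And>q. H q \<noteq> 0 \<Longrightarrow> freq q = n0) \<Longrightarrow>
      (tri F G H)\<^sup>2 \<le> ennreal (k\<^sup>2 * (2 ^ l1 * 2 ^ l2)) * (l2sq F * l2sq G * l2sq H) \<and>
      (tri F G H)\<^sup>2 \<le> ennreal (k\<^sup>2 * (min (2 ^ l1) (2 ^ l2) * 2 powr m)) * (l2sq F * l2sq G * l2sq H)"
  shows "block_bound n1 n2 n0 m k"
  unfolding block_bound_def
proof (intro allI impI)
  fix l1 l2 and F G H :: "spacetime \<Rightarrow> ennreal"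
  assume m: "F \<in> borel_measurable borel" "G \<in> borel_measurable borel" "H \<in> borel_measurable borel"
    and s: "\<forall>q. F q \<noteq> 0 \<longrightarrow> freq q = n1 \<and> modul q = l1" "\<forall>q. G q \<noteq> 0 \<longrightarrow> freq q = n2 \<and> modul q = l2" "\<forall>q. H q \<noteq> 0 \<longrightarrow> freq q = n0"
  let ?x = "(min (real l1) (real l2) + min (max (real l1) (real l2)) m) / 2"
  have sq: "(ennreal (k * 2 powr ?x))\<^sup>2 = ennreal (k\<^sup>2 * 2 powr (min (real l1) (real l2) + min (max (real l1) (real l2)) m))"
  proof -
    have "(2 powr ?x)\<^sup>2 = 2 powr (?x + ?x)" unfolding power2_eq_square powr_add ..
    then show ?thesis using k by (simp add: ennreal_power power_mult_distrib)
  qed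
  have "k\<^sup>2 * (2 ^ l1 * 2 ^ l2) = k\<^sup>2 * 2 powr (min (real l1) (real l2) + min (max (real l1) (real l2)) m)" if "max (real l1) (real l2) \<le> m"
  proof -
    have "min (real l1) (real l2) + min (max (real l1) (real l2)) m = real l1 + real l2"
      using that by (auto simp: min_def max_def)
    then show ?thesis by (simp add: powr_add powr_realpow)
  qed
  moreover have "k\<^sup>2 * (min (2 ^ l1) (2 ^ l2) * 2 powr m) = k\<^sup>2 * 2 powr (min (real l1) (real l2) + min (max (real l1) (real l2)) m)" if "\<not> max (real l1) (real l2) \<le> m"
  proof -
    have "min (2 ^ l1) (2 ^ l2) = (2::real) powr (min (real l1) (real l2))"
      by (auto simp: min_def powr_realpow)
    moreover have "min (max (real l1) (real l2)) m = m" using that by (intro min_absorb2) linarith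
    ultimately show ?thesis by (simp add: powr_add)
  qed
  ultimately show "(tri F G H)\<^sup>2 \<le> (ennreal (k * 2 powr ?x))\<^sup>2 * (l2sq F * l2sq G * l2sq H)"
    unfolding sq using A[of F G H l1 l2] m s by (cases "max (real l1) (real l2) \<le> m") metis+
qed

text \<open>As \<open>N2 \<le> 32 * N0\<close>, the quotient \<open>R2 / M\<close> in
  \<open>tri_transversal\<close> is bounded and \<open>N1^2 * L1 * L2\<close> remains. The trivial
  bound is \<open>N1^3 * L_min = N1^2 * (L_min * N1)\<close>, whence the threshold
  \<open>N1\<close>.\<close>

lemma block_low_high:
  assumes n: "n1 \<le> n2" "n2 \<le> n0 + 5"
  shows "block_bound n1 n2 n0 (real n1) (1000 * 2 ^ n1)"
proof (rule block_boundI)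
  fix l1 l2 and F G H :: "spacetime \<Rightarrow> ennreal"
  assume m: "F \<in> borel_measurable borel" "G \<in> borel_measurable borel" "H \<in> borel_measurable borel"
    and F: "\<And>q. F q \<noteq> 0 \<Longrightarrow> freq q = n1 \<and> modul q = l1" and G: "\<And>q. G q \<noteq> 0 \<Longrightarrow> freq q = n2 \<and> modul q = l2"
    and H: "\<And>q. H q \<noteq> 0 \<Longrightarrow> freq q = n0"
  let ?Z = "l2sq F * l2sq G * l2sq H"
  let ?N = "(2::real) ^ n1" and ?L1 = "(2::real) ^ l1" and ?L2 = "(2::real) ^ l2"
  have triv: "(tri F G H)\<^sup>2 \<le> ennreal (24 * (2 * ?N) ^ 3 * min (2 * ?L1) (2 * ?L2)) * ?Z"
  proof (rule tri_trivial[OF m, where c = 0])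
    show "snd q \<in> cball 0 (2 * ?N) \<and> cdist q \<le> 2 * ?L1" if "F q \<noteq> 0" for q
      using F[OF that] freq_bounds(1)[of q] modul_bound[of q] by auto
    show "cdist q \<le> 2 * ?L2" if "G q \<noteq> 0" for q using G[OF that] modul_bound[of q] by auto
  qed auto
  have e: "24 * (2 * ?N) ^ 3 * min (2 * ?L1) (2 * ?L2) = 384 * (?N\<^sup>2 * (min ?L1 ?L2 * ?N))"
    by (simp add: min_def power2_eq_square power3_eq_cube)
  have L: "1 \<le> ?L1" "1 \<le> ?L2" by auto
  have "384 * (?N\<^sup>2 * (min ?L1 ?L2 * ?N)) \<le> 1000000 * (?N\<^sup>2 * (min ?L1 ?L2 * ?N))"
    by (intro mult_right_mono) auto
  also have "\<dots> = (1000 * ?N)\<^sup>2 * (min ?L1 ?L2 * 2 powr real n1)"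
    by (simp add: power_mult_distrib powr_realpow)
  finally have 2: "(tri F G H)\<^sup>2 \<le> ennreal ((1000 * ?N)\<^sup>2 * (min ?L1 ?L2 * 2 powr real n1)) * ?Z"
    using triv unfolding e by (elim order_trans) (intro mult_right_mono ennreal_leI, auto)
  have 1: "(tri F G H)\<^sup>2 \<le> ennreal ((1000 * ?N)\<^sup>2 * (?L1 * ?L2)) * ?Z"
  \<comment> \<open>In the lowest output region the foci may coincide. But then
    \<open>2 ^ n1\<close> is at most 32, and the trivial bound is enough.\<close>
  proof (cases "n0 = 0")
    case True
    then have "?N \<le> 2 ^ 5" using n by (intro power_increasing) auto
    moreover have "min ?L1 ?L2 \<le> ?L1 * ?L2" using L by (simp add: min_def)
    ultimately have "min ?L1 ?L2 * ?N \<le> (?L1 * ?L2) * 32" by (intro mult_mono) auto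
    then have "384 * (?N\<^sup>2 * (min ?L1 ?L2 * ?N)) \<le> 384 * (?N\<^sup>2 * ((?L1 * ?L2) * 32))" by (intro mult_left_mono) auto
    also have "\<dots> = 12288 * (?N\<^sup>2 * (?L1 * ?L2))" by simp
    also have "\<dots> \<le> 1000000 * (?N\<^sup>2 * (?L1 * ?L2))" by (intro mult_right_mono) auto
    also have "\<dots> = (1000 * ?N)\<^sup>2 * (?L1 * ?L2)" by (simp add: power_mult_distrib)
    finally show ?thesis using triv unfolding e by (elim order_trans) (intro mult_right_mono ennreal_leI, auto)
  next
    case False
    have "(tri F G H)\<^sup>2 \<le> ennreal (256 * (2 * ?N)\<^sup>2 * (2 * 2 ^ n2) * (2 * ?L1) * (2 * ?L2) / (2 ^ n0 / 2)) * ?Z"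
    proof (rule tri_transversal[OF m])
      show "norm (snd q) \<le> 2 * ?N \<and> cdist q \<le> 2 * ?L1" if "F q \<noteq> 0" for q
        using F[OF that] freq_bounds(1)[of q] modul_bound[of q] by auto
      show "norm (snd q) \<le> 2 * 2 ^ n2 \<and> cdist q \<le> 2 * ?L2" if "G q \<noteq> 0" for q
        using G[OF that] freq_bounds(1)[of q] modul_bound[of q] by auto
      show "2 ^ n0 / 2 \<le> norm (snd q)" if "H q \<noteq> 0" for q
        using H[OF that] freq_bounds(2)[of q] False by auto
    qed auto
    also have "\<dots> \<le> ennreal ((1000 * ?N)\<^sup>2 * (?L1 * ?L2)) * ?Z"
    proof (intro mult_right_mono ennreal_leI)
      have "(2::real) ^ n2 \<le> 2 ^ (n0 + 5)" using n by (intro power_increasing) auto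
      then have r: "(2::real) ^ n2 / 2 ^ n0 \<le> 32" by (simp add: power_add divide_le_eq)
      have "256 * (2 * ?N)\<^sup>2 * (2 * 2 ^ n2) * (2 * ?L1) * (2 * ?L2) / (2 ^ n0 / 2) =
          16384 * (?N\<^sup>2 * (?L1 * ?L2)) * (2 ^ n2 / 2 ^ n0)" by (simp add: power_mult_distrib)
      also have "\<dots> \<le> 16384 * (?N\<^sup>2 * (?L1 * ?L2)) * 32" by (intro mult_left_mono r) auto
      also have "\<dots> \<le> 1000000 * (?N\<^sup>2 * (?L1 * ?L2))" by simp
      also have "\<dots> = (1000 * ?N)\<^sup>2 * (?L1 * ?L2)" by (simp add: power_mult_distrib)
      finally show "256 * (2 * ?N)\<^sup>2 * (2 * 2 ^ n2) * (2 * ?L1) * (2 * ?L2) / (2 ^ n0 / 2) \<le> (1000 * ?N)\<^sup>2 * (?L1 * ?L2)" .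
    qed auto
    finally show ?thesis .
  qed
  show "(tri F G H)\<^sup>2 \<le> ennreal ((1000 * ?N)\<^sup>2 * (?L1 * ?L2)) * ?Z \<and>
      (tri F G H)\<^sup>2 \<le> ennreal ((1000 * ?N)\<^sup>2 * (min ?L1 ?L2 * 2 powr real n1)) * ?Z"
    using 1 2 by blast
qed simp

text \<open>\<open>N0^3 = (N0 * N1) * (N0^2 / N1)\<close> explains the threshold. A gap of five
  gives \<open>32 * N0 \<le> N1\<close>, more than the factor 12 in \<open>tri_high_high\<close>,
  and the square of 1200 exceeds the constant 1328000 there.\<close>

lemma block_high_high:
  assumes n: "n0 + 5 \<le> n1" "n0 + 5 \<le> n2" "n2 \<le> n1 + 1"
  shows "block_bound n1 n2 n0 (2 * real n0 - real n1) (1200 * 2 powr ((real n0 + real n1) / 2))"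
proof (rule block_boundI)
  fix l1 l2 and F G H :: "spacetime \<Rightarrow> ennreal"
  assume m: "F \<in> borel_measurable borel" "G \<in> borel_measurable borel" "H \<in> borel_measurable borel"
    and F: "\<And>q. F q \<noteq> 0 \<Longrightarrow> freq q = n1 \<and> modul q = l1" and G: "\<And>q. G q \<noteq> 0 \<Longrightarrow> freq q = n2 \<and> modul q = l2"
    and H: "\<And>q. H q \<noteq> 0 \<Longrightarrow> freq q = n0"
  let ?Z = "l2sq F * l2sq G * l2sq H"
  let ?N0 = "(2::real) ^ n0" and ?N1 = "(2::real) ^ n1" and ?N2 = "(2::real) ^ n2" and ?L1 = "(2::real) ^ l1" and ?L2 = "(2::real) ^ l2"
  let ?k = "1200 * 2 powr ((real n0 + real n1) / 2)"
  have F': "?N1 / 2 \<le> norm (snd q) \<and> norm (snd q) \<le> 2 * ?N1 \<and> cdist q \<le> 2 * ?L1" if "F q \<noteq> 0" for q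
    using F[OF that] freq_bounds[of q] modul_bound[of q] n by auto
  have G': "?N2 / 2 \<le> norm (snd q) \<and> norm (snd q) \<le> 2 * ?N2 \<and> cdist q \<le> 2 * ?L2" if "G q \<noteq> 0" for q
    using G[OF that] freq_bounds[of q] modul_bound[of q] n by auto
  have H': "norm (snd q) \<le> 2 * ?N0" if "H q \<noteq> 0" for q
    using H[OF that] freq_bounds(1)[of q] by auto
  have "(2::real) ^ (n0 + 5) \<le> ?N1" "(2::real) ^ (n0 + 5) \<le> ?N2" "?N2 \<le> 2 ^ (n1 + 1)"
    using n by (auto intro!: power_increasing simp del: power_Suc)
  then have "32 * ?N0 \<le> ?N1" "32 * ?N0 \<le> ?N2" and N3: "?N2 \<le> 2 * ?N1" by (simp_all add: power_add mult.commute)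
  moreover have "0 < ?N0" by simp
  ultimately have N: "12 * ?N0 \<le> ?N1" "12 * ?N0 \<le> ?N2" "?N2 \<le> 2 * ?N1" by linarith+
  have k2: "?k\<^sup>2 = 1440000 * (?N0 * ?N1)"
  proof -
    have "(2 powr ((real n0 + real n1) / 2))\<^sup>2 = 2 powr ((real n0 + real n1) / 2 + (real n0 + real n1) / 2)"
      unfolding power2_eq_square powr_add ..
    also have "\<dots> = ?N0 * ?N1" by (simp add: powr_add powr_realpow)
    finally show ?thesis by (simp add: power_mult_distrib)
  qed
  have m2: "2 powr (2 * real n0 - real n1) = ?N0\<^sup>2 / ?N1"
  proof -
    have "2 * real n0 = real (2 * n0)" by simp
    then have "2 powr (2 * real n0 - real n1) = 2 ^ (2 * n0) / ?N1" by (simp only: powr_diff powr_realpow zero_less_numeral)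
    then show ?thesis by (simp add: power_mult mult.commute)
  qed
  have "(tri F G H)\<^sup>2 \<le> ennreal (1328000 * ?N0 * ?N1 * ?L1 * ?L2) * ?Z"
    by (rule tri_high_high(1)[OF m F' G' H']) (use N in auto)
  also have "\<dots> \<le> ennreal (?k\<^sup>2 * (?L1 * ?L2)) * ?Z"
    unfolding k2 by (intro mult_right_mono ennreal_leI) auto
  finally have 1: "(tri F G H)\<^sup>2 \<le> ennreal (?k\<^sup>2 * (?L1 * ?L2)) * ?Z" .
  have "(tri F G H)\<^sup>2 \<le> ennreal (1328000 * ?N0 ^ 3 * min ?L1 ?L2) * ?Z"
    by (rule tri_high_high(2)[OF m F' G' H']) (use N in auto)
  also have "\<dots> \<le> ennreal (?k\<^sup>2 * (min ?L1 ?L2 * 2 powr (2 * real n0 - real n1))) * ?Z"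
  proof (intro mult_right_mono ennreal_leI)
    have "1328000 * ?N0 ^ 3 * min ?L1 ?L2 = 1328000 * (?N0 ^ 3 * min ?L1 ?L2)" by simp
    also have "\<dots> \<le> 1440000 * (?N0 ^ 3 * min ?L1 ?L2)" by (intro mult_right_mono) auto
    also have "\<dots> = ?k\<^sup>2 * (min ?L1 ?L2 * 2 powr (2 * real n0 - real n1))"
      unfolding k2 m2 by (simp add: power2_eq_square power3_eq_cube)
    finally show "1328000 * ?N0 ^ 3 * min ?L1 ?L2 \<le> ?k\<^sup>2 * (min ?L1 ?L2 * 2 powr (2 * real n0 - real n1))" .
  qed auto
  finally have 2: "(tri F G H)\<^sup>2 \<le> ennreal (?k\<^sup>2 * (min ?L1 ?L2 * 2 powr (2 * real n0 - real n1))) * ?Z" .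
  show "(tri F G H)\<^sup>2 \<le> ennreal (?k\<^sup>2 * (?L1 * ?L2)) * ?Z \<and>
      (tri F G H)\<^sup>2 \<le> ennreal (?k\<^sup>2 * (min ?L1 ?L2 * 2 powr (2 * real n0 - real n1))) * ?Z"
    using 1 2 by blast
qed simp

text \<open>Since the exponent \<open>b0\<close> is 0, \<open>h\<close> carries no modulation weight
  and is not split; it is the factor \<open>Z\<close> of \<open>schur_bilinear\<close>. The constant
  does not depend on the frequencies, which can therefore be summed afterwards.\<close>

lemma sum_modulations:
  assumes b12: "0 < b1" "0 < b2" "b1 \<noteq> 1/2" "b2 \<noteq> 1/2" "1/2 \<le> b1 + b2"
  obtains C where "0 < C"
    "\<And>n0 n1 n2 m k f g h. block_bound n1 n2 n0 m k \<Longrightarrow> 0 \<le> k \<Longrightarrow>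
       f \<in> borel_measurable borel \<Longrightarrow> g \<in> borel_measurable borel \<Longrightarrow> h \<in> borel_measurable borel \<Longrightarrow>
       (\<And>q. f q \<noteq> 0 \<Longrightarrow> freq q = n1) \<Longrightarrow> (\<And>q. g q \<noteq> 0 \<Longrightarrow> freq q = n2) \<Longrightarrow> (\<And>q. h q \<noteq> 0 \<Longrightarrow> freq q = n0) \<Longrightarrow>
       (tri (wt s1 b1 f) (wt s2 b2 g) (wt s0 0 h))\<^sup>2 \<le>
         (ennreal (C * k * 2 powr (kappa b1 b2 m - s0 * real n0 - s1 * real n1 - s2 * real n2)))\<^sup>2 * (l2sq f * l2sq g * l2sq h)"
proof -
  obtain C0 where C0: "0 < C0"
    "\<And>m a. (\<integral>\<^sup>+b. ennreal (2 powr mweight b1 b2 m a b) \<partial>count_space UNIV) \<le> ennreal (C0 * 2 powr kappa b1 b2 m)"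
    "\<And>m b. (\<integral>\<^sup>+a. ennreal (2 powr mweight b1 b2 m a b) \<partial>count_space UNIV) \<le> ennreal (C0 * 2 powr kappa b1 b2 m)"
    using modulation_sum[OF b12] by metis
  \<comment> \<open>The total loss from rounding the three weights to powers of two, as in
    \<open>wt_le\<close>.\<close>
  define c where "c = \<bar>s0\<bar> + (\<bar>s1\<bar> + b1) + (\<bar>s2\<bar> + b2)"
  show thesis
  proof (rule that)
    show "0 < C0 * 2 powr c" using C0 by simp
    fix n0 n1 n2 :: nat and m k :: real and f g h :: "spacetime \<Rightarrow> ennreal"
    assume bb: "block_bound n1 n2 n0 m k" and k: "0 \<le> k"
      and [measurable]: "f \<in> borel_measurable borel" "g \<in> borel_measurable borel" "h \<in> borel_measurable borel"
      and f: "\<And>q. f q \<noteq> 0 \<Longrightarrow> freq q = n1" and g: "\<And>q. g q \<noteq> 0 \<Longrightarrow> freq q = n2" and h: "\<And>q. h q \<noteq> 0 \<Longrightarrow> freq q = n0"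
    let ?F = "wt s1 b1 f" and ?G = "wt s2 b2 g" and ?H = "wt s0 0 h"
    let ?p = "\<lambda>a. piece modul a"
    define D where "D = k * 2 powr (c - s0 * real n0 - s1 * real n1 - s2 * real n2)"
    have D: "0 \<le> D" using k by (simp add: D_def)
    define K where "K a b = ennreal (D * 2 powr mweight b1 b2 m a b)" for a b
    have T: "(tri (?p a ?F) (?p b ?G) ?H)\<^sup>2 \<le> (K a b)\<^sup>2 * (l2sq (?p a f) * l2sq (?p b g) * l2sq h)" for a b
    proof -
      let ?xm = "(min (real a) (real b) + min (max (real a) (real b)) m) / 2"
      let ?xa = "\<bar>s1\<bar> + b1 - s1 * real n1 - b1 * real a" and ?xb = "\<bar>s2\<bar> + b2 - s2 * real n2 - b2 * real b" and ?xc = "\<bar>s0\<bar> - s0 * real n0"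
      have "(tri (?p a ?F) (?p b ?G) ?H)\<^sup>2 \<le> (ennreal (k * 2 powr ?xm))\<^sup>2 * (l2sq (?p a ?F) * l2sq (?p b ?G) * l2sq ?H)"
      proof -
        have S: "freq q = n1 \<and> modul q = a" if "?p a ?F q \<noteq> 0" for q
          using f that by (auto simp: piece_def wt_def split: if_splits)
        have S': "freq q = n2 \<and> modul q = b" if "?p b ?G q \<noteq> 0" for q
          using g that by (auto simp: piece_def wt_def split: if_splits)
        have S'': "freq q = n0" if "?H q \<noteq> 0" for q
          using h that by (auto simp: wt_def)
        have M: "?p a ?F \<in> borel_measurable borel" "?p b ?G \<in> borel_measurable borel" "?H \<in> borel_measurable borel"
          by measurable
        show ?thesis by (rule block_boundD[OF bb M S S' S''])
      qed
      also have "\<dots> \<le> (ennreal (k * 2 powr ?xm))\<^sup>2 * (((ennreal (2 powr ?xa))\<^sup>2 * l2sq (?p a f)) * ((ennreal (2 powr ?xb))\<^sup>2 * l2sq (?p b g)) * ((ennreal (2 powr ?xc))\<^sup>2 * l2sq h))"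
      proof (intro mult_left_mono mult_mono)
        show "l2sq (?p a ?F) \<le> (ennreal (2 powr ?xa))\<^sup>2 * l2sq (?p a f)"
          unfolding piece_wt using f b12 by (intro l2sq_wt_le) (auto simp: piece_def split: if_splits)
        show "l2sq (?p b ?G) \<le> (ennreal (2 powr ?xb))\<^sup>2 * l2sq (?p b g)"
          unfolding piece_wt using g b12 by (intro l2sq_wt_le) (auto simp: piece_def split: if_splits)
        show "l2sq ?H \<le> (ennreal (2 powr ?xc))\<^sup>2 * l2sq h"
          using h by (intro l2sq_wt_le) auto
      qed auto
      also have "\<dots> = (ennreal (k * 2 powr ?xm) * ennreal (2 powr ?xa) * ennreal (2 powr ?xb) * ennreal (2 powr ?xc))\<^sup>2 * (l2sq (?p a f) * l2sq (?p b g) * l2sq h)"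
        by (simp only: power_mult_distrib mult_ac)
      also have "ennreal (k * 2 powr ?xm) * ennreal (2 powr ?xa) * ennreal (2 powr ?xb) * ennreal (2 powr ?xc) = ennreal (k * 2 powr ?xm * 2 powr ?xa * 2 powr ?xb * 2 powr ?xc)"
        using k by (simp only: ennreal_mult mult_nonneg_nonneg powr_ge_zero)
      also have "k * 2 powr ?xm * 2 powr ?xa * 2 powr ?xb * 2 powr ?xc = D * 2 powr mweight b1 b2 m a b"
      proof -
        have eq: "?xm + ?xa + ?xb + ?xc = (c - s0 * real n0 - s1 * real n1 - s2 * real n2) + mweight b1 b2 m a b"
          by (simp add: c_def mweight_def)
        have "k * 2 powr ?xm * 2 powr ?xa * 2 powr ?xb * 2 powr ?xc = k * 2 powr (?xm + ?xa + ?xb + ?xc)"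
          by (simp only: powr_add mult.assoc)
        also have "\<dots> = D * 2 powr mweight b1 b2 m a b"
          unfolding eq by (simp only: D_def powr_add mult.assoc)
        finally show ?thesis .
      qed
      finally show ?thesis unfolding K_def .
    qed
    let ?B = "ennreal (D * (C0 * 2 powr kappa b1 b2 m))"
    have K1: "(\<integral>\<^sup>+b. K a b \<partial>count_space UNIV) \<le> ?B" for a
    proof -
      have "(\<integral>\<^sup>+b. K a b \<partial>count_space UNIV) = ennreal D * (\<integral>\<^sup>+b. ennreal (2 powr mweight b1 b2 m a b) \<partial>count_space UNIV)"
        using D by (simp add: K_def ennreal_mult nn_integral_cmult)
      also have "\<dots> \<le> ennreal D * ennreal (C0 * 2 powr kappa b1 b2 m)" by (intro mult_left_mono C0) auto
      also have "\<dots> = ?B" using D C0(1) by (intro ennreal_mult[symmetric]) auto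
      finally show ?thesis .
    qed
    have K2: "(\<integral>\<^sup>+a. K a b \<partial>count_space UNIV) \<le> ?B" for b
    proof -
      have "(\<integral>\<^sup>+a. K a b \<partial>count_space UNIV) = ennreal D * (\<integral>\<^sup>+a. ennreal (2 powr mweight b1 b2 m a b) \<partial>count_space UNIV)"
        using D by (simp add: K_def ennreal_mult nn_integral_cmult)
      also have "\<dots> \<le> ennreal D * ennreal (C0 * 2 powr kappa b1 b2 m)" by (intro mult_left_mono C0) auto
      also have "\<dots> = ?B" using D C0(1) by (intro ennreal_mult[symmetric]) auto
      finally show ?thesis .
    qed
    have "tri ?F ?G ?H = (\<integral>\<^sup>+a. tri (?p a ?F) ?G ?H \<partial>count_space UNIV)"
      by (rule tri_piece_left) measurable
    also have "\<dots> = (\<integral>\<^sup>+a. \<integral>\<^sup>+b. tri (?p a ?F) (?p b ?G) ?H \<partial>count_space UNIV \<partial>count_space UNIV)"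
      by (intro nn_integral_cong tri_piece_right) measurable
    finally have "(tri ?F ?G ?H)\<^sup>2 \<le> ?B * ?B * ((\<integral>\<^sup>+a. l2sq (?p a f) \<partial>count_space UNIV) * (\<integral>\<^sup>+b. l2sq (?p b g) \<partial>count_space UNIV) * l2sq h)"
      using schur_bilinear[OF T K1 K2] by simp
    also have "\<dots> = ?B\<^sup>2 * (l2sq f * l2sq g * l2sq h)"
      by (simp add: nn_integral_l2sq_piece power2_eq_square)
    also have "D * (C0 * 2 powr kappa b1 b2 m) = C0 * 2 powr c * k * 2 powr (kappa b1 b2 m - s0 * real n0 - s1 * real n1 - s2 * real n2)"
      by (simp add: D_def powr_add[symmetric] powr_diff)
    finally show "(tri ?F ?G ?H)\<^sup>2 \<le> (ennreal (C0 * 2 powr c * k * 2 powr (kappa b1 b2 m - s0 * real n0 - s1 * real n1 - s2 * real n2)))\<^sup>2 * (l2sq f * l2sq g * l2sq h)" .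
  qed
qed

section \<open>Summation over frequencies\<close>

definition dyadic_tri where
  "dyadic_tri s0 s1 s2 b1 b2 f g h n1 n2 n0 =
     tri (wt s1 b1 (piece freq n1 f)) (wt s2 b2 (piece freq n2 g)) (wt s0 0 (piece freq n0 h))"

lemma dyadic_tri_commute:
  assumes [measurable]: "f \<in> borel_measurable borel" "g \<in> borel_measurable borel"
  shows "dyadic_tri s0 s1 s2 b1 b2 f g h n1 n2 n0 = dyadic_tri s0 s2 s1 b2 b1 g f h n2 n1 n0"
  unfolding dyadic_tri_def by (rule tri_commute) measurable

lemma dyadic_tri_nonzero:
  assumes "dyadic_tri s0 s1 s2 b1 b2 f g h n1 n2 n0 \<noteq> 0"
  shows "n0 \<le> max n1 n2 + 1" "n1 \<le> max n0 n2 + 1" "n2 \<le> max n0 n1 + 1"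
proof -
  obtain p q where "wt s0 0 (piece freq n0 h) p \<noteq> 0" "wt s1 b1 (piece freq n1 f) q \<noteq> 0" "wt s2 b2 (piece freq n2 g) (p - q) \<noteq> 0"
    using tri_nonzeroE[OF assms[unfolded dyadic_tri_def]] by metis
  then have "freq p = n0" "freq q = n1" "freq (p - q) = n2"
    by (auto simp: wt_def piece_def split: if_splits)
  then show "n0 \<le> max n1 n2 + 1" "n1 \<le> max n0 n2 + 1" "n2 \<le> max n0 n1 + 1"
    using freq_triangle[where p = p and q = q] by auto
qed

lemma piece_nonzero: "piece d n f q \<noteq> 0 \<Longrightarrow> d q = n"
  by (auto simp: piece_def split: if_splits)

text \<open>Moves a weight from one high frequency to a comparable one at the price of a constant
  factor.\<close>

lemma abs_mult_le:
  fixes s x y c :: real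
  assumes "\<bar>x - y\<bar> \<le> c"
  shows "- s * x \<le> - s * y + c * \<bar>s\<bar>"
proof -
  have "- s * x - (- s * y) = s * (y - x)" by (simp add: algebra_simps)
  also have "\<dots> \<le> \<bar>s\<bar> * \<bar>y - x\<bar>" by (metis abs_ge_self abs_mult)
  also have "\<dots> \<le> \<bar>s\<bar> * c" using assms by (intro mult_left_mono) auto
  finally show ?thesis by (simp add: mult.commute)
qed

lemma nn_integral_cmult_if_le:
  assumes D: "0 \<le> D" and C: "0 \<le> C"
    and le: "(\<integral>\<^sup>+i. (if P i then ennreal (e i) else 0) \<partial>count_space UNIV) \<le> ennreal C"
  shows "(\<integral>\<^sup>+i. (if P i then ennreal (D * e i) else 0) \<partial>count_space UNIV) \<le> ennreal (D * C)"
proof -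
  have "(\<integral>\<^sup>+i. (if P i then ennreal (D * e i) else 0) \<partial>count_space UNIV) =
      (\<integral>\<^sup>+i. ennreal D * (if P i then ennreal (e i) else 0) \<partial>count_space UNIV)"
    using D by (intro nn_integral_cong) (auto simp: ennreal_mult')
  also have "\<dots> \<le> ennreal D * ennreal C"
    by (simp add: nn_integral_cmult le mult_left_mono)
  also have "\<dots> = ennreal (D * C)" using C D by (simp add: ennreal_mult)
  finally show ?thesis .
qed

text \<open>Here \<open>n1\<close> is the low index of \<open>schur_trilinear\<close>, while
  \<open>n2\<close> and \<open>n0\<close> are comparable: the triangle inequality gives
  \<open>n0 \<le> n2 + 1\<close> and the region gives \<open>n2 \<le> n0 + 5\<close>. So
  \<open>c = 5\<close>, which is the origin of the factor 11.\<close>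

lemma low_high_bound:
  assumes ad: "admissible s0 s1 s2 b1 b2"
  obtains C where "0 < C"
    "\<And>f g h. f \<in> borel_measurable borel \<Longrightarrow> g \<in> borel_measurable borel \<Longrightarrow> h \<in> borel_measurable borel \<Longrightarrow>
     (\<integral>\<^sup>+n2. \<integral>\<^sup>+n0. \<integral>\<^sup>+n1. (if n1 \<le> n2 \<and> n2 \<le> n0 + 5 then dyadic_tri s0 s1 s2 b1 b2 f g h n1 n2 n0 else 0)
        \<partial>count_space UNIV \<partial>count_space UNIV \<partial>count_space UNIV)\<^sup>2 \<le> (ennreal C)\<^sup>2 * (l2sq f * l2sq g * l2sq h)"
proof -
  have b12: "0 < b1" "0 < b2" "b1 \<noteq> 1/2" "b2 \<noteq> 1/2" "1/2 \<le> b1 + b2" using ad by (auto simp: admissible_def)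
  obtain C0 where C0: "0 < C0"
    "\<And>n0 n1 n2 m k f g h. block_bound n1 n2 n0 m k \<Longrightarrow> 0 \<le> k \<Longrightarrow>
       f \<in> borel_measurable borel \<Longrightarrow> g \<in> borel_measurable borel \<Longrightarrow> h \<in> borel_measurable borel \<Longrightarrow>
       (\<And>q. f q \<noteq> 0 \<Longrightarrow> freq q = n1) \<Longrightarrow> (\<And>q. g q \<noteq> 0 \<Longrightarrow> freq q = n2) \<Longrightarrow> (\<And>q. h q \<noteq> 0 \<Longrightarrow> freq q = n0) \<Longrightarrow>
       (tri (wt s1 b1 f) (wt s2 b2 g) (wt s0 0 h))\<^sup>2 \<le>
         (ennreal (C0 * k * 2 powr (kappa b1 b2 m - s0 * real n0 - s1 * real n1 - s2 * real n2)))\<^sup>2 * (l2sq f * l2sq g * l2sq h)"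
    using sum_modulations[OF b12, of s1 s2 s0] by blast
  obtain C1 where C1: "0 < C1"
    "\<And>j. (\<integral>\<^sup>+i. (if i \<le> j then ennreal (2 powr ((1 + theta b1 b2 - s1) * real i - (s0 + s2) * real j)) else 0) \<partial>count_space UNIV) \<le> ennreal C1"
    using low_high_sum[OF ad] by metis
  \<comment> \<open>The factor \<open>2 powr (5 * \<bar>s0\<bar>)\<close> pays for replacing the
    output frequency by the comparable \<open>n2\<close> in the weight with exponent
    \<open>s0\<close>.\<close>
  define D where "D = C0 * 1000 * 2 powr (5 * \<bar>s0\<bar>)"
  have D: "0 < D" using C0 by (simp add: D_def)
  define w where "w i j = (if i \<le> j then ennreal (D * 2 powr ((1 + theta b1 b2 - s1) * real i - (s0 + s2) * real j)) else 0)" for i j :: nat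
  show thesis
  proof (rule that)
    show "0 < 11 * (D * C1)" using D C1 by simp
    fix f g h :: "spacetime \<Rightarrow> ennreal"
    assume m [measurable]: "f \<in> borel_measurable borel" "g \<in> borel_measurable borel" "h \<in> borel_measurable borel"
    let ?T = "\<lambda>i j k. if i \<le> j \<and> j \<le> k + 5 then dyadic_tri s0 s1 s2 b1 b2 f g h i j k else 0"
    have near: "k \<le> j + 5 \<and> j \<le> k + 5" if "?T i j k \<noteq> 0" for i j k
      using that dyadic_tri_nonzero(1)[of s0 s1 s2 b1 b2 f g h i j k] by (auto split: if_splits)
    have T: "(?T i j k)\<^sup>2 \<le> (w i j)\<^sup>2 * (l2sq (piece freq i f) * l2sq (piece freq j g) * l2sq (piece freq k h))" for i j k
    proof (cases "?T i j k = 0")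
      case False
      then have ij: "i \<le> j" "j \<le> k + 5" by (auto split: if_splits)
      have jk: "\<bar>real k - real j\<bar> \<le> 5" using near[OF False] by auto
      let ?y = "kappa b1 b2 (real i) - s0 * real k - s1 * real i - s2 * real j"
      have "(?T i j k)\<^sup>2 \<le> (ennreal (C0 * (1000 * 2 ^ i) * 2 powr ?y))\<^sup>2 * (l2sq (piece freq i f) * l2sq (piece freq j g) * l2sq (piece freq k h))"
        using C0(2)[OF block_low_high[OF ij], of "piece freq i f" "piece freq j g" "piece freq k h"] ij
        by (simp add: dyadic_tri_def piece_nonzero)
      also have "\<dots> \<le> (w i j)\<^sup>2 * (l2sq (piece freq i f) * l2sq (piece freq j g) * l2sq (piece freq k h))"
      proof (intro mult_right_mono power_mono)
        have "C0 * (1000 * 2 ^ i) * 2 powr ?y = C0 * 1000 * 2 powr (real i + ?y)"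
          by (simp add: powr_add powr_realpow)
        also have "\<dots> \<le> C0 * 1000 * 2 powr (5 * \<bar>s0\<bar> + ((1 + theta b1 b2 - s1) * real i - (s0 + s2) * real j))"
        proof (intro mult_left_mono powr_mono)
          show "real i + ?y \<le> 5 * \<bar>s0\<bar> + ((1 + theta b1 b2 - s1) * real i - (s0 + s2) * real j)"
            using abs_mult_le[OF jk, of s0] by (simp add: kappa_def algebra_simps)
        qed (use C0 in auto)
        also have "\<dots> = D * 2 powr ((1 + theta b1 b2 - s1) * real i - (s0 + s2) * real j)"
          by (simp only: D_def powr_add mult.assoc)
        finally show "ennreal (C0 * (1000 * 2 ^ i) * 2 powr ?y) \<le> w i j"
          using ij by (simp add: w_def ennreal_leI)
      qed auto
      finally show ?thesis .
    qed simp
    have A: "(\<integral>\<^sup>+i. w i j \<partial>count_space UNIV) \<le> ennreal (D * C1)" for j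
      unfolding w_def using D C1(1) by (intro nn_integral_cmult_if_le C1(2)) auto
    have "(\<integral>\<^sup>+j. \<integral>\<^sup>+k. \<integral>\<^sup>+i. ?T i j k \<partial>count_space UNIV \<partial>count_space UNIV \<partial>count_space UNIV)\<^sup>2 \<le>
      (of_nat (2 * 5 + 1) * ennreal (D * C1))\<^sup>2 * ((\<integral>\<^sup>+i. l2sq (piece freq i f) \<partial>count_space UNIV) *
        (\<integral>\<^sup>+j. l2sq (piece freq j g) \<partial>count_space UNIV) * (\<integral>\<^sup>+k. l2sq (piece freq k h) \<partial>count_space UNIV))"
      by (rule schur_trilinear[OF T near A])
    also have "of_nat (2 * 5 + 1) * ennreal (D * C1) = ennreal (11 * (D * C1))"
      using D C1 by (subst ennreal_mult) auto
    finally show "(\<integral>\<^sup>+n2. \<integral>\<^sup>+n0. \<integral>\<^sup>+n1. ?T n1 n2 n0 \<partial>count_space UNIV \<partial>count_space UNIV \<partial>count_space UNIV)\<^sup>2 \<le>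
       (ennreal (11 * (D * C1)))\<^sup>2 * (l2sq f * l2sq g * l2sq h)"
      by (simp only: nn_integral_l2sq_piece[OF m(1) freq_modul_measurable(1)] nn_integral_l2sq_piece[OF m(2) freq_modul_measurable(1)]
          nn_integral_l2sq_piece[OF m(3) freq_modul_measurable(1)])
  qed
qed

text \<open>Now the output is the low index. By the triangle inequality an input far above the
  output forces the other input to within one dyadic step of it.\<close>

lemma high_high_bound:
  assumes ad: "admissible s0 s1 s2 b1 b2"
  obtains C where "0 < C"
    "\<And>f g h. f \<in> borel_measurable borel \<Longrightarrow> g \<in> borel_measurable borel \<Longrightarrow> h \<in> borel_measurable borel \<Longrightarrow>
     (\<integral>\<^sup>+n1. \<integral>\<^sup>+n2. \<integral>\<^sup>+n0. (if n0 + 5 < max n1 n2 then dyadic_tri s0 s1 s2 b1 b2 f g h n1 n2 n0 else 0)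
        \<partial>count_space UNIV \<partial>count_space UNIV \<partial>count_space UNIV)\<^sup>2 \<le> (ennreal C)\<^sup>2 * (l2sq f * l2sq g * l2sq h)"
proof -
  have b12: "0 < b1" "0 < b2" "b1 \<noteq> 1/2" "b2 \<noteq> 1/2" "1/2 \<le> b1 + b2" using ad by (auto simp: admissible_def)
  obtain C0 where C0: "0 < C0"
    "\<And>n0 n1 n2 m k f g h. block_bound n1 n2 n0 m k \<Longrightarrow> 0 \<le> k \<Longrightarrow>
       f \<in> borel_measurable borel \<Longrightarrow> g \<in> borel_measurable borel \<Longrightarrow> h \<in> borel_measurable borel \<Longrightarrow>
       (\<And>q. f q \<noteq> 0 \<Longrightarrow> freq q = n1) \<Longrightarrow> (\<And>q. g q \<noteq> 0 \<Longrightarrow> freq q = n2) \<Longrightarrow> (\<And>q. h q \<noteq> 0 \<Longrightarrow> freq q = n0) \<Longrightarrow>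
       (tri (wt s1 b1 f) (wt s2 b2 g) (wt s0 0 h))\<^sup>2 \<le>
         (ennreal (C0 * k * 2 powr (kappa b1 b2 m - s0 * real n0 - s1 * real n1 - s2 * real n2)))\<^sup>2 * (l2sq f * l2sq g * l2sq h)"
    using sum_modulations[OF b12, of s1 s2 s0] by blast
  obtain C1 where C1: "0 < C1"
    "\<And>j. (\<integral>\<^sup>+i. (if i \<le> j then ennreal (2 powr hhexp s0 s1 s2 b1 b2 (real i) (real j)) else 0) \<partial>count_space UNIV) \<le> ennreal C1"
    using high_high_sum[OF ad] by metis
  define D where "D = C0 * 1200 * 2 powr \<bar>s2\<bar>"
  have D: "0 < D" using C0 by (simp add: D_def)
  define w where "w i j = (if i \<le> j then ennreal (D * 2 powr hhexp s0 s1 s2 b1 b2 (real i) (real j)) else 0)" for i j :: nat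
  show thesis
  proof (rule that)
    show "0 < 3 * (D * C1)" using D C1 by simp
    fix f g h :: "spacetime \<Rightarrow> ennreal"
    assume m [measurable]: "f \<in> borel_measurable borel" "g \<in> borel_measurable borel" "h \<in> borel_measurable borel"
    let ?T = "\<lambda>i j k. if i + 5 < max j k then dyadic_tri s0 s1 s2 b1 b2 f g h j k i else 0"
    have near: "k \<le> j + 1 \<and> j \<le> k + 1" if "?T i j k \<noteq> 0" for i j k
    proof -
      have "i + 5 < max j k" "dyadic_tri s0 s1 s2 b1 b2 f g h j k i \<noteq> 0" using that by (auto split: if_splits)
      then show ?thesis using dyadic_tri_nonzero(2,3)[of s0 s1 s2 b1 b2 f g h j k i] by linarith
    qed
    have T: "(?T i j k)\<^sup>2 \<le> (w i j)\<^sup>2 * (l2sq (piece freq i h) * l2sq (piece freq j f) * l2sq (piece freq k g))" for i j k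
    proof (cases "?T i j k = 0")
      case False
      then have ij: "i + 5 < max j k" by (auto split: if_splits)
      have jk: "\<bar>real k - real j\<bar> \<le> 1" using near[OF False] by auto
      \<comment> \<open>The strict inequality \<open>i + 5 < max j k\<close> leaves room for the one
        step by which \<open>j\<close> and \<open>k\<close> may differ, so both inputs have the gap
        required in \<open>block_high_high\<close>.\<close>
      have n: "i + 5 \<le> j" "i + 5 \<le> k" "k \<le> j + 1" using near[OF False] ij by linarith+
      let ?y = "kappa b1 b2 (2 * real i - real j) - s0 * real i - s1 * real j - s2 * real k"
      have "(?T i j k)\<^sup>2 \<le> (ennreal (C0 * (1200 * 2 powr ((real i + real j) / 2)) * 2 powr ?y))\<^sup>2 * (l2sq (piece freq j f) * l2sq (piece freq k g) * l2sq (piece freq i h))"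
        using C0(2)[OF block_high_high[OF n], of "piece freq j f" "piece freq k g" "piece freq i h"] ij
        by (simp add: dyadic_tri_def piece_nonzero)
      also have "\<dots> \<le> (w i j)\<^sup>2 * (l2sq (piece freq j f) * l2sq (piece freq k g) * l2sq (piece freq i h))"
      proof (intro mult_right_mono power_mono)
        have "C0 * (1200 * 2 powr ((real i + real j) / 2)) * 2 powr ?y = C0 * 1200 * 2 powr ((real i + real j) / 2 + ?y)"
          by (simp only: powr_add mult.assoc)
        also have "\<dots> \<le> C0 * 1200 * 2 powr (\<bar>s2\<bar> + hhexp s0 s1 s2 b1 b2 (real i) (real j))"
        proof (intro mult_left_mono powr_mono)
          show "(real i + real j) / 2 + ?y \<le> \<bar>s2\<bar> + hhexp s0 s1 s2 b1 b2 (real i) (real j)"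
            using abs_mult_le[OF jk, of s2] by (simp add: hhexp_def algebra_simps)
        qed (use C0 in auto)
        also have "\<dots> = D * 2 powr hhexp s0 s1 s2 b1 b2 (real i) (real j)"
          by (simp only: D_def powr_add mult.assoc)
        finally show "ennreal (C0 * (1200 * 2 powr ((real i + real j) / 2)) * 2 powr ?y) \<le> w i j"
          using n by (simp add: w_def ennreal_leI)
      qed auto
      finally show ?thesis by (simp only: mult_ac)
    qed simp
    have A: "(\<integral>\<^sup>+i. w i j \<partial>count_space UNIV) \<le> ennreal (D * C1)" for j
      unfolding w_def using D C1(1) by (intro nn_integral_cmult_if_le C1(2)) auto
    have "(\<integral>\<^sup>+j. \<integral>\<^sup>+k. \<integral>\<^sup>+i. ?T i j k \<partial>count_space UNIV \<partial>count_space UNIV \<partial>count_space UNIV)\<^sup>2 \<le>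
      (of_nat (2 * 1 + 1) * ennreal (D * C1))\<^sup>2 * ((\<integral>\<^sup>+i. l2sq (piece freq i h) \<partial>count_space UNIV) *
        (\<integral>\<^sup>+j. l2sq (piece freq j f) \<partial>count_space UNIV) * (\<integral>\<^sup>+k. l2sq (piece freq k g) \<partial>count_space UNIV))"
      by (rule schur_trilinear[OF T near A])
    also have "of_nat (2 * 1 + 1) * ennreal (D * C1) = ennreal (3 * (D * C1))"
      using D C1 by (subst ennreal_mult) auto
    finally show "(\<integral>\<^sup>+n1. \<integral>\<^sup>+n2. \<integral>\<^sup>+n0. ?T n0 n1 n2 \<partial>count_space UNIV \<partial>count_space UNIV \<partial>count_space UNIV)\<^sup>2 \<le>
       (ennreal (3 * (D * C1)))\<^sup>2 * (l2sq f * l2sq g * l2sq h)"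
      by (simp only: nn_integral_l2sq_piece[OF m(1) freq_modul_measurable(1)] nn_integral_l2sq_piece[OF m(2) freq_modul_measurable(1)]
          nn_integral_l2sq_piece[OF m(3) freq_modul_measurable(1)] mult_ac)
  qed
qed

lemma nn_integral_count_swap:
  "(\<integral>\<^sup>+i. \<integral>\<^sup>+j. f i j \<partial>count_space UNIV \<partial>count_space UNIV) = (\<integral>\<^sup>+j. \<integral>\<^sup>+i. f i j \<partial>count_space UNIV \<partial>count_space UNIV)"
  using nn_integral_fst_count_space[of "\<lambda>(i, j). f i j"] nn_integral_snd_count_space[of "\<lambda>(i, j). f i j"] by simp

text \<open>All triples of frequencies are covered by three regions: either the larger input is at
  most five steps above the output, with two choices for the larger one that are exchanged by
  symmetry, or the output lies further below. Overlaps do no harm, as all terms are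
  nonnegative.\<close>

lemma weighted_trilinear_bound:
  assumes ad: "admissible s0 s1 s2 b1 b2"
  obtains C where "0 < C"
    "\<And>f g h. f \<in> borel_measurable borel \<Longrightarrow> g \<in> borel_measurable borel \<Longrightarrow> h \<in> borel_measurable borel \<Longrightarrow>
      (tri (wt s1 b1 f) (wt s2 b2 g) (wt s0 0 h))\<^sup>2 \<le> (ennreal C)\<^sup>2 * (l2sq f * l2sq g * l2sq h)"
proof -
  obtain C1 where C1: "0 < C1"
    "\<And>f g h. f \<in> borel_measurable borel \<Longrightarrow> g \<in> borel_measurable borel \<Longrightarrow> h \<in> borel_measurable borel \<Longrightarrow>
     (\<integral>\<^sup>+n2. \<integral>\<^sup>+n0. \<integral>\<^sup>+n1. (if n1 \<le> n2 \<and> n2 \<le> n0 + 5 then dyadic_tri s0 s1 s2 b1 b2 f g h n1 n2 n0 else 0)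
        \<partial>count_space UNIV \<partial>count_space UNIV \<partial>count_space UNIV)\<^sup>2 \<le> (ennreal C1)\<^sup>2 * (l2sq f * l2sq g * l2sq h)"
    using low_high_bound[OF ad] by blast
  obtain C2 where C2: "0 < C2"
    "\<And>f g h. f \<in> borel_measurable borel \<Longrightarrow> g \<in> borel_measurable borel \<Longrightarrow> h \<in> borel_measurable borel \<Longrightarrow>
     (\<integral>\<^sup>+n2. \<integral>\<^sup>+n0. \<integral>\<^sup>+n1. (if n1 \<le> n2 \<and> n2 \<le> n0 + 5 then dyadic_tri s0 s2 s1 b2 b1 f g h n1 n2 n0 else 0)
        \<partial>count_space UNIV \<partial>count_space UNIV \<partial>count_space UNIV)\<^sup>2 \<le> (ennreal C2)\<^sup>2 * (l2sq f * l2sq g * l2sq h)"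
    using low_high_bound[OF admissible_commute[OF ad]] by blast
  obtain C3 where C3: "0 < C3"
    "\<And>f g h. f \<in> borel_measurable borel \<Longrightarrow> g \<in> borel_measurable borel \<Longrightarrow> h \<in> borel_measurable borel \<Longrightarrow>
     (\<integral>\<^sup>+n1. \<integral>\<^sup>+n2. \<integral>\<^sup>+n0. (if n0 + 5 < max n1 n2 then dyadic_tri s0 s1 s2 b1 b2 f g h n1 n2 n0 else 0)
        \<partial>count_space UNIV \<partial>count_space UNIV \<partial>count_space UNIV)\<^sup>2 \<le> (ennreal C3)\<^sup>2 * (l2sq f * l2sq g * l2sq h)"
    using high_high_bound[OF ad] by blast
  define C where "C = max C1 (max C2 C3)"
  have C: "0 < C" "C1 \<le> C" "C2 \<le> C" "C3 \<le> C" using C1(1) by (auto simp: C_def)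
  show thesis
  proof (rule that)
    show "0 < 3 * C" using C by simp
    fix f g h :: "spacetime \<Rightarrow> ennreal"
    assume m [measurable]: "f \<in> borel_measurable borel" "g \<in> borel_measurable borel" "h \<in> borel_measurable borel"
    let ?c = "count_space (UNIV :: nat set)" and ?Z = "l2sq f * l2sq g * l2sq h"
    let ?t = "\<lambda>n1 n2 n0. dyadic_tri s0 s1 s2 b1 b2 f g h n1 n2 n0"
    let ?r1 = "\<lambda>n1 n2 n0. if n1 \<le> n2 \<and> n2 \<le> n0 + 5 then ?t n1 n2 n0 else 0"
    let ?r2 = "\<lambda>n1 n2 n0. if n2 \<le> n1 \<and> n1 \<le> n0 + 5 then ?t n1 n2 n0 else 0"
    let ?r3 = "\<lambda>n1 n2 n0. if n0 + 5 < max n1 n2 then ?t n1 n2 n0 else 0"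
    let ?R1 = "\<integral>\<^sup>+n1. \<integral>\<^sup>+n2. \<integral>\<^sup>+n0. ?r1 n1 n2 n0 \<partial>?c \<partial>?c \<partial>?c" and ?R2 = "\<integral>\<^sup>+n1. \<integral>\<^sup>+n2. \<integral>\<^sup>+n0. ?r2 n1 n2 n0 \<partial>?c \<partial>?c \<partial>?c"
      and ?R3 = "\<integral>\<^sup>+n1. \<integral>\<^sup>+n2. \<integral>\<^sup>+n0. ?r3 n1 n2 n0 \<partial>?c \<partial>?c \<partial>?c"
    have up: "x \<le> (ennreal C)\<^sup>2 * ?Z" if "x \<le> (ennreal c)\<^sup>2 * ?Z" "c \<le> C" for x c
      using that(1) by (rule order_trans) (intro mult_right_mono power_mono ennreal_leI that(2), auto)
    have "?R1 = (\<integral>\<^sup>+n2. \<integral>\<^sup>+n1. \<integral>\<^sup>+n0. ?r1 n1 n2 n0 \<partial>?c \<partial>?c \<partial>?c)" by (rule nn_integral_count_swap)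
    also have "\<dots> = (\<integral>\<^sup>+n2. \<integral>\<^sup>+n0. \<integral>\<^sup>+n1. ?r1 n1 n2 n0 \<partial>?c \<partial>?c \<partial>?c)" by (intro nn_integral_cong nn_integral_count_swap)
    finally have 1: "?R1\<^sup>2 \<le> (ennreal C)\<^sup>2 * ?Z" using up[OF C1(2)[OF m] C(2)] by simp
    have "?R2 = (\<integral>\<^sup>+n1. \<integral>\<^sup>+n0. \<integral>\<^sup>+n2. ?r2 n1 n2 n0 \<partial>?c \<partial>?c \<partial>?c)" by (intro nn_integral_cong nn_integral_count_swap)
    also have "\<dots> = (\<integral>\<^sup>+n1. \<integral>\<^sup>+n0. \<integral>\<^sup>+n2. (if n2 \<le> n1 \<and> n1 \<le> n0 + 5 then dyadic_tri s0 s2 s1 b2 b1 g f h n2 n1 n0 else 0) \<partial>?c \<partial>?c \<partial>?c)"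
      by (simp only: dyadic_tri_commute[OF m(1,2)])
    finally have 2: "?R2\<^sup>2 \<le> (ennreal C)\<^sup>2 * ?Z"
      using up[OF C2(2)[OF m(2,1,3), unfolded mult.commute[of "l2sq g"]] C(3)] by simp
    have 3: "?R3\<^sup>2 \<le> (ennreal C)\<^sup>2 * ?Z" using up[OF C3(2)[OF m] C(4)] by simp
    have "tri (wt s1 b1 f) (wt s2 b2 g) (wt s0 0 h) = (\<integral>\<^sup>+n1. tri (piece freq n1 (wt s1 b1 f)) (wt s2 b2 g) (wt s0 0 h) \<partial>?c)"
      by (rule tri_piece_left) measurable
    also have "\<dots> = (\<integral>\<^sup>+n1. \<integral>\<^sup>+n2. tri (piece freq n1 (wt s1 b1 f)) (piece freq n2 (wt s2 b2 g)) (wt s0 0 h) \<partial>?c \<partial>?c)"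
      by (intro nn_integral_cong tri_piece_right) measurable
    also have "\<dots> = (\<integral>\<^sup>+n1. \<integral>\<^sup>+n2. \<integral>\<^sup>+n0. ?t n1 n2 n0 \<partial>?c \<partial>?c \<partial>?c)"
      unfolding dyadic_tri_def piece_wt[symmetric] by (intro nn_integral_cong tri_piece_out) measurable
    also have "\<dots> \<le> (\<integral>\<^sup>+n1. \<integral>\<^sup>+n2. \<integral>\<^sup>+n0. ?r1 n1 n2 n0 + (?r2 n1 n2 n0 + ?r3 n1 n2 n0) \<partial>?c \<partial>?c \<partial>?c)"
    proof (intro nn_integral_mono)
      fix n1 n2 n0 :: nat
      consider "n1 \<le> n2 \<and> n2 \<le> n0 + 5" | "n2 \<le> n1 \<and> n1 \<le> n0 + 5" | "n0 + 5 < max n1 n2" by linarith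
      then show "?t n1 n2 n0 \<le> ?r1 n1 n2 n0 + (?r2 n1 n2 n0 + ?r3 n1 n2 n0)"
        by cases (simp_all add: add_increasing add_increasing2)
    qed
    also have "\<dots> = ?R1 + (?R2 + ?R3)"
      by (simp only: nn_integral_add[OF borel_measurable_count_space borel_measurable_count_space])
    \<comment> \<open>The available bounds concern squares, so the sum is replaced by three times
      the maximum.\<close>
    finally have "tri (wt s1 b1 f) (wt s2 b2 g) (wt s0 0 h) \<le> 3 * max ?R1 (max ?R2 ?R3)"
    proof (rule order_trans)
      have "?R1 + (?R2 + ?R3) \<le> max ?R1 (max ?R2 ?R3) + (max ?R1 (max ?R2 ?R3) + max ?R1 (max ?R2 ?R3))"
        by (intro add_mono) (auto simp: le_max_iff_disj)
      also have "\<dots> = (1 + (1 + 1)) * max ?R1 (max ?R2 ?R3)" by (simp only: distrib_right mult_1)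
      finally show "?R1 + (?R2 + ?R3) \<le> 3 * max ?R1 (max ?R2 ?R3)" by simp
    qed
    then have "(tri (wt s1 b1 f) (wt s2 b2 g) (wt s0 0 h))\<^sup>2 \<le> (3 * max ?R1 (max ?R2 ?R3))\<^sup>2"
      by (intro power_mono) auto
    also have "\<dots> = 9 * (max ?R1 (max ?R2 ?R3))\<^sup>2" by (simp add: power_mult_distrib)
    also have "\<dots> \<le> 9 * ((ennreal C)\<^sup>2 * ?Z)"
    proof (rule mult_left_mono)
      show "(max ?R1 (max ?R2 ?R3))\<^sup>2 \<le> (ennreal C)\<^sup>2 * ?Z"
        using 1 2 3 unfolding max_def by presburger
    qed simp
    also have "\<dots> = (ennreal (3 * C))\<^sup>2 * ?Z"
    proof -
      have "ennreal (3 * C) = 3 * ennreal C" using C by (subst ennreal_mult) auto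
      then show ?thesis by (simp add: power_mult_distrib mult.assoc)
    qed
    finally show "(tri (wt s1 b1 f) (wt s2 b2 g) (wt s0 0 h))\<^sup>2 \<le> (ennreal (3 * C))\<^sup>2 * ?Z" .
  qed
qed

text \<open>Brackets are at least 1, so smaller exponents mean larger inverse weights. This carries
  an estimate over to all larger exponents \<open>b1\<close> and \<open>b2\<close>.\<close>

lemma wt_mono:
  assumes "b' \<le> b" "s' \<le> s"
  shows "wt s b f q \<le> wt s' b' f q"
  unfolding wt_def using assms jbr_ge
  by (intro mult_right_mono ennreal_leI mult_mono powr_mono) auto

section \<open>The Fourier transform of Schwartz functions\<close>

lemma cis_measurable [measurable]: "cis \<in> borel_measurable borel"
  by (intro borel_measurable_continuous_onI continuous_intros)

lemma integral_lborel_translate: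
  fixes f :: "'a::euclidean_space \<Rightarrow> complex"
  assumes [measurable]: "f \<in> borel_measurable borel"
  shows "(LINT x|lborel. f (c + x)) = (LINT x|lborel. f x)"
  by (subst (2) lborel_distr_plus[symmetric, of c]) (simp add: integral_distr)

lemma integrable_lborel_translate:
  fixes f :: "'a::euclidean_space \<Rightarrow> complex"
  assumes f: "integrable lborel f"
  shows "integrable lborel (\<lambda>x. f (c + x))"
proof -
  have [measurable]: "f \<in> borel_measurable borel" using f by auto
  have "integrable (distr lborel borel ((+) c)) f" using f by (simp add: lborel_distr_plus)
  then show ?thesis by (simp add: integrable_distr_eq)
qed

lemma integral_lborel_scale:
  fixes f :: "'a::euclidean_space \<Rightarrow> complex"
  assumes [measurable]: "f \<in> borel_measurable borel" and c: "c \<noteq> 0"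
  shows "(LINT x|lborel. f x) = \<bar>c\<bar> ^ DIM('a) *\<^sub>R (LINT x|lborel. f (t + c *\<^sub>R x))"
proof -
  have "(LINT x|lborel. f x) = (LINT x|density (distr lborel borel (\<lambda>x. t + c *\<^sub>R x)) (\<lambda>_. ennreal (\<bar>c\<bar> ^ DIM('a))). f x)"
    using lborel_affine[OF c, of t] by simp
  also have "\<dots> = (LINT x|distr lborel borel (\<lambda>x. t + c *\<^sub>R x). \<bar>c\<bar> ^ DIM('a) *\<^sub>R f x)"
    by (subst integral_density) auto
  also have "\<dots> = \<bar>c\<bar> ^ DIM('a) *\<^sub>R (LINT x|lborel. f (t + c *\<^sub>R x))"
    by (subst integral_distr) auto
  finally show ?thesis .
qed

lemma integrable_pair_lborelI:
  fixes f :: "'a::euclidean_space \<Rightarrow> 'b::euclidean_space \<Rightarrow> complex"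
  assumes [measurable]: "case_prod f \<in> borel_measurable (lborel \<Otimes>\<^sub>M lborel)"
    and fin: "(\<integral>\<^sup>+x. \<integral>\<^sup>+y. ennreal (cmod (f x y)) \<partial>lborel \<partial>lborel) < \<infinity>"
  shows "integrable (lborel \<Otimes>\<^sub>M lborel) (case_prod f)"
proof (rule integrableI_bounded)
  have "(\<integral>\<^sup>+x. \<integral>\<^sup>+y. ennreal (cmod (f x y)) \<partial>lborel \<partial>lborel) = (\<integral>\<^sup>+p. ennreal (cmod (case_prod f p)) \<partial>(lborel \<Otimes>\<^sub>M lborel))"
    using lborel.nn_integral_fst[of "\<lambda>p. ennreal (cmod (case_prod f p))" lborel] by simp
  then show "(\<integral>\<^sup>+p. ennreal (cmod (case_prod f p)) \<partial>(lborel \<Otimes>\<^sub>M lborel)) < \<infinity>" using fin by simp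
qed measurable

text \<open>The difference \<open>g (x + v) - g x\<close> is the integral of \<open>g'\<close> along
  a segment. Its integral over all \<open>x\<close> vanishes by translation invariance, and after
  exchanging the integrals it is also the integral of \<open>g'\<close>. No boundary terms arise,
  and integrability is the only decay required.\<close>

lemma integral_directional_derivative_eq_0:
  fixes g g' :: "'a::euclidean_space \<Rightarrow> complex"
  assumes g: "integrable lborel g" and g': "integrable lborel g'"
    and cont: "continuous_on UNIV g'"
    and deriv: "\<And>x t. ((\<lambda>t. g (x + t *\<^sub>R v)) has_vector_derivative g' (x + t *\<^sub>R v)) (at t)"
  shows "(LINT x|lborel. g' x) = 0"
proof -
  have [measurable]: "g \<in> borel_measurable borel" "g' \<in> borel_measurable borel" using g g' by auto
  define f where "f x t = indicat_real {0..1} t *\<^sub>R g' (x + t *\<^sub>R v)" for x t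
  have inner: "(LINT t|lborel. f x t) = g (v + x) - g x" for x
  proof -
    have "(LINT t|lborel. f x t) = g (x + 1 *\<^sub>R v) - g (x + 0 *\<^sub>R v)"
      unfolding f_def
    proof (rule integral_FTC_atLeastAtMost)
      show "continuous_on {0..1} (\<lambda>t. g' (x + t *\<^sub>R v))"
        by (rule continuous_on_compose2[OF cont]) (auto intro!: continuous_intros)
    qed (auto intro: has_vector_derivative_at_within deriv)
    then show ?thesis by (simp add: add.commute)
  qed
  have int: "integrable (lborel \<Otimes>\<^sub>M lborel) (case_prod f)"
  proof (rule integrable_pair_lborelI)
    show "case_prod f \<in> borel_measurable (lborel \<Otimes>\<^sub>M lborel)" unfolding f_def by measurable
    have "(\<integral>\<^sup>+x. \<integral>\<^sup>+t. ennreal (cmod (f x t)) \<partial>lborel \<partial>lborel) = (\<integral>\<^sup>+t. \<integral>\<^sup>+x. ennreal (cmod (f x t)) \<partial>lborel \<partial>lborel)"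
      unfolding f_def by (rule lborel_pair.Fubini') measurable
    also have "\<dots> = (\<integral>\<^sup>+t. (\<integral>\<^sup>+x. ennreal (cmod (g' x)) \<partial>lborel) * indicator {0..1::real} t \<partial>lborel)"
    proof (rule nn_integral_cong)
      fix t :: real
      have "(\<integral>\<^sup>+x. ennreal (cmod (f x t)) \<partial>lborel) = (\<integral>\<^sup>+x. ennreal (cmod (g' (t *\<^sub>R v + x))) * indicator {0..1} t \<partial>lborel)"
        by (intro nn_integral_cong) (auto simp: f_def indicator_def add.commute)
      also have "\<dots> = (\<integral>\<^sup>+x. ennreal (cmod (g' (t *\<^sub>R v + x))) \<partial>lborel) * indicator {0..1} t"
        by (rule nn_integral_multc) measurable
      also have "(\<integral>\<^sup>+x. ennreal (cmod (g' (t *\<^sub>R v + x))) \<partial>lborel) = (\<integral>\<^sup>+x. ennreal (cmod (g' x)) \<partial>lborel)"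
        by (rule nn_integral_lborel_translate) measurable
      finally show "(\<integral>\<^sup>+x. ennreal (cmod (f x t)) \<partial>lborel) = (\<integral>\<^sup>+x. ennreal (cmod (g' x)) \<partial>lborel) * indicator {0..1} t" .
    qed
    also have "\<dots> = (\<integral>\<^sup>+x. ennreal (cmod (g' x)) \<partial>lborel)"
      by (subst nn_integral_cmult_indicator) auto
    also have "\<dots> < \<infinity>" using g' by (simp add: integrable_iff_bounded)
    finally show "(\<integral>\<^sup>+x. \<integral>\<^sup>+t. ennreal (cmod (f x t)) \<partial>lborel \<partial>lborel) < \<infinity>" .
  qed
  have "(LINT t|lborel. LINT x|lborel. f x t) = (LINT x|lborel. LINT t|lborel. f x t)"
    by (rule lborel_pair.Fubini_integral[OF int])
  also have "\<dots> = (LINT x|lborel. g (v + x) - g x)" by (simp only: inner)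
  also have "\<dots> = 0"
    using g integrable_lborel_translate[OF g, of v] by (subst Bochner_Integration.integral_diff) (auto simp: integral_lborel_translate)
  finally have "(LINT t|lborel. LINT x|lborel. f x t) = 0" .
  moreover have "(LINT x|lborel. f x t) = indicat_real {0..1} t *\<^sub>R (LINT x|lborel. g' x)" for t
  proof -
    have "(LINT x|lborel. f x t) = indicat_real {0..1} t *\<^sub>R (LINT x|lborel. g' (t *\<^sub>R v + x))"
      unfolding f_def by (simp add: add.commute)
    then show ?thesis by (simp add: integral_lborel_translate)
  qed
  ultimately have "(LINT t|lborel. indicat_real {0..1::real} t *\<^sub>R (LINT x|lborel. g' x)) = 0" by simp
  then show ?thesis by (subst (asm) integral_scaleR_left) (auto simp: integrable_indicator_iff content_real)
qed

lemma decay_of_moments: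
  fixes f :: "'a::real_normed_vector \<Rightarrow> complex"
  assumes "\<And>k::nat. \<exists>C. \<forall>x. norm x ^ k * cmod (f x) \<le> C"
  shows "\<exists>C>0. \<forall>x. cmod (f x) \<le> C / (1 + norm x) ^ k"
proof -
  obtain C0 where C0: "\<And>x. norm x ^ 0 * cmod (f x) \<le> C0" using assms[of 0] by auto
  obtain C1 where C1: "\<And>x. norm x ^ k * cmod (f x) \<le> C1" using assms[of k] by auto
  define C where "C = 2 ^ k * (\<bar>C0\<bar> + \<bar>C1\<bar> + 1)"
  have "cmod (f x) \<le> C / (1 + norm x) ^ k" for x
  proof -
    have "(1 + norm x) ^ k \<le> (2 * max 1 (norm x)) ^ k" by (intro power_mono) auto
    also have "\<dots> = 2 ^ k * max 1 (norm x) ^ k" by (simp add: power_mult_distrib)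
    also have "\<dots> \<le> 2 ^ k * (1 + norm x ^ k)" by (intro mult_left_mono) (auto simp: max_def)
    finally have "(1 + norm x) ^ k * cmod (f x) \<le> 2 ^ k * (1 + norm x ^ k) * cmod (f x)"
      by (intro mult_right_mono) auto
    also have "\<dots> = 2 ^ k * (cmod (f x) + norm x ^ k * cmod (f x))" by (simp add: algebra_simps)
    also have "\<dots> \<le> C" unfolding C_def using C0[of x] C1[of x] by (intro mult_left_mono) auto
    moreover have "0 < (1 + norm x) ^ k" by (intro zero_less_power add_pos_nonneg) auto
    ultimately show ?thesis by (simp add: le_divide_eq mult.commute)
  qed
  moreover have "0 < C" by (simp add: C_def)
  ultimately show ?thesis by blast
qed

text \<open>The function is dominated by the sum over \<open>n\<close> of
  \<open>1 / (n + 1) ^ (d + 2)\<close> on the ball of radius \<open>n + 1\<close>, where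
  \<open>d\<close> is the dimension. The volume of that ball leaves the convergent series of
  \<open>1 / (n + 1)^2\<close>.\<close>

lemma integrable_decay:
  "integrable lborel (\<lambda>x::'a::euclidean_space. 1 / (1 + norm x) ^ (DIM('a) + 2))"
proof (rule integrableI_bounded)
  let ?d = "DIM('a)"
  let ?V = "unit_ball_vol (real ?d)"
  have "(\<integral>\<^sup>+x. ennreal (norm (1 / (1 + norm x) ^ (?d + 2))) \<partial>(lborel :: 'a measure)) \<le>
      (\<integral>\<^sup>+x. (\<Sum>n. ennreal (1 / real (n + 1) ^ (?d + 2)) * indicator (ball 0 (real (n + 1))) x) \<partial>(lborel :: 'a measure))"
  proof (rule nn_integral_mono)
    fix x :: 'a
    define n where "n = nat \<lfloor>norm x\<rfloor>"
    have n: "real n \<le> norm x" "norm x < real (n + 1)" unfolding n_def using norm_ge_zero[of x] by linarith+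
    have "ennreal (norm (1 / (1 + norm x) ^ (?d + 2))) \<le> ennreal (1 / real (n + 1) ^ (?d + 2))"
    proof (rule ennreal_leI)
      have "real (n + 1) ^ (?d + 2) \<le> (1 + norm x) ^ (?d + 2)" using n by (intro power_mono) auto
      then have "1 / (1 + norm x) ^ (?d + 2) \<le> 1 / real (n + 1) ^ (?d + 2)" by (intro divide_left_mono) (auto intro!: mult_pos_pos zero_less_power add_pos_nonneg)
      then show "norm (1 / (1 + norm x) ^ (?d + 2)) \<le> 1 / real (n + 1) ^ (?d + 2)" by simp
    qed
    also have "\<dots> = (\<Sum>m\<in>{n}. ennreal (1 / real (m + 1) ^ (?d + 2)) * indicator (ball 0 (real (m + 1))) x)"
      using n by simp
    also have "\<dots> \<le> (\<Sum>n. ennreal (1 / real (n + 1) ^ (?d + 2)) * indicator (ball 0 (real (n + 1))) x)"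
      by (rule sum_le_suminf) auto
    finally show "ennreal (norm (1 / (1 + norm x) ^ (?d + 2))) \<le> \<dots>" .
  qed
  also have "\<dots> = (\<Sum>n. ennreal (1 / real (n + 1) ^ (?d + 2)) * emeasure lborel (ball (0::'a) (real (n + 1))))"
  proof -
    have "(\<lambda>x. ennreal (1 / real (n + 1) ^ (?d + 2)) * indicator (ball (0::'a) (real (n + 1))) x) \<in> borel_measurable lborel" for n
      by (intro borel_measurable_times_ennreal borel_measurable_const borel_measurable_indicator) simp
    then show ?thesis
      by (subst nn_integral_suminf) (simp_all only: nn_integral_cmult_indicator sets_lborel borel_open[OF open_ball])
  qed
  also have "\<dots> = (\<Sum>n. ennreal ?V * ennreal (1 / real (n + 1) ^ 2))"
  proof (rule arg_cong[where f = suminf], rule ext)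
    fix n
    have "ennreal (1 / real (n + 1) ^ (?d + 2)) * emeasure lborel (ball (0::'a) (real (n + 1))) =
        ennreal (1 / real (n + 1) ^ (?d + 2) * (?V * real (n + 1) ^ ?d))"
    proof -
      have eb: "emeasure lborel (ball (0::'a) (real (n + 1))) = ennreal (?V * real (n + 1) ^ ?d)"
        by (rule emeasure_ball) simp
      show ?thesis unfolding eb by (rule ennreal_mult[symmetric]) auto
    qed
    also have "1 / real (n + 1) ^ (?d + 2) * (?V * real (n + 1) ^ ?d) = ?V * (1 / real (n + 1) ^ 2)"
    proof -
      have "1 / x ^ (?d + 2) * (?V * x ^ ?d) = ?V * (1 / x ^ 2)" if "0 < x" for x :: real
        using that by (simp add: power_add power2_eq_square)
      from this[of "real (n + 1)"] show ?thesis by simp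
    qed
    also have "ennreal \<dots> = ennreal ?V * ennreal (1 / real (n + 1) ^ 2)" by (intro ennreal_mult) auto
    finally show "ennreal (1 / real (n + 1) ^ (?d + 2)) * emeasure lborel (ball (0::'a) (real (n + 1))) = \<dots>" .
  qed
  also have "\<dots> = ennreal ?V * ennreal (pi\<^sup>2 / 6)"
  proof -
    have "(\<Sum>n. ennreal (1 / real (n + 1) ^ 2)) = ennreal (pi\<^sup>2 / 6)"
      using inverse_squares_sums by (intro suminf_ennreal_eq) auto
    then show ?thesis by simp
  qed
  also have "\<dots> < \<infinity>" by (simp add: ennreal_mult_less_top)
  finally show "(\<integral>\<^sup>+x. ennreal (norm (1 / (1 + norm x) ^ (?d + 2))) \<partial>(lborel :: 'a measure)) < \<infinity>" .
qed measurable

section \<open>Schwartz functions and the decay of their transforms\<close>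

lemma pderivs_append: "pderivs (xs @ ys) f = pderivs xs (pderivs ys f)"
  by (induction xs) auto

lemma schwartz_pderivs:
  assumes "schwartz f" "set ds \<subseteq> Basis"
  shows "schwartz (pderivs ds f)"
  using assms unfolding schwartz_def by (auto simp: pderivs_append[symmetric])

lemma schwartz_differentiable: "schwartz f \<Longrightarrow> f differentiable (at x)"
  unfolding schwartz_def by (metis bot.extremum list.set(1) pderivs.simps(1))

lemma schwartz_continuous: "schwartz f \<Longrightarrow> continuous_on UNIV f"
  by (intro continuous_at_imp_continuous_on) (auto intro: differentiable_imp_continuous_within schwartz_differentiable)

lemma schwartz_measurable: "schwartz f \<Longrightarrow> f \<in> borel_measurable borel"
  by (intro borel_measurable_continuous_onI schwartz_continuous)

lemma schwartz_decay:
  assumes "schwartz f"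
  shows "\<exists>C>0. \<forall>x. cmod (f x) \<le> C / (1 + norm x) ^ k"
proof (rule decay_of_moments)
  show "\<exists>C. \<forall>x. norm x ^ k * cmod (f x) \<le> C" for k
    using assms unfolding schwartz_def by (metis bot.extremum list.set(1) pderivs.simps(1))
qed

lemma integrable_of_decay:
  fixes f :: "'a::euclidean_space \<Rightarrow> complex"
  assumes [measurable]: "f \<in> borel_measurable borel"
    and "\<And>x. cmod (f x) \<le> C / (1 + norm x) ^ (DIM('a) + 2)"
  shows "integrable lborel f"
proof (rule Bochner_Integration.integrable_bound)
  show "integrable lborel (\<lambda>x::'a. C * (1 / (1 + norm x) ^ (DIM('a) + 2)))"
    by (intro integrable_mult_right integrable_decay)
  show "AE x in lborel. cmod (f x) \<le> norm (C * (1 / (1 + norm x) ^ (DIM('a) + 2)))"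
  proof (rule AE_I2)
    fix x
    have "cmod (f x) \<le> C / (1 + norm x) ^ (DIM('a) + 2)" by (rule assms(2))
    also have "\<dots> = C * (1 / (1 + norm x) ^ (DIM('a) + 2))" by (simp only: times_divide_eq_right mult_1_right)
    also have "\<dots> \<le> norm (C * (1 / (1 + norm x) ^ (DIM('a) + 2)))" unfolding real_norm_def by (rule abs_ge_self)
    finally show "cmod (f x) \<le> \<dots>" .
  qed
qed simp

lemma schwartz_integrable:
  fixes f :: "'a::euclidean_space \<Rightarrow> complex"
  assumes "schwartz f" shows "integrable lborel f"
proof -
  obtain C where "\<And>x. cmod (f x) \<le> C / (1 + norm x) ^ (DIM('a) + 2)"
    using schwartz_decay[OF assms, of "DIM('a) + 2"] by blast
  with schwartz_measurable[OF assms] show ?thesis by (rule integrable_of_decay)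
qed

lemma fourier_measurable [measurable]:
  assumes [measurable]: "u \<in> borel_measurable borel"
  shows "fourier u \<in> borel_measurable borel"
  unfolding fourier_def by measurable

lemma integrable_cis_mult:
  fixes u :: "'a::euclidean_space \<Rightarrow> complex"
  assumes "integrable lborel u" and [measurable]: "a \<in> borel_measurable borel"
  shows "integrable lborel (\<lambda>q. cis (a q) * u q)"
proof (rule Bochner_Integration.integrable_bound[OF assms(1)])
  have [measurable]: "u \<in> borel_measurable borel" using assms(1) by auto
  show "(\<lambda>q. cis (a q) * u q) \<in> borel_measurable lborel" by measurable
qed (simp add: norm_mult)

lemma fourier_bound:
  assumes "integrable lborel u"
  shows "cmod (fourier u p) \<le> (LINT q|lborel. cmod (u q))"
proof -
  have "cmod (fourier u p) \<le> (LINT q|lborel. cmod (cis (- (q \<bullet> p)) * u q))"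
    unfolding fourier_def by (rule integral_norm_bound)
  then show ?thesis by (simp add: norm_mult)
qed

text \<open>Integration by parts: the derivative in direction \<open>v\<close> of the product of
  \<open>u\<close> and the character has integral zero.\<close>

lemma fourier_pderiv:
  assumes u: "schwartz u" and v: "v \<in> Basis"
  shows "fourier (pderivs [v] u) p = \<i> * complex_of_real (v \<bullet> p) * fourier u p"
proof -
  let ?u' = "pderivs [v] u"
  have u': "schwartz ?u'" using schwartz_pderivs[OF u, of "[v]"] v by simp
  define e where "e q = cis (- (q \<bullet> p))" for q
  define g where "g q = e q * u q" for q
  define g' where "g' q = e q * ?u' q - \<i> * complex_of_real (v \<bullet> p) * (e q * u q)" for q
  have i1: "integrable lborel (\<lambda>q. e q * u q)" unfolding e_def
    by (rule integrable_cis_mult[OF schwartz_integrable[OF u]]) measurable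
  have i2: "integrable lborel (\<lambda>q. e q * ?u' q)" unfolding e_def
    by (rule integrable_cis_mult[OF schwartz_integrable[OF u']]) measurable
  have "(LINT x|lborel. g' x) = 0"
  proof (rule integral_directional_derivative_eq_0)
    show "integrable lborel g" unfolding g_def by (rule i1)
    show "integrable lborel g'" unfolding g'_def using i1 i2 by (intro Bochner_Integration.integrable_diff integrable_mult_right)
    show "continuous_on UNIV g'" unfolding g'_def e_def
      by (intro continuous_intros schwartz_continuous u u')
    fix x t
    have du: "((\<lambda>t. u (x + t *\<^sub>R v)) has_vector_derivative ?u' (x + t *\<^sub>R v)) (at t)"
    proof -
      let ?D = "frechet_derivative u (at (x + t *\<^sub>R v))"
      have D: "(u has_derivative ?D) (at (x + t *\<^sub>R v))"
        using schwartz_differentiable[OF u] frechet_derivative_works by blast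
      have "((\<lambda>t. x + t *\<^sub>R v) has_derivative (\<lambda>h. h *\<^sub>R v)) (at t)"
        by (auto intro!: derivative_eq_intros)
      from has_derivative_compose[OF this D]
      have "((\<lambda>t. u (x + t *\<^sub>R v)) has_derivative (\<lambda>h. ?D (h *\<^sub>R v))) (at t)" .
      moreover have "?D (h *\<^sub>R v) = h *\<^sub>R ?D v" for h
        using has_derivative_linear[OF D] by (rule linear_scale)
      ultimately show ?thesis by (simp add: has_vector_derivative_def)
    qed
    have de: "((\<lambda>t. e (x + t *\<^sub>R v)) has_vector_derivative (- \<i> * complex_of_real (v \<bullet> p) * e (x + t *\<^sub>R v))) (at t)"
    proof -
      have "((\<lambda>t. - \<i> * complex_of_real ((x + t *\<^sub>R v) \<bullet> p)) has_vector_derivative (- \<i> * complex_of_real (v \<bullet> p))) (at t)"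
        by (auto intro!: derivative_eq_intros simp: inner_simps)
      from field_vector_diff_chain_at[OF this DERIV_exp]
      show ?thesis by (simp add: e_def cis_conv_exp o_def)
    qed
    have "((\<lambda>t. e (x + t *\<^sub>R v) * u (x + t *\<^sub>R v)) has_vector_derivative
        (e (x + t *\<^sub>R v) * ?u' (x + t *\<^sub>R v) + (- \<i> * complex_of_real (v \<bullet> p) * e (x + t *\<^sub>R v)) * u (x + t *\<^sub>R v))) (at t)"
      by (rule has_vector_derivative_mult[OF de du])
    then show "((\<lambda>t. g (x + t *\<^sub>R v)) has_vector_derivative g' (x + t *\<^sub>R v)) (at t)"
      by (simp add: g_def g'_def algebra_simps)
  qed
  moreover have "(LINT x|lborel. g' x) = fourier ?u' p - \<i> * complex_of_real (v \<bullet> p) * fourier u p"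
    unfolding g'_def fourier_def e_def[symmetric] using i1 i2
    by (subst Bochner_Integration.integral_diff) auto
  ultimately show ?thesis by simp
qed

lemma fourier_pderivs_replicate:
  assumes u: "schwartz u" and v: "v \<in> Basis"
  shows "fourier (pderivs (replicate k v) u) p = (\<i> * complex_of_real (v \<bullet> p)) ^ k * fourier u p"
proof (induction k)
  case (Suc k)
  have "schwartz (pderivs (replicate k v) u)" by (rule schwartz_pderivs[OF u]) (use v in auto)
  from fourier_pderiv[OF this v, of p] show ?case by (simp add: Suc mult_ac)
qed simp

text \<open>For each \<open>p\<close> take the coordinate direction \<open>v\<close> in which
  \<open>p\<close> is largest; \<open>norm p\<close> is then at most \<open>DIM('a)\<close> times
  \<open>\<bar>p \<bullet> v\<bar>\<close>, and \<open>k\<close> derivatives along this single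
  \<open>v\<close> control the moment.\<close>

lemma fourier_decay:
  fixes u :: "'a::euclidean_space \<Rightarrow> complex"
  assumes u: "schwartz u"
  shows "\<exists>C>0. \<forall>p. cmod (fourier u p) \<le> C / (1 + norm p) ^ k"
proof (rule decay_of_moments)
  fix k
  define B where "B v = (LINT q|lborel. cmod (pderivs (replicate k v) u q))" for v :: 'a
  have B: "\<bar>p \<bullet> v\<bar> ^ k * cmod (fourier u p) \<le> B v" if v: "v \<in> Basis" for v p
  proof -
    have "integrable lborel (pderivs (replicate k v) u)"
      by (intro schwartz_integrable schwartz_pderivs u) (use v in auto)
    from fourier_bound[OF this, of p] show ?thesis
      by (simp add: fourier_pderivs_replicate[OF u v] norm_mult norm_power B_def inner_commute)
  qed
  have B0: "0 \<le> B v" for v unfolding B_def by simp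
  have "norm p ^ k * cmod (fourier u p) \<le> real DIM('a) ^ k * (\<Sum>v\<in>Basis. B v)" for p
  proof -
    have "\<exists>v\<in>Basis. \<forall>w\<in>Basis. \<bar>p \<bullet> w\<bar> \<le> \<bar>p \<bullet> v\<bar>"
    proof -
      have f: "finite ((\<lambda>v. \<bar>p \<bullet> v\<bar>) ` (Basis :: 'a set))" "(\<lambda>v. \<bar>p \<bullet> v\<bar>) ` (Basis :: 'a set) \<noteq> {}" by auto
      from Max_in[OF f] obtain v where v: "Max ((\<lambda>v. \<bar>p \<bullet> v\<bar>) ` Basis) = \<bar>p \<bullet> v\<bar>" "v \<in> Basis" by (rule imageE)
      then show ?thesis using Max_ge[OF f(1)] by (intro bexI[of _ v]) auto
    qed
    then obtain v where v: "v \<in> Basis" "\<And>w. w \<in> Basis \<Longrightarrow> \<bar>p \<bullet> w\<bar> \<le> \<bar>p \<bullet> v\<bar>" by blast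
    have "norm p \<le> (\<Sum>w\<in>Basis. \<bar>p \<bullet> w\<bar>)" by (rule norm_le_l1)
    also have "\<dots> \<le> real DIM('a) * \<bar>p \<bullet> v\<bar>" using v(2) by (rule sum_bounded_above)
    finally have "norm p ^ k \<le> (real DIM('a) * \<bar>p \<bullet> v\<bar>) ^ k" by (intro power_mono) auto
    then have "norm p ^ k * cmod (fourier u p) \<le> (real DIM('a) * \<bar>p \<bullet> v\<bar>) ^ k * cmod (fourier u p)" by (intro mult_right_mono) auto
    also have "\<dots> = real DIM('a) ^ k * (\<bar>p \<bullet> v\<bar> ^ k * cmod (fourier u p))" by (simp add: power_mult_distrib mult.assoc)
    also have "\<dots> \<le> real DIM('a) ^ k * (\<Sum>v\<in>Basis. B v)"
    proof (rule mult_left_mono)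
      have "B v \<le> (\<Sum>v\<in>Basis. B v)" using v(1) B0 by (intro member_le_sum) auto
      then show "\<bar>p \<bullet> v\<bar> ^ k * cmod (fourier u p) \<le> (\<Sum>v\<in>Basis. B v)" using B[OF v(1), of p] by linarith
    qed simp
    finally show ?thesis .
  qed
  then show "\<exists>C. \<forall>x. norm x ^ k * cmod (fourier u x) \<le> C" by blast
qed

lemma fourier_integrable:
  fixes u :: "'a::euclidean_space \<Rightarrow> complex"
  assumes "schwartz u" shows "integrable lborel (fourier u)"
proof -
  obtain C where "\<And>x. cmod (fourier u x) \<le> C / (1 + norm x) ^ (DIM('a) + 2)"
    using fourier_decay[OF assms, of "DIM('a) + 2"] by blast
  with fourier_measurable[OF schwartz_measurable[OF assms]] show ?thesis by (rule integrable_of_decay)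
qed

section \<open>Gaussian regularization and Fourier inversion\<close>

definition gauss :: "'a::euclidean_space \<Rightarrow> complex" where
  "gauss q = complex_of_real (exp (- (norm q)\<^sup>2 / 2))"

lemma gauss_measurable [measurable]: "gauss \<in> borel_measurable borel"
  unfolding gauss_def by measurable

lemma cmod_gauss: "cmod (gauss q) = exp (- (norm q)\<^sup>2 / 2)" "cmod (gauss q) \<le> 1"
  by (simp_all add: gauss_def)

text \<open>Up to normalization this is the characteristic function of the standard normal
  distribution.\<close>

lemma gauss_real_fourier:
  fixes s :: real
  shows "integrable lborel (\<lambda>x. cis (- (s * x)) * complex_of_real (exp (- x\<^sup>2 / 2)))"
    and "(LINT x|lborel. cis (- (s * x)) * complex_of_real (exp (- x\<^sup>2 / 2))) = complex_of_real (sqrt (2 * pi) * exp (- s\<^sup>2 / 2))"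
proof -
  have e: "complex_of_real (exp (- x\<^sup>2 / 2)) = complex_of_real (sqrt (2 * pi)) * complex_of_real (std_normal_density x)" for x :: real
    by (simp add: std_normal_density_def)
  show "integrable lborel (\<lambda>x. cis (- (s * x)) * complex_of_real (exp (- x\<^sup>2 / 2)))"
    unfolding e
    by (rule integrable_cis_mult, intro integrable_mult_right integrable_of_real integrable_normal_density) auto
  have "complex_of_real (exp (- (- s)\<^sup>2 / 2)) = char std_normal_distribution (- s)"
    by (simp add: char_std_normal_distribution)
  also have "\<dots> = (LINT x|lborel. std_normal_density x *\<^sub>R iexp (- s * x))"
    unfolding char_def by (subst integral_density) auto
  finally have eq: "complex_of_real (exp (- s\<^sup>2 / 2)) = (LINT x|lborel. std_normal_density x *\<^sub>R iexp (- s * x))"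
    by (simp only: power2_minus)
  have "complex_of_real (sqrt (2 * pi)) * complex_of_real (exp (- s\<^sup>2 / 2)) =
      (LINT x|lborel. complex_of_real (sqrt (2 * pi)) * (std_normal_density x *\<^sub>R iexp (- s * x)))"
    unfolding eq by (rule integral_mult_right_zero[symmetric])
  also have "\<dots> = (LINT x|lborel. cis (- (s * x)) * complex_of_real (exp (- x\<^sup>2 / 2)))"
    unfolding e by (intro Bochner_Integration.integral_cong) (auto simp: cis_conv_exp scaleR_conv_of_real)
  finally show "(LINT x|lborel. cis (- (s * x)) * complex_of_real (exp (- x\<^sup>2 / 2))) = complex_of_real (sqrt (2 * pi) * exp (- s\<^sup>2 / 2))"
    by simp
qed

lemma gauss_eq_exp_sum: "gauss q = exp (\<Sum>b\<in>Basis. complex_of_real (- (q \<bullet> b)\<^sup>2 / 2))"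
proof -
  have r: "- (norm q)\<^sup>2 / 2 = (\<Sum>b\<in>Basis. - (q \<bullet> b)\<^sup>2 / 2)"
    unfolding power2_norm_eq_inner
    by (subst euclidean_inner) (simp add: power2_eq_square sum_divide_distrib sum_negf)
  show ?thesis unfolding gauss_def r exp_of_real[symmetric] of_real_sum ..
qed

text \<open>The character and the Gaussian are both products over the coordinates, so the integral
  is a product of one-dimensional ones.\<close>

lemma gauss_fourier:
  fixes z :: "'a::euclidean_space"
  shows "integrable lborel (\<lambda>q::'a. cis (- (z \<bullet> q)) * gauss q)"
    and "(LINT q|lborel. cis (- (z \<bullet> q)) * gauss q) = complex_of_real (sqrt (2 * pi) ^ DIM('a)) * gauss z"
proof -
  interpret product_sigma_finite "\<lambda>_::'a. lborel :: real measure" ..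
  define f where "f b x = cis (- ((z \<bullet> b) * x)) * complex_of_real (exp (- x\<^sup>2 / 2))" for b :: 'a and x :: real
  have fm [measurable]: "f b \<in> borel_measurable borel" for b unfolding f_def by measurable
  have fi: "integrable lborel (f b)" for b unfolding f_def by (rule gauss_real_fourier)
  have split: "cis (- (z \<bullet> q)) * gauss q = (\<Prod>b\<in>Basis. f b (q \<bullet> b))" for q :: 'a
  proof -
    have "cis (- (z \<bullet> q)) = exp (\<Sum>b\<in>Basis. - \<i> * complex_of_real ((z \<bullet> b) * (q \<bullet> b)))"
      by (simp add: cis_conv_exp euclidean_inner[of z q] sum_distrib_left sum_negf)
    then show ?thesis
      by (simp only: gauss_eq_exp_sum exp_sum[OF finite_Basis] f_def prod.distrib[symmetric] cis_conv_exp exp_of_real[symmetric])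
        (simp add: mult_ac)
  qed
  have m: "(\<lambda>x. \<Sum>b\<in>Basis. x b *\<^sub>R b) \<in> (\<Pi>\<^sub>M b\<in>Basis. lborel) \<rightarrow>\<^sub>M (borel :: 'a measure)" by measurable
  have comp: "(\<Sum>c\<in>Basis. x c *\<^sub>R c) \<bullet> b = x b" if "b \<in> Basis" for x and b :: 'a
    using that by (simp add: inner_sum_left inner_Basis if_distrib cong: if_cong)
  have "integrable (\<Pi>\<^sub>M b\<in>Basis. lborel) (\<lambda>x. \<Prod>b\<in>Basis. f b (x b))"
    by (rule product_integrable_prod) (auto intro: fi)
  then show "integrable lborel (\<lambda>q::'a. cis (- (z \<bullet> q)) * gauss q)"
    unfolding split by (subst lborel_eq, subst integrable_distr_eq[OF m]) (auto simp: comp cong: prod.cong)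
  have "(LINT q|lborel. cis (- (z \<bullet> q)) * gauss q) = (LINT x|Pi\<^sub>M Basis (\<lambda>_. lborel). (\<Prod>b\<in>Basis. f b (x b)))"
    unfolding split by (subst lborel_eq, subst integral_distr[OF m]) (auto simp: comp cong: prod.cong)
  also have "\<dots> = (\<Prod>b\<in>Basis. (LINT x|lborel. f b x))"
    by (rule product_integral_prod) (auto intro: fi)
  also have "\<dots> = (\<Prod>b\<in>Basis. complex_of_real (sqrt (2 * pi) * exp (- (z \<bullet> b)\<^sup>2 / 2)))"
    unfolding f_def gauss_real_fourier(2) ..
  also have "\<dots> = complex_of_real (sqrt (2 * pi) ^ DIM('a)) * gauss z"
    by (simp only: gauss_eq_exp_sum exp_sum[OF finite_Basis] of_real_mult prod.distrib prod_constant of_real_power exp_of_real)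
  finally show "(LINT q|lborel. cis (- (z \<bullet> q)) * gauss q) = complex_of_real (sqrt (2 * pi) ^ DIM('a)) * gauss z" .
qed

lemma gauss_integrable: "integrable lborel (gauss :: 'a::euclidean_space \<Rightarrow> complex)"
  and gauss_integral: "(LINT q|lborel. gauss (q :: 'a)) = complex_of_real (sqrt (2 * pi) ^ DIM('a))"
proof -
  have "gauss (0 :: 'a) = 1" by (simp add: gauss_def)
  then show "integrable lborel (gauss :: 'a \<Rightarrow> complex)"
    "(LINT q|lborel. gauss (q :: 'a)) = complex_of_real (sqrt (2 * pi) ^ DIM('a))"
    using gauss_fourier[of "0 :: 'a"] by simp_all
qed

lemma gauss_tendsto: "(\<lambda>n. gauss ((q :: 'a::euclidean_space) /\<^sub>R real (Suc n))) \<longlonglongrightarrow> 1"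
proof -
  have A: "(\<lambda>n. inverse (real (Suc n)) *\<^sub>R q) \<longlonglongrightarrow> 0"
    using tendsto_scaleR[OF LIMSEQ_inverse_real_of_nat tendsto_const[of q]] by (simp only: scaleR_zero_left)
  have "isCont gauss (0 :: 'a)" unfolding gauss_def by (auto intro!: continuous_intros)
  from isCont_tendsto_compose[OF this A] have "(\<lambda>n. gauss (q /\<^sub>R real (Suc n))) \<longlonglongrightarrow> gauss (0 :: 'a)" .
  moreover have "gauss (0 :: 'a) = 1" by (simp add: gauss_def)
  ultimately show ?thesis by (simp only:)
qed

text \<open>The Gaussian factor makes the double integral in \<open>q\<close> and \<open>x\<close>
  absolutely convergent, so the order can be exchanged. Rescaling by \<open>N\<close> then turns the
  transform of the wide Gaussian into an average of \<open>u\<close> near \<open>y\<close>.\<close>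

lemma gauss_regularized_inversion:
  fixes u :: "'a::euclidean_space \<Rightarrow> complex" and y :: 'a
  assumes u: "integrable lborel u" and N: "0 < N"
  defines "c \<equiv> complex_of_real (sqrt (2 * pi) ^ DIM('a))"
  shows "(LINT q|lborel. cis (q \<bullet> y) * fourier u q * gauss (q /\<^sub>R N)) = (LINT z|lborel. c * gauss z * u (y + (1 / N) *\<^sub>R z))"
proof -
  have um [measurable]: "u \<in> borel_measurable borel" using u by auto
  define f where "f q x = cis (- ((x - y) \<bullet> q)) * gauss (q /\<^sub>R N) * u x" for q x
  have gN: "integrable lborel (\<lambda>q::'a. cis (a q) * gauss (q /\<^sub>R N))" if [measurable]: "a \<in> borel_measurable borel" for a
  proof (rule integrable_cis_mult)
    have "integrable (distr lborel borel (\<lambda>x::'a. 0 + (1 / N) *\<^sub>R x)) gauss"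
    proof -
      have "integrable (density (distr lborel borel (\<lambda>x::'a. 0 + (1 / N) *\<^sub>R x)) (\<lambda>_. ennreal (\<bar>1 / N\<bar> ^ DIM('a)))) gauss"
        using gauss_integrable lborel_affine[of "1 / N" "0 :: 'a"] N by simp
      then have "integrable (distr lborel borel (\<lambda>x::'a. 0 + (1 / N) *\<^sub>R x)) (\<lambda>x. (1 / N) ^ DIM('a) *\<^sub>R gauss x)"
        using N by (subst (asm) integrable_density) auto
      from integrable_scaleR_right[OF this, of "N ^ DIM('a)"] show ?thesis
        using N by (simp add: power_one_over)
    qed
    then show "integrable lborel (\<lambda>q::'a. gauss (q /\<^sub>R N))"
      by (subst (asm) integrable_distr_eq) (auto simp: inverse_eq_divide)
  qed fact
  have int: "integrable (lborel \<Otimes>\<^sub>M lborel) (\<lambda>(x, q). f q x)"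
  proof (rule integrable_pair_lborelI)
    show "(\<lambda>(x, q). f q x) \<in> borel_measurable (lborel \<Otimes>\<^sub>M lborel)" unfolding f_def by measurable
    have "(\<integral>\<^sup>+x. \<integral>\<^sup>+q. ennreal (cmod (f q x)) \<partial>lborel \<partial>lborel) =
        (\<integral>\<^sup>+x. \<integral>\<^sup>+q. ennreal (cmod (gauss (q /\<^sub>R N))) * ennreal (cmod (u x)) \<partial>(lborel :: 'a measure) \<partial>lborel)"
      by (simp add: f_def norm_mult ennreal_mult)
    also have "\<dots> = (\<integral>\<^sup>+q. ennreal (cmod (gauss (q /\<^sub>R N))) \<partial>(lborel :: 'a measure)) * (\<integral>\<^sup>+x. ennreal (cmod (u x)) \<partial>lborel)"
      by (simp add: nn_integral_multc nn_integral_cmult)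
    also have "\<dots> < \<infinity>"
      using gN[of "\<lambda>_. 0"] u by (auto simp: integrable_iff_bounded ennreal_mult_less_top)
    finally show "(\<integral>\<^sup>+x. \<integral>\<^sup>+q. ennreal (cmod (f q x)) \<partial>lborel \<partial>lborel) < \<infinity>" .
  qed
  have cm: "cis (q \<bullet> y) * cis (- (x \<bullet> q)) = cis (- ((x - y) \<bullet> q))" for q x
    by (simp add: cis_mult inner_diff_left inner_diff_right inner_commute)
  have "(LINT q|lborel. cis (q \<bullet> y) * fourier u q * gauss (q /\<^sub>R N)) = (LINT q|lborel. LINT x|lborel. f q x)"
  proof (rule Bochner_Integration.integral_cong[OF refl])
    fix q
    have "cis (q \<bullet> y) * fourier u q * gauss (q /\<^sub>R N) = (cis (q \<bullet> y) * gauss (q /\<^sub>R N)) * fourier u q" by simp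
    also have "\<dots> = (LINT x|lborel. (cis (q \<bullet> y) * gauss (q /\<^sub>R N)) * (cis (- (x \<bullet> q)) * u x))"
      unfolding fourier_def by (rule integral_mult_right_zero[symmetric])
    also have "\<dots> = (LINT x|lborel. f q x)"
      by (intro Bochner_Integration.integral_cong) (simp_all add: f_def cm[symmetric] mult_ac)
    finally show "cis (q \<bullet> y) * fourier u q * gauss (q /\<^sub>R N) = (LINT x|lborel. f q x)" .
  qed
  also have "\<dots> = (LINT x|lborel. LINT q|lborel. f q x)"
    using lborel_pair.Fubini_integral[OF int] by simp
  also have "\<dots> = (LINT x|lborel. N ^ DIM('a) *\<^sub>R (c * gauss (N *\<^sub>R (x - y)) * u x))"
  proof (rule Bochner_Integration.integral_cong[OF refl])
    fix x
    have "(LINT q|lborel. f q x) = (LINT q|lborel. cis (- ((x - y) \<bullet> q)) * gauss (q /\<^sub>R N)) * u x"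
      unfolding f_def by (rule integral_mult_left_zero)
    also have "(LINT q|lborel. cis (- ((x - y) \<bullet> q)) * gauss (q /\<^sub>R N)) =
        \<bar>N\<bar> ^ DIM('a) *\<^sub>R (LINT q|lborel. cis (- ((x - y) \<bullet> (0 + N *\<^sub>R q))) * gauss ((0 + N *\<^sub>R q) /\<^sub>R N))"
      using N by (intro integral_lborel_scale) auto
    also have "\<dots> = N ^ DIM('a) *\<^sub>R (LINT q|lborel. cis (- ((N *\<^sub>R (x - y)) \<bullet> q)) * gauss q)"
      using N by (simp add: inner_simps)
    also have "\<dots> = N ^ DIM('a) *\<^sub>R (c * gauss (N *\<^sub>R (x - y)))"
      unfolding gauss_fourier(2) c_def ..
    finally show "(LINT q|lborel. f q x) = N ^ DIM('a) *\<^sub>R (c * gauss (N *\<^sub>R (x - y)) * u x)" by simp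
  qed
  also have "\<dots> = \<bar>1 / N\<bar> ^ DIM('a) *\<^sub>R
      (LINT z|lborel. N ^ DIM('a) *\<^sub>R (c * gauss (N *\<^sub>R ((y + (1 / N) *\<^sub>R z) - y)) * u (y + (1 / N) *\<^sub>R z)))"
    using N by (intro integral_lborel_scale) auto
  also have "\<dots> = (LINT z|lborel. c * gauss z * u (y + (1 / N) *\<^sub>R z))"
    using N by (simp add: power_one_over)
  finally show ?thesis .
qed

text \<open>Let \<open>N\<close> tend to infinity in the regularized formula:
  \<open>fourier u\<close> dominates on the left, a multiple of the Gaussian on the right. Of the
  two factors \<open>?c\<close>, one comes from transforming the Gaussian and the other from its
  integral.\<close>

lemma fourier_inversion:
  fixes u :: "'a::euclidean_space \<Rightarrow> complex"
  assumes u: "integrable lborel u" "integrable lborel (fourier u)" "continuous_on UNIV u" and B: "\<And>x. cmod (u x) \<le> B"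
  shows "(LINT q|lborel. cis (q \<bullet> y) * fourier u q) = complex_of_real ((2 * pi) ^ DIM('a)) * u y"
proof (rule LIMSEQ_unique)
  let ?N = "\<lambda>n. real (Suc n)"
  let ?c = "complex_of_real (sqrt (2 * pi) ^ DIM('a))"
  have [measurable]: "u \<in> borel_measurable borel" "fourier u \<in> borel_measurable borel" using u by auto
  show "(\<lambda>n. LINT q|lborel. cis (q \<bullet> y) * fourier u q * gauss (q /\<^sub>R ?N n)) \<longlonglongrightarrow> (LINT q|lborel. cis (q \<bullet> y) * fourier u q)"
  proof (rule integral_dominated_convergence)
    show "integrable lborel (\<lambda>q. cmod (fourier u q))" using u(2) by (rule integrable_norm)
    show "AE q in lborel. (\<lambda>n. cis (q \<bullet> y) * fourier u q * gauss (q /\<^sub>R ?N n)) \<longlonglongrightarrow> cis (q \<bullet> y) * fourier u q"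
      using tendsto_mult[OF tendsto_const gauss_tendsto] by (intro AE_I2) fastforce
    show "AE q in lborel. cmod (cis (q \<bullet> y) * fourier u q * gauss (q /\<^sub>R ?N n)) \<le> cmod (fourier u q)" for n
    proof (rule AE_I2)
      fix q :: 'a
      show "cmod (cis (q \<bullet> y) * fourier u q * gauss (q /\<^sub>R ?N n)) \<le> cmod (fourier u q)"
        using mult_left_le[OF cmod_gauss(2)[of "q /\<^sub>R ?N n"], of "cmod (fourier u q)"] by (simp add: norm_mult)
    qed
  qed measurable
  have eq: "(LINT q|lborel. cis (q \<bullet> y) * fourier u q * gauss (q /\<^sub>R ?N n)) = (LINT z|lborel. ?c * gauss z * u (y + (1 / ?N n) *\<^sub>R z))" for n
    by (rule gauss_regularized_inversion[OF u(1)]) simp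
  have lim: "(\<lambda>n. LINT z|lborel. ?c * gauss z * u (y + (1 / ?N n) *\<^sub>R z)) \<longlonglongrightarrow> (LINT z|lborel. ?c * gauss (z :: 'a) * u y)"
  proof (rule integral_dominated_convergence)
    show "integrable lborel (\<lambda>z::'a. cmod (?c * gauss z) * B)"
      by (intro integrable_mult_left integrable_norm integrable_mult_right gauss_integrable)
    show "AE z in lborel. (\<lambda>n. ?c * gauss z * u (y + (1 / ?N n) *\<^sub>R z)) \<longlonglongrightarrow> ?c * gauss z * u y"
    proof (rule AE_I2)
      fix z :: 'a
      have "(\<lambda>n. y + inverse (?N n) *\<^sub>R z) \<longlonglongrightarrow> y + 0 *\<^sub>R z"
        by (intro tendsto_intros LIMSEQ_inverse_real_of_nat)
      then have "(\<lambda>n. u (y + (1 / ?N n) *\<^sub>R z)) \<longlonglongrightarrow> u y"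
        using u(3) by (intro isCont_tendsto_compose[of y u]) (auto simp: continuous_on_eq_continuous_at inverse_eq_divide)
      then show "(\<lambda>n. ?c * gauss z * u (y + (1 / ?N n) *\<^sub>R z)) \<longlonglongrightarrow> ?c * gauss z * u y"
        by (intro tendsto_intros)
    qed
    show "AE z in lborel. cmod (?c * gauss z * u (y + (1 / ?N n) *\<^sub>R z)) \<le> cmod (?c * gauss z) * B" for n
      using B by (intro AE_I2) (simp only: norm_mult mult_left_mono mult_nonneg_nonneg norm_ge_zero)
  qed measurable
  have val: "(LINT z|lborel. ?c * gauss (z :: 'a) * u y) = complex_of_real ((2 * pi) ^ DIM('a)) * u y"
  proof -
    have "(LINT z|lborel. ?c * gauss (z :: 'a) * u y) = ?c * ?c * u y"
      by (simp add: gauss_integral)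
    also have "?c * ?c = complex_of_real ((2 * pi) ^ DIM('a))"
      by (simp only: of_real_mult[symmetric] power_mult_distrib[symmetric] real_sqrt_mult_self) simp
    finally show ?thesis .
  qed
  show "(\<lambda>n. LINT q|lborel. cis (q \<bullet> y) * fourier u q * gauss (q /\<^sub>R ?N n)) \<longlonglongrightarrow> complex_of_real ((2 * pi) ^ DIM('a)) * u y"
    unfolding eq val[symmetric] by (rule lim)
qed

text \<open>Only \<open>u\<close> is replaced by its inversion formula; after Fubini the inner
  integral is the transform of \<open>v\<close> at \<open>p - q\<close>.\<close>

lemma fourier_mult:
  fixes u v :: "'a::euclidean_space \<Rightarrow> complex"
  assumes u: "schwartz u" and v: "schwartz v"
  shows "complex_of_real ((2 * pi) ^ DIM('a)) * fourier (\<lambda>q. u q * v q) p = (LINT q|lborel. fourier u q * fourier v (p - q))"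
proof -
  have ui: "integrable lborel u" "integrable lborel (fourier u)" and vi: "integrable lborel v"
    using u v by (auto intro: schwartz_integrable fourier_integrable)
  have [measurable]: "u \<in> borel_measurable borel" "fourier u \<in> borel_measurable borel" "v \<in> borel_measurable borel"
    using ui vi by auto
  obtain B where B: "\<And>x. cmod (u x) \<le> B" using schwartz_decay[OF u, of 0] by auto
  define f where "f y q = fourier u q * (cis (- (y \<bullet> (p - q))) * v y)" for y q
  have int: "integrable (lborel \<Otimes>\<^sub>M lborel) (case_prod f)"
  proof (rule integrable_pair_lborelI)
    show "case_prod f \<in> borel_measurable (lborel \<Otimes>\<^sub>M lborel)" unfolding f_def by measurable
    have "(\<integral>\<^sup>+y. \<integral>\<^sup>+q. ennreal (cmod (f y q)) \<partial>lborel \<partial>lborel) =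
        (\<integral>\<^sup>+y. \<integral>\<^sup>+q. ennreal (cmod (fourier u q)) * ennreal (cmod (v y)) \<partial>lborel \<partial>lborel)"
      by (simp add: f_def norm_mult ennreal_mult)
    also have "\<dots> = (\<integral>\<^sup>+q. ennreal (cmod (fourier u q)) \<partial>lborel) * (\<integral>\<^sup>+y. ennreal (cmod (v y)) \<partial>lborel)"
      by (simp add: nn_integral_multc nn_integral_cmult)
    also have "\<dots> < \<infinity>" using ui vi by (auto simp: integrable_iff_bounded ennreal_mult_less_top)
    finally show "(\<integral>\<^sup>+y. \<integral>\<^sup>+q. ennreal (cmod (f y q)) \<partial>lborel \<partial>lborel) < \<infinity>" .
  qed
  have "complex_of_real ((2 * pi) ^ DIM('a)) * fourier (\<lambda>q. u q * v q) p =
      (LINT y|lborel. complex_of_real ((2 * pi) ^ DIM('a)) * (cis (- (y \<bullet> p)) * (u y * v y)))"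
    unfolding fourier_def by (rule integral_mult_right_zero[symmetric])
  also have "\<dots> = (LINT y|lborel. LINT q|lborel. f y q)"
  proof (rule Bochner_Integration.integral_cong[OF refl])
    fix y
    have "complex_of_real ((2 * pi) ^ DIM('a)) * (cis (- (y \<bullet> p)) * (u y * v y)) =
        (cis (- (y \<bullet> p)) * v y) * (complex_of_real ((2 * pi) ^ DIM('a)) * u y)" by simp
    also have "\<dots> = (cis (- (y \<bullet> p)) * v y) * (LINT q|lborel. cis (q \<bullet> y) * fourier u q)"
      by (subst fourier_inversion[OF ui schwartz_continuous[OF u] B]) simp
    also have "\<dots> = (LINT q|lborel. (cis (- (y \<bullet> p)) * v y) * (cis (q \<bullet> y) * fourier u q))"
      by (rule integral_mult_right_zero[symmetric])
    also have "\<dots> = (LINT q|lborel. f y q)"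
    proof (rule Bochner_Integration.integral_cong[OF refl])
      fix q
      have "cis (- (y \<bullet> p)) * cis (q \<bullet> y) = cis (- (y \<bullet> (p - q)))"
        by (simp add: cis_mult inner_diff_right inner_commute)
      then show "(cis (- (y \<bullet> p)) * v y) * (cis (q \<bullet> y) * fourier u q) = f y q"
        by (simp add: f_def mult_ac)
    qed
    finally show "complex_of_real ((2 * pi) ^ DIM('a)) * (cis (- (y \<bullet> p)) * (u y * v y)) = (LINT q|lborel. f y q)" .
  qed
  also have "\<dots> = (LINT q|lborel. LINT y|lborel. f y q)"
    using lborel_pair.Fubini_integral[OF int] by simp
  also have "\<dots> = (LINT q|lborel. fourier u q * fourier v (p - q))"
    unfolding f_def fourier_def[of v] by (simp only: integral_mult_right_zero)
  finally show ?thesis .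
qed

lemma norm_integral_le_nn_integral: "ennreal (norm (integral\<^sup>L M f)) \<le> (\<integral>\<^sup>+x. ennreal (norm (f x)) \<partial>M)"
proof (cases "integrable M f")
  case True
  then show ?thesis by (rule integral_norm_bound_ennreal)
next
  case False
  then show ?thesis by (simp add: not_integrable_integral_eq)
qed

lemma fourier_mult_le_conv:
  fixes u v :: "'a::euclidean_space \<Rightarrow> complex"
  assumes u: "schwartz u" and v: "schwartz v"
  shows "ennreal (cmod (fourier (\<lambda>q. u q * v q) p)) \<le>
    conv (\<lambda>q. ennreal (cmod (fourier u q))) (\<lambda>q. ennreal (cmod (fourier v q))) p"
proof -
  let ?k = "(2 * pi) ^ DIM('a)"
  \<comment> \<open>With the unnormalized transform the convolution formula carries this power of
    \<open>2 * pi\<close> on the side of the product; being at least 1, it may be dropped.\<close>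
  have "1 \<le> 2 * pi" using pi_gt3 by simp
  then have k: "1 \<le> ?k" by (rule one_le_power)
  have "cmod (fourier (\<lambda>q. u q * v q) p) \<le> ?k * cmod (fourier (\<lambda>q. u q * v q) p)"
    using k by (intro mult_le_cancel_right1[THEN iffD2]) auto
  also have "\<dots> = cmod (complex_of_real ?k * fourier (\<lambda>q. u q * v q) p)"
    by (simp only: norm_mult norm_of_real abs_of_nonneg[OF order_trans[OF zero_le_one k]])
  also have "\<dots> = cmod (LINT q|lborel. fourier u q * fourier v (p - q))"
    by (simp only: fourier_mult[OF u v])
  finally have "ennreal (cmod (fourier (\<lambda>q. u q * v q) p)) \<le> ennreal (cmod (LINT q|lborel. fourier u q * fourier v (p - q)))"
    by (rule ennreal_leI)
  also have "\<dots> \<le> (\<integral>\<^sup>+q. ennreal (cmod (fourier u q * fourier v (p - q))) \<partial>lborel)"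
    by (rule norm_integral_le_nn_integral)
  also have "\<dots> = conv (\<lambda>q. ennreal (cmod (fourier u q))) (\<lambda>q. ennreal (cmod (fourier v q))) p"
    by (simp add: conv_def norm_mult ennreal_mult)
  finally show ?thesis .
qed

section \<open>The product estimate\<close>

lemma jbr_powr_le:
  assumes "\<bar>r\<bar> \<le> x"
  shows "jbr r powr s \<le> (1 + x) ^ nat \<lceil>\<bar>s\<bar>\<rceil>"
proof -
  have "jbr r \<le> 1 + \<bar>r\<bar>"
    unfolding jbr_eq_sqrt by (rule real_le_lsqrt) (auto simp: power2_eq_square algebra_simps)
  then have x: "1 \<le> jbr r" "jbr r \<le> 1 + x" using jbr_ge(1)[of r] assms by auto
  have "jbr r powr s \<le> jbr r powr \<bar>s\<bar>" using x by (intro powr_mono) auto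
  also have "\<dots> \<le> (1 + x) powr \<bar>s\<bar>" using x by (intro powr_mono2) auto
  also have "\<dots> \<le> (1 + x) powr real (nat \<lceil>\<bar>s\<bar>\<rceil>)" using x by (intro powr_mono) linarith+
  also have "\<dots> = (1 + x) ^ nat \<lceil>\<bar>s\<bar>\<rceil>" using x by (intro powr_realpow) auto
  finally show ?thesis .
qed

text \<open>The default value 0 of a divergent integral would make \<open>hsb_norm\<close> vanish,
  so finiteness has to be known for the factors on the right-hand side. The rapid decay of the
  transform beats the polynomial growth of the weights, whatever the signs of \<open>s\<close> and
  \<open>b\<close>.\<close>

lemma sobolev_integrable:
  fixes u :: "spacetime \<Rightarrow> complex"
  assumes u: "schwartz u"
  shows "integrable lborel (\<lambda>p. (jbr (norm (snd p)) powr s * jbr (\<bar>fst p\<bar> - norm (snd p)) powr b * cmod (fourier u p))\<^sup>2)"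
proof -
  let ?W = "\<lambda>p. jbr (norm (snd p)) powr s * jbr (\<bar>fst p\<bar> - norm (snd p)) powr b * cmod (fourier u p)"
  let ?D = "DIM(spacetime) + 2"
  define m where "m = nat \<lceil>\<bar>s\<bar>\<rceil> + nat \<lceil>\<bar>b\<bar>\<rceil>"
  have [measurable]: "fourier u \<in> borel_measurable borel" by (rule fourier_measurable[OF schwartz_measurable[OF u]])
  obtain C where C: "\<And>p. cmod (fourier u p) \<le> C / (1 + norm p) ^ (m + ?D)"
    using fourier_decay[OF u, of "m + ?D"] by blast
  have W: "0 \<le> ?W p" "?W p \<le> C / (1 + norm p) ^ ?D" for p
  proof -
    show "0 \<le> ?W p" by simp
    have p: "norm (snd p) \<le> norm p" "\<bar>fst p\<bar> \<le> norm p"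
      using norm_snd_le[of "snd p" "fst p"] norm_fst_le[of "fst p" "snd p"] by auto
    have p1: "0 < 1 + norm p" by (intro add_pos_nonneg) auto
    have "?W p \<le> ((1 + norm p) ^ nat \<lceil>\<bar>s\<bar>\<rceil> * (1 + norm p) ^ nat \<lceil>\<bar>b\<bar>\<rceil>) * (C / (1 + norm p) ^ (m + ?D))"
    proof (intro mult_mono jbr_powr_le C)
      show "\<bar>\<bar>fst p\<bar> - norm (snd p)\<bar> \<le> norm p" using p norm_ge_zero[of "snd p"] by linarith
    qed (use p in auto)
    also have "\<dots> = (1 + norm p) ^ m * (C / ((1 + norm p) ^ m * (1 + norm p) ^ ?D))"
      by (simp only: m_def power_add)
    also have "\<dots> = C / (1 + norm p) ^ ?D" using p1 by (simp del: power_Suc power_add)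
    finally show "?W p \<le> C / (1 + norm p) ^ ?D" .
  qed
  have C0: "0 \<le> C" using order_trans[OF W[of 0]] by simp
  have "integrable lborel (\<lambda>p. complex_of_real ((?W p)\<^sup>2))"
  proof (rule integrable_of_decay)
    show "(\<lambda>p. complex_of_real ((?W p)\<^sup>2)) \<in> borel_measurable borel" unfolding jbr_def by measurable
    fix p :: spacetime
    have p1: "1 \<le> (1 + norm p) ^ ?D" by (intro one_le_power) auto
    have "(?W p)\<^sup>2 \<le> (C / (1 + norm p) ^ ?D)\<^sup>2" by (intro power_mono W)
    also have "\<dots> = (C\<^sup>2 / (1 + norm p) ^ ?D) / (1 + norm p) ^ ?D" by (simp only: power2_eq_square times_divide_times_eq divide_divide_eq_left)
    also have "\<dots> \<le> C\<^sup>2 / (1 + norm p) ^ ?D"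
    proof -
      have "(a / y) / y \<le> a / y" if "0 \<le> a" "1 \<le> y" for a y :: real
        using that divide_left_mono[of 1 y "a / y"] by simp
      from this[OF zero_le_power2 p1] show ?thesis .
    qed
    finally show "cmod (complex_of_real ((?W p)\<^sup>2)) \<le> C\<^sup>2 / (1 + norm p) ^ ?D" by (simp only: norm_of_real abs_power2)
  qed
  from integrable_Re[OF this] show ?thesis by (simp only: Re_complex_of_real)
qed

lemma l2sq_eq_hsb_norm:
  fixes u :: "spacetime \<Rightarrow> complex"
  assumes "integrable lborel (\<lambda>p. (jbr (norm (snd p)) powr s * jbr (\<bar>fst p\<bar> - norm (snd p)) powr b * cmod (fourier u p))\<^sup>2)"
  shows "l2sq (\<lambda>p. ennreal (jbr (norm (snd p)) powr s * jbr (\<bar>fst p\<bar> - norm (snd p)) powr b * cmod (fourier u p))) = ennreal ((hsb_norm s b u)\<^sup>2)"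
proof -
  have "0 \<le> (LINT p|lborel. (jbr (norm (snd p)) powr s * jbr (\<bar>fst p\<bar> - norm (snd p)) powr b * cmod (fourier u p))\<^sup>2)"
    by (rule Bochner_Integration.integral_nonneg) simp
  then have h: "(hsb_norm s b u)\<^sup>2 = (LINT p|lborel. (jbr (norm (snd p)) powr s * jbr (\<bar>fst p\<bar> - norm (snd p)) powr b * cmod (fourier u p))\<^sup>2)"
    unfolding hsb_norm_def by (rule real_sqrt_pow2)
  have "l2sq (\<lambda>p. ennreal (jbr (norm (snd p)) powr s * jbr (\<bar>fst p\<bar> - norm (snd p)) powr b * cmod (fourier u p))) =
      (\<integral>\<^sup>+p. ennreal ((jbr (norm (snd p)) powr s * jbr (\<bar>fst p\<bar> - norm (snd p)) powr b * cmod (fourier u p))\<^sup>2) \<partial>lborel)"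
    unfolding l2sq_def by (intro nn_integral_cong ennreal_power) simp
  also have "\<dots> = ennreal ((hsb_norm s b u)\<^sup>2)"
    unfolding h by (rule nn_integral_eq_integral[OF assms]) simp
  finally show ?thesis .
qed

lemma hsb_norm_nonneg: "0 \<le> hsb_norm s b u"
  unfolding hsb_norm_def by (intro real_sqrt_ge_zero Bochner_Integration.integral_nonneg) simp

text \<open>Duality with the product itself as test function: \<open>h\<close> is the weighted
  transform of \<open>u v\<close>, so the trilinear form bounds the square of its norm from above,
  and the surplus power of that norm cancels.\<close>

lemma is_product_of_trilinear:
  assumes C: "0 < C"
    and tri: "\<And>f g h. f \<in> borel_measurable borel \<Longrightarrow> g \<in> borel_measurable borel \<Longrightarrow> h \<in> borel_measurable borel \<Longrightarrow>
      (tri (wt s1 b1 f) (wt s2 b2 g) (wt s0 0 h))\<^sup>2 \<le> (ennreal C)\<^sup>2 * (l2sq f * l2sq g * l2sq h)"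
  shows "is_product TYPE(3) s0 s1 s2 0 b1 b2"
  unfolding is_product_def
proof (intro exI allI impI)
  fix u v :: "spacetime \<Rightarrow> complex"
  assume u: "schwartz u" and v: "schwartz v"
  define W where "W s b p = jbr (norm (snd p)) powr s * jbr (\<bar>fst p\<bar> - norm (snd p)) powr b" for s b and p :: spacetime
  let ?uv = "\<lambda>q. u q * v q"
  let ?A = "hsb_norm (- s0) (- 0) ?uv" and ?B1 = "hsb_norm s1 b1 u" and ?B2 = "hsb_norm s2 b2 v"
  have nn: "0 \<le> ?A" "0 \<le> ?B1" "0 \<le> ?B2" by (rule hsb_norm_nonneg)+
  have um: "u \<in> borel_measurable borel" and vm: "v \<in> borel_measurable borel"
    using u v by (auto intro: schwartz_measurable)
  have [measurable]: "fourier u \<in> borel_measurable borel" "fourier v \<in> borel_measurable borel" "fourier ?uv \<in> borel_measurable borel"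
    using um vm by (auto intro!: fourier_measurable borel_measurable_times)
  have [measurable]: "W s b \<in> borel_measurable borel" for s b unfolding W_def jbr_def by measurable
  have W0: "0 \<le> W s b p" for s b p by (simp add: W_def)
  have jpos: "jbr r > 0" for r using jbr_ge(1)[of r] by linarith
  have Winv: "W (- s) (- b) p * W s b p = 1" for s b p
    using jpos[of "norm (snd p)"] jpos[of "\<bar>fst p\<bar> - norm (snd p)"] by (simp add: W_def powr_minus field_simps)
  show "?A \<le> C * ?B1 * ?B2"
  proof (cases "integrable lborel (\<lambda>p. (W (- s0) (- 0) p * cmod (fourier ?uv p))\<^sup>2)")
    \<comment> \<open>Here \<open>?A\<close> is 0 by the default value of a divergent integral. In
      the other case \<open>?A\<close> is a true finite norm, as the final cancellation
      requires.\<close>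
    case False
    then have "?A = 0" by (simp add: hsb_norm_def W_def not_integrable_integral_eq)
    then show ?thesis using C nn by simp
  next
    case True
    define f where "f p = ennreal (W s1 b1 p * cmod (fourier u p))" for p
    define g where "g p = ennreal (W s2 b2 p * cmod (fourier v p))" for p
    define h where "h p = ennreal (W (- s0) (- 0) p * cmod (fourier ?uv p))" for p
    have m: "f \<in> borel_measurable borel" "g \<in> borel_measurable borel" "h \<in> borel_measurable borel"
      unfolding f_def g_def h_def by measurable
    have lf: "l2sq f = ennreal (?B1\<^sup>2)" and lg: "l2sq g = ennreal (?B2\<^sup>2)"
      unfolding f_def g_def W_def using sobolev_integrable[OF u] sobolev_integrable[OF v] by (auto intro: l2sq_eq_hsb_norm)
    have lh: "l2sq h = ennreal (?A\<^sup>2)"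
      using True unfolding h_def W_def by (rule l2sq_eq_hsb_norm)
    have wf: "wt s1 b1 f = (\<lambda>p. ennreal (cmod (fourier u p)))" and wg: "wt s2 b2 g = (\<lambda>p. ennreal (cmod (fourier v p)))"
      by (auto simp: fun_eq_iff wt_def f_def g_def W_def[symmetric] W0 ennreal_mult[symmetric] mult.assoc[symmetric] Winv)
    have "l2sq h \<le> (\<integral>\<^sup>+p. wt s0 0 h p * conv (wt s1 b1 f) (wt s2 b2 g) p \<partial>lborel)"
      unfolding l2sq_def
    proof (rule nn_integral_mono)
      fix p
      have "(h p)\<^sup>2 = h p * (ennreal (W (- s0) (- 0) p) * ennreal (cmod (fourier ?uv p)))"
        using W0 by (simp add: h_def power2_eq_square ennreal_mult)
      also have "\<dots> \<le> h p * (ennreal (W (- s0) (- 0) p) * conv (wt s1 b1 f) (wt s2 b2 g) p)"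
        unfolding wf wg by (intro mult_left_mono fourier_mult_le_conv u v) auto
      also have "\<dots> = wt s0 0 h p * conv (wt s1 b1 f) (wt s2 b2 g) p"
        by (simp add: wt_def W_def mult_ac)
      finally show "(h p)\<^sup>2 \<le> wt s0 0 h p * conv (wt s1 b1 f) (wt s2 b2 g) p" .
    qed
    also have "\<dots> = tri (wt s1 b1 f) (wt s2 b2 g) (wt s0 0 h)"
      by (rule tri_eq_conv[symmetric]) (use m in measurable)
    finally have "(l2sq h)\<^sup>2 \<le> (tri (wt s1 b1 f) (wt s2 b2 g) (wt s0 0 h))\<^sup>2" by (intro power_mono) auto
    also have "\<dots> \<le> (ennreal C)\<^sup>2 * (l2sq f * l2sq g * l2sq h)" by (rule tri[OF m])
    finally have "(ennreal (?A\<^sup>2))\<^sup>2 \<le> (ennreal C)\<^sup>2 * (ennreal (?B1\<^sup>2) * ennreal (?B2\<^sup>2) * ennreal (?A\<^sup>2))"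
      unfolding lf lg lh .
    also have "\<dots> = ennreal (C\<^sup>2 * (?B1\<^sup>2 * ?B2\<^sup>2 * ?A\<^sup>2))"
      using C by (simp add: ennreal_mult ennreal_power)
    finally have "(?A\<^sup>2)\<^sup>2 \<le> C\<^sup>2 * (?B1\<^sup>2 * ?B2\<^sup>2 * ?A\<^sup>2)"
      by (simp add: ennreal_power)
    then have "?A\<^sup>2 * ?A\<^sup>2 \<le> (C * ?B1 * ?B2)\<^sup>2 * ?A\<^sup>2"
      by (simp add: power_mult_distrib power2_eq_square mult_ac)
    show ?thesis
    proof (cases "?A = 0")
      case True
      then show ?thesis using C nn by simp
    next
      case False
      then have "0 < ?A\<^sup>2" by simp
      with \<open>?A\<^sup>2 * ?A\<^sup>2 \<le> (C * ?B1 * ?B2)\<^sup>2 * ?A\<^sup>2\<close> have "?A\<^sup>2 \<le> (C * ?B1 * ?B2)\<^sup>2"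
        by (rule mult_right_le_imp_le)
      then show ?thesis using C nn by (intro power2_le_imp_le[of ?A]) auto
    qed
  qed
qed

lemma is_product_of_admissible:
  assumes ad: "admissible s0 s1 s2 b1' b2'" and b: "b1' \<le> b1" "b2' \<le> b2"
  shows "is_product TYPE(3) s0 s1 s2 0 b1 b2"
proof -
  obtain C where C: "0 < C"
    "\<And>f g h. f \<in> borel_measurable borel \<Longrightarrow> g \<in> borel_measurable borel \<Longrightarrow> h \<in> borel_measurable borel \<Longrightarrow>
      (tri (wt s1 b1' f) (wt s2 b2' g) (wt s0 0 h))\<^sup>2 \<le> (ennreal C)\<^sup>2 * (l2sq f * l2sq g * l2sq h)"
    using weighted_trilinear_bound[OF ad] by blast
  show ?thesis
  proof (rule is_product_of_trilinear[OF C(1)])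
    fix f g h :: "spacetime \<Rightarrow> ennreal"
    assume m: "f \<in> borel_measurable borel" "g \<in> borel_measurable borel" "h \<in> borel_measurable borel"
    have "(tri (wt s1 b1 f) (wt s2 b2 g) (wt s0 0 h))\<^sup>2 \<le> (tri (wt s1 b1' f) (wt s2 b2' g) (wt s0 0 h))\<^sup>2"
      using b by (intro power_mono tri_mono wt_mono) auto
    also have "\<dots> \<le> (ennreal C)\<^sup>2 * (l2sq f * l2sq g * l2sq h)" by (rule C(2)[OF m])
    finally show "(tri (wt s1 b1 f) (wt s2 b2 g) (wt s0 0 h))\<^sup>2 \<le> (ennreal C)\<^sup>2 * (l2sq f * l2sq g * l2sq h)" .
  qed
qed

theorem theoremP:
  fixes s0 s1 s2 b1 b2 :: real
  defines "S \<equiv> s0 + s1 + s2"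
  assumes a1: "b1 > 0" and a2: "b2 > 0"
    and b: "b1 + b2 \<ge> 1/2"
    and c: "S \<ge> 2 - (b1 + b2)"
    and d: "S \<ge> 3/2 - b1"
    and e: "S \<ge> 3/2 - b2"
    and f: "S \<ge> 1"
    and g: "s0 + 2 * (s1 + s2) \<ge> 3/2"
    and h: "s1 + s2 \<ge> 0"
    and i: "s0 + s2 \<ge> 0"
    and j: "s0 + s1 \<ge> 0"
    and ex1: "b1 = 1/2 \<Longrightarrow> S > 2 - (b1 + b2) \<and> S > 3/2 - b1"
    and ex2: "b2 = 1/2 \<Longrightarrow> S > 2 - (b1 + b2) \<and> S > 3/2 - b2"
    and ex3: "b1 + b2 = 1 \<Longrightarrow> S > 2 - (b1 + b2)"
    and ex4: "s0 \<in> {1/2, 3/2, 3/2 - 2*b1, 3/2 - 2*b2, 5/2 - 2*(b1 + b2)} \<Longrightarrow>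
              s0 + 2 * (s1 + s2) > 3/2"
    and ex5: "S = 2 - (b1 + b2) \<or> S = 3/2 - b1 \<or> S = 3/2 - b2 \<or> S = 1 \<Longrightarrow>
              s1 + s2 > 0 \<and> s0 + s2 > 0 \<and> s0 + s1 > 0"
  shows "is_product TYPE(3) s0 s1 s2 0 b1 b2"
proof -
  define t where "t = theta b1 b2"
  \<comment> \<open>The four values of \<open>t\<close> turn \<open>1 + t \<le> S\<close> into (f),
    (d), (e) and (c), and \<open>1/2 + 2 * t\<close> into the exceptional values of
    \<open>s0\<close> other than \<open>3/2\<close>.\<close>
  have t: "t \<in> {0, 1/2 - b1, 1/2 - b2, 1 - (b1 + b2)}"
    by (auto simp: t_def theta_def max_def)
  have tS: "1 + t \<le> S" using t c d e f by auto
  have tG: "3/2 < s0 + 2 * (s1 + s2)" if "s0 = 1/2 + 2 * t" using t that by (intro ex4) auto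
  show ?thesis
  proof (cases "b1 = 1/2 \<or> b2 = 1/2")
    case False
    have "admissible s0 s1 s2 b1 b2"
      unfolding admissible_def t_def[symmetric]
    proof (intro conjI impI)
      assume "s0 + s1 + s2 = 1 + t"
      then have "S = 2 - (b1 + b2) \<or> S = 3/2 - b1 \<or> S = 3/2 - b2 \<or> S = 1" using t by (auto simp: S_def)
      from ex5[OF this] show "0 < s1 + s2" "0 < s0 + s2" "0 < s0 + s1" by auto
    qed (use False a1 a2 b g h i j tS tG ex4 in \<open>auto simp: S_def\<close>)
    then show ?thesis by (rule is_product_of_admissible) auto
  next
    case True
    txt \<open>Lowering an exponent equal to \<open>1/2\<close> slightly avoids logarithmic sums; the strict inequalities leave room.\<close>
    have gap: "1 + t < S"
      using True ex1 ex2 c d e f by (auto simp: t_def theta_def max_def)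
    \<comment> \<open>The distance of \<open>s0\<close> from an exceptional value. If it is 0, (g)
      is strict already; otherwise \<open>\<delta> \<le> x / 8\<close> lets \<open>2 * theta\<close>
      move by at most \<open>x / 2\<close>, so it cannot reach \<open>s0 - 1/2\<close>.\<close>
    define x where "x = \<bar>s0 - (1/2 + 2 * t)\<bar>"
    \<comment> \<open>In this order the bounds keep both exponents positive, \<open>S\<close>
      strictly above \<open>1 + theta\<close>, the sum of the exponents at least \<open>1/2\<close>,
      and \<open>s0\<close> off the shifted exceptional value.\<close>
    define \<delta> where "\<delta> = min (min (b1 / 2) (b2 / 2)) (min ((S - (1 + t)) / 4) (min ((b1 + b2 - 1/2) / 2) (if x = 0 then 1 else x / 8)))"
    have "0 < b1 / 2" "0 < b2 / 2" "0 < (S - (1 + t)) / 4" "0 < (b1 + b2 - 1/2) / 2" "0 < (if x = 0 then 1 else x / 8)"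
      using True a1 a2 gap by (auto simp: x_def)
    then have "0 < \<delta>" unfolding \<delta>_def by (simp only: min_less_iff_conj)
    moreover have "\<delta> \<le> b1 / 2" "\<delta> \<le> b2 / 2" "\<delta> \<le> (S - (1 + t)) / 4" "\<delta> \<le> (b1 + b2 - 1/2) / 2"
        "\<delta> \<le> (if x = 0 then 1 else x / 8)"
      unfolding \<delta>_def by (simp_all only: min_le_iff_disj order_refl simp_thms)
    ultimately have \<delta>: "0 < \<delta>" "\<delta> \<le> b1 / 2" "\<delta> \<le> b2 / 2" "\<delta> \<le> (S - (1 + t)) / 4" "\<delta> \<le> (b1 + b2 - 1/2) / 2"
      and \<delta>x: "x \<noteq> 0 \<Longrightarrow> \<delta> \<le> x / 8"
      by simp_all
    define b1' where "b1' = (if b1 = 1/2 then b1 - \<delta> else b1)"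
    define b2' where "b2' = (if b2 = 1/2 then b2 - \<delta> else b2)"
    have t': "t < theta b1' b2'" "theta b1' b2' \<le> t + 2 * \<delta>"
    proof -
      have "max 0 (1/2 - b1') = max 0 (1/2 - b1) + (if b1 = 1/2 then \<delta> else 0)"
        "max 0 (1/2 - b2') = max 0 (1/2 - b2) + (if b2 = 1/2 then \<delta> else 0)"
        using \<delta>(1) by (simp_all add: b1'_def b2'_def)
      then have "theta b1' b2' = t + (if b1 = 1/2 then \<delta> else 0) + (if b2 = 1/2 then \<delta> else 0)"
        by (simp only: t_def theta_def)
      then show "t < theta b1' b2'" "theta b1' b2' \<le> t + 2 * \<delta>" using True \<delta>(1) by (simp_all split: if_splits)
    qed
    have "admissible s0 s1 s2 b1' b2'"
      unfolding admissible_def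
    proof (intro conjI impI)
      assume s: "s0 \<in> {3/2, 1/2 + 2 * theta b1' b2'}"
      show "3/2 < s0 + 2 * (s1 + s2)"
      proof (cases "x = 0 \<or> s0 = 3/2")
        case True
        then show ?thesis using tG ex4 by (auto simp: x_def)
      next
        case False
        then have "x = 2 * (theta b1' b2' - t)" using s t' by (auto simp: x_def)
        then show ?thesis using \<delta>x False t' \<delta>(1) by auto
      qed
    qed (use True a1 a2 b g h i j \<delta> t' gap in \<open>auto simp: S_def b1'_def b2'_def\<close>)
    then show ?thesis by (rule is_product_of_admissible) (use \<delta>(1) in \<open>auto simp: b1'_def b2'_def\<close>)
  qed
qed

end
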